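(* Let $\beta,L>0$, $\alpha\in(0,1)$, and let $(\phi_n)_{n\in\mathbb{N}}$ be a sequence of tests (measurable functions $\phi_n:\mathbb{R}^{n+1}\to[0,1]$) satisfying $\sup_{c>0}\mathbb{E}_c[\phi_n(\mathbf{Z}_n)]\le\alpha$ for every $n$, the supremum being over all constant volatilities $\sigma\equiv c>0$ (the null hypothesis $H_0$). Then for arbitrary numbers $\epsilon_n>0$ with $\lim_{n\to\infty}\epsilon_n=0$ and $\lim_{n\to\infty}\epsilon_n^2\log(n)=\infty$ there exists a constant $c=c(\beta,L)>0$, depending only on $\beta$ and $L$, such that $$\limsup_{n\to\infty}\ \inf_{\substack{\sigma:\ \sigma^2/\|\sigma\|_{L^2}^2\in\mathcal{H}(\beta,L),\\ d_J(\sigma,H_0)\ge(1-\epsilon_n)c\,\rho_n}}\mathbb{E}_\sigma[\phi_n(\mathbf{Z}_n)]\le\alpha$$ for any fixed nondegenerate compact interval $J\subset(0,1)$. In case $\beta\in(0,1]$ the result holds true for $c=c_*(\beta,L)$.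
   Context: Model: for a measurable $\sigma:[0,1]\to(0,\infty)$ (square integrable), under $\mathbb{P}_\sigma$ (expectation $\mathbb{E}_\sigma$) the process $Z=(Z_t)_{t\in[0,1]}$ is given by $dZ_t=\sigma(t)\,dW_t$, $Z_0=z_0\in\mathbb{R}$ fixed, with $W$ a standard Brownian motion. The observations are $\mathbf{Z}_n=(Z_0,Z_{1/n},\dots,Z_{(n-1)/n},Z_1)$; thus under $\mathbb{P}_\sigma$ the increments $Z_{k/n}-Z_{(k-1)/n}$ are independent with law $\mathcal{N}\big(0,\int_{(k-1)/n}^{k/n}\sigma(s)^2ds\big)$. For a constant $c>0$, $\mathbb{E}_c$ denotes $\mathbb{E}_\sigma$ with $\sigma\equiv c$. $\|\sigma\|_{L^2}^2=\int_0^1\sigma(s)^2ds$, and the distance to constancy is $d_J(\sigma,H_0)=\sup_{t\in J}\left|\frac{\sigma(t)^2}{\|\sigma\|_{L^2}^2}-1\right|$. Hölder class: $\lfloor\beta\rfloor$ denotes the largest integer strictly smaller than $\beta$; $\mathcal{H}(\beta,L)$ is the class of functions $f$ whose first $\lfloor\beta\rfloor$ derivatives exist and satisfy $|f^{(\lfloor\beta\rfloor)}(x)-f^{(\lfloor\beta\rfloor)}(y)|\le L|x-y|^{\beta-\lfloor\beta\rfloor}$ for all $x,y$ in the domain (here the domain is $[0,1]$ for $\sigma^2/\|\sigma\|_{L^2}^2$). Rate: $\rho_n=\rho_n(\beta)=\left(\frac{\log n}{n}\right)^{\beta/(2\beta+1)}$. Constant, for $\beta\in(0,1]$: $c_*=c_*(\beta,L)=\left(\frac{4L^{1/\beta}}{(2\beta+1)\|\psi_\beta\|_{L^2}^2}\right)^{\beta/(2\beta+1)}$,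 where $\psi_\beta$ is the optimal recovery kernel, i.e. the minimizer of $\|\psi\|_{L^2(\mathbb{R})}$ over all $\psi\in\mathcal{H}(\beta,1)$ on $\mathbb{R}$ with $\psi(0)\ge1$; for $0<\beta\le1$ it is $\psi_\beta(x)=(1-|x|^\beta)\mathbf{1}_{\{|x|\le1\}}$. *)

theory Defs
  imports "HOL-Probability.Probability"
begin

definition L2_norm :: "real set \<Rightarrow> (real \<Rightarrow> real) \<Rightarrow> real" where
  "L2_norm D f = sqrt (LINT x:D|lborel. (f x)\<^sup>2)"

section \<open>Hoelder classes\<close>

text \<open>The largest integer strictly smaller than \<open>\<beta>\<close>, for \<open>\<beta> > 0\<close>; e.g. it is 0 at \<open>\<beta> = 1\<close>.\<close>

definition strict_floor :: "real \<Rightarrow> nat" where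
  "strict_floor \<beta> = nat (\<lceil>\<beta>\<rceil> - 1)"

text \<open>The function \<open>g i\<close> is the \<open>i\<close>-th derivative of \<open>f\<close> on \<open>D\<close>. Derivatives are
  taken within \<open>D\<close>, hence one-sided at the end points of an interval, and the values of
  \<open>f\<close> outside of \<open>D\<close> play no role.\<close>

definition hoelder_class :: "real set \<Rightarrow> real \<Rightarrow> real \<Rightarrow> (real \<Rightarrow> real) set" where
  "hoelder_class D \<beta> L = {f. \<exists>g :: nat \<Rightarrow> real \<Rightarrow> real.
     (\<forall>x\<in>D. g 0 x = f x) \<and>
     (\<forall>i<strict_floor \<beta>. \<forall>x\<in>D. (g i has_real_derivative g (Suc i) x) (at x within D)) \<and>
     (\<forall>x\<in>D. \<forall>y\<in>D. \<bar>g (strict_floor \<beta>) x - g (strict_floor \<beta>) y\<bar>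
        \<le> L * \<bar>x - y\<bar> powr (\<beta> - real (strict_floor \<beta>)))}"

section \<open>Brownian motion and Wiener integrals on the unit interval\<close>

definition brownian_motion :: "'a measure \<Rightarrow> (real \<Rightarrow> 'a \<Rightarrow> real) \<Rightarrow> bool" where
  "brownian_motion M W \<longleftrightarrow> prob_space M \<and>
     (\<forall>t\<in>{0..1}. W t \<in> borel_measurable M) \<and>
     (AE \<omega> in M. W 0 \<omega> = 0) \<and>
     (\<forall>s t. 0 \<le> s \<and> s < t \<and> t \<le> 1 \<longrightarrow>
        distributed M lborel (\<lambda>\<omega>. W t \<omega> - W s \<omega>) (normal_density 0 (sqrt (t - s)))) \<and>
     (\<forall>(m::nat) t. mono_on {..m} t \<and> t ` {..m} \<subseteq> {0..1} \<longrightarrow>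
        prob_space.indep_vars M (\<lambda>_. borel) (\<lambda>i \<omega>. W (t (Suc i)) \<omega> - W (t i) \<omega>) {..<m}) \<and>
     (AE \<omega> in M. continuous_on {0..1} (\<lambda>t. W t \<omega>))"

text \<open>Step functions with values \<open>a i\<close> on the intervals \<open>(t i, t (i+1)]\<close>, \<open>i < m\<close>.\<close>

definition step_function :: "nat \<Rightarrow> (nat \<Rightarrow> real) \<Rightarrow> (nat \<Rightarrow> real) \<Rightarrow> real \<Rightarrow> real" where
  "step_function m t a x = (\<Sum>i<m. a i * indicator {t i<..t (Suc i)} x)"

definition step_integral ::
    "(real \<Rightarrow> 'a \<Rightarrow> real) \<Rightarrow> nat \<Rightarrow> (nat \<Rightarrow> real) \<Rightarrow> (nat \<Rightarrow> real) \<Rightarrow> 'a \<Rightarrow> real" where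
  "step_integral W m t a \<omega> = (\<Sum>i<m. a i * (W (t (Suc i)) \<omega> - W (t i) \<omega>))"

text \<open>\<open>X\<close> is a version of the stochastic integral over \<open>[0,1]\<close> of the deterministic
  function \<open>f\<close> against \<open>W\<close>: the \<open>L\<^sup>2\<close>-limit of the integrals of step functions which
  approximate \<open>f\<close> in \<open>L\<^sup>2([0,1])\<close>. By the Ito isometry the limit is almost surely the
  same for all approximating sequences.\<close>

definition has_wiener_integral ::
    "'a measure \<Rightarrow> (real \<Rightarrow> 'a \<Rightarrow> real) \<Rightarrow> (real \<Rightarrow> real) \<Rightarrow> ('a \<Rightarrow> real) \<Rightarrow> bool" where
  "has_wiener_integral M W f X \<longleftrightarrow> X \<in> borel_measurable M \<and>
     (\<exists>(m :: nat \<Rightarrow> nat) t a.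
        (\<forall>j. mono_on {..m j} (t j) \<and> t j ` {..m j} \<subseteq> {0..1}) \<and>
        (\<lambda>j. \<integral>\<^sup>+x\<in>{0..1}. ennreal ((step_function (m j) (t j) (a j) x - f x)\<^sup>2) \<partial>lborel)
          \<longlonglongrightarrow> 0 \<and>
        (\<lambda>j. \<integral>\<^sup>+\<omega>. ennreal ((step_integral W (m j) (t j) (a j) \<omega> - X \<omega>)\<^sup>2) \<partial>M)
          \<longlonglongrightarrow> 0)"

section \<open>The volatility model\<close>

text \<open>Volatilities are functions on \<open>[0,1]\<close>; their values elsewhere are irrelevant.\<close>

definition volatility :: "(real \<Rightarrow> real) \<Rightarrow> bool" where
  "volatility \<sigma> \<longleftrightarrow> set_borel_measurable lborel {0..1} \<sigma> \<and> (\<forall>t\<in>{0..1}. 0 < \<sigma> t) \<and>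
     set_integrable lborel {0..1} (\<lambda>t. (\<sigma> t)\<^sup>2)"

text \<open>Under \<open>M\<close> one has \<open>dZ\<^sub>t = \<sigma>(t) dW\<^sub>t\<close>, \<open>Z\<^sub>0 = z0\<close> for some Brownian motion \<open>W\<close>,
  that is, \<open>Z\<^sub>t - z0\<close> is the integral of \<open>\<sigma>\<close> over \<open>[0,t]\<close> against \<open>W\<close>.\<close>

definition volatility_model ::
    "'a measure \<Rightarrow> real \<Rightarrow> (real \<Rightarrow> real) \<Rightarrow> (real \<Rightarrow> 'a \<Rightarrow> real) \<Rightarrow> bool" where
  "volatility_model M z0 \<sigma> Z \<longleftrightarrow>
     (AE \<omega> in M. Z 0 \<omega> = z0) \<and>
     (AE \<omega> in M. continuous_on {0..1} (\<lambda>t. Z t \<omega>)) \<and>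
     (\<exists>W. brownian_motion M W \<and>
        (\<forall>t\<in>{0..1}. Z t \<in> borel_measurable M \<and>
           has_wiener_integral M W (\<lambda>s. indicator {0..t} s * \<sigma> s) (\<lambda>\<omega>. Z t \<omega> - z0)))"

definition observations :: "nat \<Rightarrow> (real \<Rightarrow> 'a \<Rightarrow> real) \<Rightarrow> 'a \<Rightarrow> nat \<Rightarrow> real" where
  "observations n Z \<omega> = (\<lambda>k\<in>{..n}. Z (real k / real n) \<omega>)"

text \<open>\<open>\<real>\<^bsup>n+1\<^esup>\<close> is the space of the product measure space indexed by \<open>{..n}\<close>.\<close>

definition is_test :: "nat \<Rightarrow> ((nat \<Rightarrow> real) \<Rightarrow> real) \<Rightarrow> bool" where
  "is_test n \<phi> \<longleftrightarrow> \<phi> \<in> borel_measurable (\<Pi>\<^sub>M k\<in>{..n}. borel) \<and>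
     (\<forall>x \<in> space (\<Pi>\<^sub>M k\<in>{..n}. (borel :: real measure)). \<phi> x \<in> {0..1})"

definition normalized_sq :: "(real \<Rightarrow> real) \<Rightarrow> real \<Rightarrow> real" where
  "normalized_sq \<sigma> t = (\<sigma> t)\<^sup>2 / (L2_norm {0..1} \<sigma>)\<^sup>2"

definition dist_const :: "real set \<Rightarrow> (real \<Rightarrow> real) \<Rightarrow> ereal" where
  "dist_const J \<sigma> = (SUP t\<in>J. ereal \<bar>normalized_sq \<sigma> t - 1\<bar>)"

definition rate :: "real \<Rightarrow> nat \<Rightarrow> real" where
  "rate \<beta> n = (ln (real n) / real n) powr (\<beta> / (2 * \<beta> + 1))"

section \<open>The optimal recovery kernel and the sharp constant\<close>

text \<open>Square integrability is part of the class, so that the \<open>L\<^sup>2\<close>-norm to be minimized is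
  the true norm and not a Bochner integral of a non-integrable function.\<close>

definition recovery_class :: "real \<Rightarrow> (real \<Rightarrow> real) set" where
  "recovery_class \<beta> = {\<psi> \<in> hoelder_class UNIV \<beta> 1.
     integrable lborel (\<lambda>x. (\<psi> x)\<^sup>2) \<and> 1 \<le> \<psi> 0}"

definition recovery_kernel :: "real \<Rightarrow> real \<Rightarrow> real" where
  "recovery_kernel \<beta> = arg_min_on (L2_norm UNIV) (recovery_class \<beta>)"

definition c_star :: "real \<Rightarrow> real \<Rightarrow> real" where
  "c_star \<beta> L = (4 * L powr (1 / \<beta>) /
     ((2 * \<beta> + 1) * (L2_norm UNIV (recovery_kernel \<beta>))\<^sup>2)) powr (\<beta> / (2 * \<beta> + 1))"

text \<open>For \<open>\<beta> \<le> 1\<close> the minimizer is unique and explicit.\<close>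

lemma powr_diff_le:
  fixes u v \<beta> :: real
  assumes "0 < \<beta>" "\<beta> \<le> 1" "0 \<le> u" "u \<le> v"
  shows "v powr \<beta> - u powr \<beta> \<le> (v - u) powr \<beta>"
proof (cases "v = 0")
  case True
  then show ?thesis using assms by simp
next
  case False
  then have v: "v > 0" using assms by simp
  have le: "s \<le> s powr \<beta>" if "0 \<le> s" "s \<le> 1" for s :: real
    using powr_mono'[of \<beta> 1 s] that assms by (cases "s = 0") auto
  have "1 = u / v + (v - u) / v" using v by (simp add: field_simps)
  also have "\<dots> \<le> (u / v) powr \<beta> + ((v - u) / v) powr \<beta>"
    using v assms by (intro add_mono le) (auto simp: field_simps)
  also have "\<dots> = (u powr \<beta> + (v - u) powr \<beta>) / v powr \<beta>"
    using v assms by (simp add: powr_divide add_divide_distrib)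
  finally show ?thesis using v by (simp add: field_simps)
qed

lemma hoelder_class_le_1:
  assumes "0 < \<beta>" "\<beta> \<le> 1"
  shows "f \<in> hoelder_class D \<beta> L \<longleftrightarrow> (\<forall>x\<in>D. \<forall>y\<in>D. \<bar>f x - f y\<bar> \<le> L * \<bar>x - y\<bar> powr \<beta>)"
proof -
  have "\<lceil>\<beta>\<rceil> = 1" using assms by (simp add: ceiling_eq_iff)
  then have 0: "strict_floor \<beta> = 0" by (simp add: strict_floor_def)
  show ?thesis
    unfolding hoelder_class_def 0 mem_Collect_eq
  proof
    assume "\<forall>x\<in>D. \<forall>y\<in>D. \<bar>f x - f y\<bar> \<le> L * \<bar>x - y\<bar> powr \<beta>"
    then show "\<exists>g. (\<forall>x\<in>D. g 0 x = f x) \<and>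
      (\<forall>i<0. \<forall>x\<in>D. (g i has_real_derivative g (Suc i) x) (at x within D)) \<and>
      (\<forall>x\<in>D. \<forall>y\<in>D. \<bar>g 0 x - g 0 y\<bar> \<le> L * \<bar>x - y\<bar> powr (\<beta> - real 0))"
      by (intro exI[of _ "\<lambda>_. f"]) simp
  qed auto
qed

lemma recovery_kernel_le_1:
  assumes b: "0 < \<beta>" "\<beta> \<le> 1"
  shows "recovery_kernel \<beta> = (\<lambda>x. (1 - \<bar>x\<bar> powr \<beta>) * indicator {-1..1} x)"
proof -
  define k :: "real \<Rightarrow> real" where "k = (\<lambda>x. (1 - \<bar>x\<bar> powr \<beta>) * indicator {-1..1} x)"
  have le1: "\<bar>x\<bar> powr \<beta> \<le> 1 \<longleftrightarrow> x \<in> {-1..1}" for x :: real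
  proof (cases "\<bar>x\<bar> \<le> 1")
    case True
    then show ?thesis using powr_mono2[of \<beta> "\<bar>x\<bar>" 1] b by auto
  next
    case False
    then have "1 < \<bar>x\<bar> powr \<beta>" using powr_less_mono2[of \<beta> 1 "\<bar>x\<bar>"] b by simp
    with False show ?thesis by (simp add: abs_le_iff) linarith
  qed
  have k: "k x = max 0 (1 - \<bar>x\<bar> powr \<beta>)" for x
    using le1[of x] by (auto simp: k_def indicator_def)
  have hold: "\<bar>\<bar>x\<bar> powr \<beta> - \<bar>y\<bar> powr \<beta>\<bar> \<le> \<bar>x - y\<bar> powr \<beta>" for x y :: real
  proof -
    have *: "\<bar>v\<bar> powr \<beta> - \<bar>u\<bar> powr \<beta> \<le> \<bar>v - u\<bar> powr \<beta>" if "\<bar>u\<bar> \<le> \<bar>v\<bar>" for u v :: real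
    proof -
      have "\<bar>v\<bar> powr \<beta> - \<bar>u\<bar> powr \<beta> \<le> (\<bar>v\<bar> - \<bar>u\<bar>) powr \<beta>"
        using that b by (intro powr_diff_le) auto
      also have "\<dots> \<le> \<bar>v - u\<bar> powr \<beta>" using that b by (intro powr_mono2) auto
      finally show ?thesis .
    qed
    have mono: "\<bar>u\<bar> powr \<beta> \<le> \<bar>v\<bar> powr \<beta>" if "\<bar>u\<bar> \<le> \<bar>v\<bar>" for u v :: real
      using that b by (intro powr_mono2) auto
    show ?thesis
      using *[of x y] *[of y x] mono[of x y] mono[of y x] by (cases "\<bar>x\<bar> \<le> \<bar>y\<bar>") (auto simp: abs_minus_commute)
  qed
  have kint: "integrable lborel (\<lambda>x. (k x)\<^sup>2)"
  proof (rule Bochner_Integration.integrable_bound)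
    show "integrable lborel (indicator {-1..1} :: real \<Rightarrow> real)" by simp
    have "(k x)\<^sup>2 \<le> indicator {-1..1} x" for x
    proof (cases "x \<in> {-1..1}")
      case True
      then have "0 \<le> k x" "k x \<le> 1" using le1[of x] by (auto simp: k)
      then show ?thesis using True by (simp add: power_le_one)
    qed (auto simp: k_def)
    then show "AE x in lborel. norm ((k x)\<^sup>2) \<le> norm (indicator {-1..1} x :: real)"
      by (intro AE_I2) simp
  qed (simp add: k_def)
  have kin: "k \<in> recovery_class \<beta>"
  proof -
    have "\<bar>k x - k y\<bar> \<le> 1 * \<bar>x - y\<bar> powr \<beta>" for x y
      using hold[of x y] unfolding k by (simp add: max_def abs_if split: if_splits)
    then show ?thesis
      using kint b by (simp add: recovery_class_def hoelder_class_le_1[OF b] k)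
  qed
  have nrm: "L2_norm UNIV f = sqrt (\<integral>x. (f x)\<^sup>2 \<partial>lborel)" for f
    by (simp add: L2_norm_def set_lebesgue_integral_def)
  have dom: "k x \<le> \<bar>f x\<bar>" "1 - \<bar>x\<bar> powr \<beta> \<le> f x" if "f \<in> recovery_class \<beta>" for f x
  proof -
    have "\<bar>f 0 - f x\<bar> \<le> 1 * \<bar>0 - x\<bar> powr \<beta>" "1 \<le> f 0"
      using that unfolding recovery_class_def mem_Collect_eq hoelder_class_le_1[OF b] by blast+
    then show "1 - \<bar>x\<bar> powr \<beta> \<le> f x" "k x \<le> \<bar>f x\<bar>" by (auto simp: k)
  qed
  have sq: "(k x)\<^sup>2 \<le> (f x)\<^sup>2" if "f \<in> recovery_class \<beta>" for f x
  proof -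
    have "(k x)\<^sup>2 \<le> \<bar>f x\<bar>\<^sup>2" using dom(1)[OF that] by (intro power_mono) (auto simp: k)
    then show ?thesis by simp
  qed
  have kmin: "L2_norm UNIV k \<le> L2_norm UNIV f" if "f \<in> recovery_class \<beta>" for f
    unfolding nrm using that sq[OF that] kint
    by (auto intro!: integral_mono simp: recovery_class_def)
  have uniq: "f = k" if f: "f \<in> recovery_class \<beta>" and fk: "L2_norm UNIV f \<le> L2_norm UNIV k" for f
  proof -
    have fint: "integrable lborel (\<lambda>x. (f x)\<^sup>2)" using f by (simp add: recovery_class_def)
    have "(\<integral>x. (f x)\<^sup>2 - (k x)\<^sup>2 \<partial>lborel) = 0"
      using kmin[OF f] fk fint kint by (simp add: nrm)
    then have ae: "AE x in lborel. (f x)\<^sup>2 - (k x)\<^sup>2 = 0"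
      using integral_nonneg_eq_0_iff_AE[of lborel "\<lambda>x. (f x)\<^sup>2 - (k x)\<^sup>2"] fint kint sq[OF f] by auto
    have cont: "continuous_on UNIV g" if "g \<in> recovery_class \<beta>" for g
    proof -
      have g: "\<bar>g y - g x\<bar> \<le> \<bar>y - x\<bar> powr \<beta>" for x y
        using that by (simp add: recovery_class_def hoelder_class_le_1[OF b])
      have "(g \<longlongrightarrow> g x) (at x)" for x
      proof -
        have "((\<lambda>y. \<bar>y - x\<bar> powr \<beta>) \<longlongrightarrow> \<bar>x - x\<bar> powr \<beta>) (at x)"
          using b by (intro tendsto_powr' tendsto_intros) auto
        then have "((\<lambda>y. \<bar>y - x\<bar> powr \<beta>) \<longlongrightarrow> 0) (at x)" using b by simp
        then have "((\<lambda>y. g y - g x) \<longlongrightarrow> 0) (at x)"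
          by (rule Lim_null_comparison[rotated]) (auto intro!: always_eventually g)
        then show ?thesis by (simp add: LIM_zero_iff)
      qed
      then show ?thesis by (simp add: continuous_on_def)
    qed
    have op: "open {x. (f x)\<^sup>2 - (k x)\<^sup>2 \<noteq> 0}"
      using cont[OF f] cont[OF kin] by (intro open_Collect_neq continuous_intros) auto
    have "{x. (f x)\<^sup>2 - (k x)\<^sup>2 \<noteq> 0} \<in> null_sets lborel"
      using ae op by (subst (asm) AE_iff_null) (auto dest: borel_open)
    then have "negligible {x. (f x)\<^sup>2 - (k x)\<^sup>2 \<noteq> 0}"
      by (simp add: negligible_iff_null_sets null_sets_completionI)
    then have "{x. (f x)\<^sup>2 - (k x)\<^sup>2 \<noteq> 0} = {}" using op open_not_negligible by blast
    then have "(f x)\<^sup>2 = (k x)\<^sup>2" for x by auto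
    then have ab: "f x = k x \<or> f x = - k x" for x using power2_eq_iff by blast
    have "f x = k x" for x
      using ab[of x] dom(2)[OF f, of x] unfolding k by (auto simp: max_def split: if_splits)
    then show ?thesis by blast
  qed
  have "is_arg_min (L2_norm UNIV) (\<lambda>f. f \<in> recovery_class \<beta>) k"
    using kin kmin by (auto simp: is_arg_min_linorder)
  then have "is_arg_min (L2_norm UNIV) (\<lambda>f. f \<in> recovery_class \<beta>) (recovery_kernel \<beta>)"
    unfolding recovery_kernel_def arg_min_on_def arg_min_def by (rule someI[of "is_arg_min (L2_norm UNIV) (\<lambda>f. f \<in> recovery_class \<beta>)"])
  then have "recovery_kernel \<beta> = k"
    using kin by (intro uniq) (auto simp: is_arg_min_linorder)
  then show ?thesis by (simp add: k_def)
qed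

end

theory Submission
  imports Defs "HOL-Computational_Algebra.Polynomial" "HOL-Real_Asymp.Real_Asymp"
begin

text \<open>Only the increments of the observed path matter. Under a continuous volatility \<open>\<sigma>\<close> they are
  independent and centred normal, with variances the integrals of \<open>\<sigma>\<^sup>2\<close> over the \<open>n\<close> cells
  (\<open>expectation_observations\<close>), so the problem is one about products of normal laws.

  The constant volatility \<open>1\<close> is compared with \<open>m\<close> alternatives \<open>\<sigma>\<^sub>j\<^sup>2 = 1 + A \<psi>((\<cdot> - t\<^sub>j) / h)\<close>, where
  \<open>\<psi>\<close> is a compactly supported kernel of Hoelder constant 1 with \<open>\<psi>(0) = 1\<close>, and the centres
  \<open>t\<^sub>j\<close> in \<open>[a, b]\<close> are so far apart that no two bumps meet the same cell. Hence the likelihood ratios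
  \<open>X\<^sub>j\<close> against the constant volatility are independent under it. The smallest power over the
  alternatives is at most their average power, which exceeds the level by at most the \<open>L\<^sup>1\<close>-distance of
  \<open>(X\<^sub>1 + ... + X\<^sub>m) / m\<close> from 1.

  The second moment of \<open>X\<^sub>j\<close> is too large for the sharp constant: it would only allow half of the critical
  energy. After truncation of the \<open>X\<^sub>j\<close> at level \<open>m\<close> the \<open>L\<^sup>1\<close>-distance is controlled by
  \<open>\<eta> = m\<^sup>-\<^sup>\<kappa> E X\<^sub>j\<^bsup>1+\<kappa>\<^esup>\<close> with a small \<open>\<kappa>\<close> (\<open>mixture_L1_bound\<close>). For normal increments
  \<open>E X\<^sub>j\<^bsup>1+\<kappa>\<^esup>\<close> is about \<open>exp (\<kappa> (1 + \<kappa>) S / 4)\<close> with \<open>S = n A\<^sup>2 h \<parallel>\<psi>\<parallel>\<^sup>2\<close>, so \<open>\<eta>\<close> tends to 0 as soon as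
  \<open>S\<close> stays below \<open>4 log m\<close> by a factor \<open>1 - \<epsilon>\<close>. With \<open>A = L h\<^sup>\<beta>\<close>, which the Hoelder condition imposes, and
  \<open>log m\<close> close to \<open>log (1/h)\<close>, hence to \<open>log n / (2\<beta> + 1)\<close>, the equation \<open>S = 4 log m\<close> determines \<open>h\<close>, and
  the corresponding \<open>A\<close> is the constant of the theorem times the rate. The slack \<open>\<epsilon>\<^sub>n\<close> is spent on
  lowering the bumps by the factor \<open>1 - \<epsilon>\<^sub>n / 2\<close>; the choice \<open>\<kappa> = \<epsilon>\<^sub>n / 4\<close> then gives
  \<open>\<eta> \<le> exp (- \<epsilon>\<^sub>n\<^sup>2 log n / (32 (2\<beta> + 1)))\<close>, which is where \<open>\<epsilon>\<^sub>n\<^sup>2 log n \<rightarrow> \<infinity>\<close> enters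
  (\<open>lower_bound_fixed_n\<close>, \<open>mixture_error_bound\<close>, \<open>limsup_power_le_level\<close>).

  For \<open>\<beta> \<le> 1\<close> the optimal recovery kernel is itself an admissible \<open>\<psi>\<close>. For \<open>\<beta> > 1\<close>, where only some
  constant is claimed, a polynomial bump serves.\<close>

section \<open>Limits of independent and of normal variables\<close>

text \<open>Convergence in \<open>L\<^sup>2\<close> passes to expectations of bounded Lipschitz functions. Probabilities of closed
  sets are recovered from them, and the closed sets generate the Borel sets.\<close>

lemma closed_indicator_lipschitz_limit:
  fixes A :: "real set"
  assumes "closed A"
  shows "\<exists>(G :: nat \<Rightarrow> real \<Rightarrow> real) C. (\<forall>m y. 0 \<le> G m y \<and> G m y \<le> 1) \<and>
    (\<forall>m. (C m)-lipschitz_on UNIV (G m)) \<and> (\<forall>y. (\<lambda>m. G m y) \<longlonglongrightarrow> indicator A y)"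
proof (cases "A = {}")
  case True
  then show ?thesis
    by (intro exI[of _ "\<lambda>_ _. 0"] exI[of _ "\<lambda>_. 0"]) (auto intro: lipschitz_intros)
next
  case False
  define G where "G = (\<lambda>(m::nat) y. max 0 (1 - real m * infdist y A))"
  show ?thesis
  proof (intro exI[of _ G] exI[of _ real] conjI allI)
    show "(real m)-lipschitz_on UNIV (G m)" for m
    proof (rule lipschitz_onI)
      fix x y :: real
      have "\<bar>real m * infdist x A - real m * infdist y A\<bar> = real m * \<bar>infdist x A - infdist y A\<bar>"
        by (simp add: abs_mult flip: right_diff_distrib)
      also have "\<dots> \<le> real m * dist x y"
        by (intro mult_left_mono infdist_triangle_abs) auto
      finally show "dist (G m x) (G m y) \<le> real m * dist x y"
        unfolding G_def dist_real_def by linarith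
    qed simp
    show "(\<lambda>m. G m y) \<longlonglongrightarrow> indicator A y" for y
    proof (cases "y \<in> A")
      case True
      then show ?thesis by (simp add: G_def)
    next
      case notin: False
      then have pos: "infdist y A > 0"
        using assms False by (metis in_closed_iff_infdist_zero infdist_nonneg less_eq_real_def)
      then obtain m0 :: nat where m0: "1 < m0 * infdist y A"
        using reals_Archimedean3 by blast
      have "G m y = 0" if "m \<ge> m0" for m
      proof -
        have "real m0 * infdist y A \<le> real m * infdist y A"
          using that pos by (intro mult_right_mono) auto
        then show ?thesis using m0 by (simp add: G_def)
      qed
      then show ?thesis
        using notin by (intro tendsto_eventually) (auto simp: eventually_sequentially)
    qed
  qed (auto simp: G_def infdist_nonneg)
qed

lemma sets_borel_eq_closed: "sets (borel :: real measure) = sigma_sets UNIV (Collect closed)"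
  unfolding borel_eq_closed by simp

lemma ennreal_square_diff_le:
  fixes u v w :: real
  shows "ennreal ((u - v)\<^sup>2) \<le> 2 * ennreal ((u - w)\<^sup>2) + 2 * ennreal ((w - v)\<^sup>2)"
proof -
  have "0 \<le> ((u - w) - (w - v))\<^sup>2" by simp
  then have "(u - v)\<^sup>2 \<le> 2 * (u - w)\<^sup>2 + 2 * (w - v)\<^sup>2"
    by (simp add: power2_eq_square algebra_simps)
  then have "ennreal ((u - v)\<^sup>2) \<le> ennreal (2 * (u - w)\<^sup>2 + 2 * (w - v)\<^sup>2)" by (rule ennreal_leI)
  then show ?thesis by (simp add: ennreal_plus ennreal_mult)
qed

lemma abs_prod_diff_le:
  fixes x y :: "'i \<Rightarrow> real"
  assumes "finite I" "\<And>i. i \<in> I \<Longrightarrow> x i \<in> {0..1}" "\<And>i. i \<in> I \<Longrightarrow> y i \<in> {0..1}"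
  shows "\<bar>(\<Prod>i\<in>I. x i) - (\<Prod>i\<in>I. y i)\<bar> \<le> (\<Sum>i\<in>I. \<bar>x i - y i\<bar>)"
  using norm_prod_diff[of I x y] assms by auto

context prob_space
begin

definition L2_limit :: "(nat \<Rightarrow> 'a \<Rightarrow> real) \<Rightarrow> ('a \<Rightarrow> real) \<Rightarrow> bool" where
  "L2_limit T X \<longleftrightarrow> (\<forall>N. T N \<in> borel_measurable M) \<and> X \<in> borel_measurable M \<and>
     (\<lambda>N. \<integral>\<^sup>+\<omega>. ennreal ((T N \<omega> - X \<omega>)\<^sup>2) \<partial>M) \<longlonglongrightarrow> 0"

lemma L2_limit_diff:
  assumes "L2_limit T X" "L2_limit S Y"
  shows "L2_limit (\<lambda>N \<omega>. T N \<omega> - S N \<omega>) (\<lambda>\<omega>. X \<omega> - Y \<omega>)"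
proof -
  have [measurable]: "T N \<in> borel_measurable M" "S N \<in> borel_measurable M"
    "X \<in> borel_measurable M" "Y \<in> borel_measurable M" for N
    using assms by (auto simp: L2_limit_def)
  let ?b = "\<lambda>N. 2 * (\<integral>\<^sup>+\<omega>. ennreal ((T N \<omega> - X \<omega>)\<^sup>2) \<partial>M) + 2 * (\<integral>\<^sup>+\<omega>. ennreal ((S N \<omega> - Y \<omega>)\<^sup>2) \<partial>M)"
  have b: "?b \<longlonglongrightarrow> 2 * 0 + 2 * 0"
    using assms by (intro tendsto_add tendsto_mult_ennreal tendsto_const) (auto simp: L2_limit_def)
  have le: "(\<integral>\<^sup>+\<omega>. ennreal ((T N \<omega> - S N \<omega> - (X \<omega> - Y \<omega>))\<^sup>2) \<partial>M) \<le> ?b N" for N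
  proof -
    have "(\<integral>\<^sup>+\<omega>. ennreal ((T N \<omega> - S N \<omega> - (X \<omega> - Y \<omega>))\<^sup>2) \<partial>M)
      \<le> (\<integral>\<^sup>+\<omega>. 2 * ennreal ((T N \<omega> - X \<omega>)\<^sup>2) + 2 * ennreal ((S N \<omega> - Y \<omega>)\<^sup>2) \<partial>M)"
    proof (rule nn_integral_mono)
      fix \<omega>
      show "ennreal ((T N \<omega> - S N \<omega> - (X \<omega> - Y \<omega>))\<^sup>2)
        \<le> 2 * ennreal ((T N \<omega> - X \<omega>)\<^sup>2) + 2 * ennreal ((S N \<omega> - Y \<omega>)\<^sup>2)"
      proof -
        have "T N \<omega> - S N \<omega> - (X \<omega> - Y \<omega>) = (T N \<omega> - X \<omega>) - (S N \<omega> - Y \<omega>)" by simp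
        then show ?thesis
          using ennreal_square_diff_le[of "T N \<omega> - X \<omega>" "S N \<omega> - Y \<omega>" 0]
          by (simp only: diff_zero diff_0 power2_minus)
      qed
    qed
    also have "\<dots> = ?b N" by (simp add: nn_integral_add nn_integral_cmult)
    finally show ?thesis .
  qed
  have "(\<lambda>N. \<integral>\<^sup>+\<omega>. ennreal ((T N \<omega> - S N \<omega> - (X \<omega> - Y \<omega>))\<^sup>2) \<partial>M) \<longlonglongrightarrow> 0"
  proof (rule tendsto_sandwich[OF _ _ tendsto_const])
    show "?b \<longlonglongrightarrow> 0" using b by simp
  qed (auto simp: le)
  then show ?thesis by (simp add: L2_limit_def)
qed

text \<open>The inequality \<open>u \<le> d + u\<^sup>2 / d\<close> turns the second moments into a bound for the first ones.\<close>

lemma L2_limit_lipschitz: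
  assumes lim: "L2_limit T X" and g: "C-lipschitz_on UNIV g"
    and bnd: "\<And>y. 0 \<le> g y" "\<And>y. g y \<le> (1::real)"
  shows "(\<lambda>N. expectation (\<lambda>\<omega>. \<bar>g (T N \<omega>) - g (X \<omega>)\<bar>)) \<longlonglongrightarrow> 0"
proof (rule LIMSEQ_I)
  fix r :: real assume r: "0 < r"
  have [measurable]: "T N \<in> borel_measurable M" "X \<in> borel_measurable M" for N
    using lim by (auto simp: L2_limit_def)
  have [measurable]: "g \<in> borel_measurable borel"
    by (intro borel_measurable_continuous_onI lipschitz_on_continuous_on[OF g])
  have C: "0 \<le> C" using lipschitz_on_nonneg[OF g] .
  define d where "d = r / (2 * (C + 1))"
  have d: "0 < d" "C * d \<le> r / 2" using r C by (auto simp: d_def field_simps)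
  have conv: "(\<lambda>N. \<integral>\<^sup>+\<omega>. ennreal ((T N \<omega> - X \<omega>)\<^sup>2) \<partial>M) \<longlonglongrightarrow> 0"
    using lim by (simp add: L2_limit_def)
  have pos: "0 < ennreal (r * d / (4 * (C + 1)))" using r d C by simp
  from order_tendstoD(2)[OF conv pos] obtain N0 where N0: "\<And>N. N \<ge> N0 \<Longrightarrow>
      (\<integral>\<^sup>+\<omega>. ennreal ((T N \<omega> - X \<omega>)\<^sup>2) \<partial>M) < ennreal (r * d / (4 * (C + 1)))"
    unfolding eventually_sequentially by auto
  have "\<bar>expectation (\<lambda>\<omega>. \<bar>g (T N \<omega>) - g (X \<omega>)\<bar>)\<bar> < r" if N: "N \<ge> N0" for N
  proof -
    let ?q = "\<lambda>\<omega>. (T N \<omega> - X \<omega>)\<^sup>2"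
    have fin: "(\<integral>\<^sup>+\<omega>. ennreal (?q \<omega>) \<partial>M) < ennreal (r * d / (4 * (C + 1)))" by (rule N0[OF N])
    then have int: "integrable M ?q"
      by (intro integrableI_nonneg) (auto simp: less_top[symmetric] top_unique)
    then have q: "expectation ?q < r * d / (4 * (C + 1))"
      using fin nn_integral_eq_integral[OF int] r d C by (simp add: ennreal_less_iff)
    have intg: "integrable M (\<lambda>\<omega>. \<bar>g (T N \<omega>) - g (X \<omega>)\<bar>)"
    proof (rule integrable_const_bound[where B = 1])
      show "AE \<omega> in M. norm \<bar>g (T N \<omega>) - g (X \<omega>)\<bar> \<le> 1"
      proof (rule AE_I2)
        fix \<omega> show "norm \<bar>g (T N \<omega>) - g (X \<omega>)\<bar> \<le> 1"
          using bnd[of "T N \<omega>"] bnd[of "X \<omega>"] by simp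
      qed
    qed simp
    have "expectation (\<lambda>\<omega>. \<bar>g (T N \<omega>) - g (X \<omega>)\<bar>) \<le> expectation (\<lambda>\<omega>. C * d + C / d * ?q \<omega>)"
    proof (rule integral_mono[OF intg])
      show "integrable M (\<lambda>\<omega>. C * d + C / d * ?q \<omega>)" using int by simp
      fix \<omega>
      let ?u = "\<bar>T N \<omega> - X \<omega>\<bar>"
      have "\<bar>g (T N \<omega>) - g (X \<omega>)\<bar> \<le> C * ?u"
        using lipschitz_onD[OF g, of "T N \<omega>" "X \<omega>"] by (simp add: dist_real_def)
      also have "?u \<le> d + ?u\<^sup>2 / d"
      proof (cases "?u \<le> d")
        case True then show ?thesis using d(1) by (simp add: add_increasing2)
      next
        case False
        then have "?u * d \<le> ?u * ?u" by (intro mult_left_mono) auto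
        then have "?u \<le> ?u\<^sup>2 / d" using d(1) by (simp add: pos_le_divide_eq power2_eq_square)
        then show ?thesis using d(1) by linarith
      qed
      then have "C * ?u \<le> C * (d + ?u\<^sup>2 / d)" by (rule mult_left_mono[OF _ C])
      also have "\<dots> = C * d + C / d * ?q \<omega>" by (simp add: distrib_left)
      finally show "\<bar>g (T N \<omega>) - g (X \<omega>)\<bar> \<le> C * d + C / d * ?q \<omega>" .
    qed
    also have "\<dots> = C * d + C / d * expectation ?q" using int by (simp add: prob_space)
    also have "\<dots> \<le> r / 2 + C / d * (r * d / (4 * (C + 1)))"
      using d(2) q C d(1) by (intro add_mono mult_left_mono) auto
    also have "\<dots> = r / 2 + r / 4 * (C / (C + 1))" using d(1) by simp
    also have "\<dots> \<le> r / 2 + r / 4 * 1" using r C by (intro add_mono mult_left_mono) auto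
    also have "\<dots> < r" using r by simp
    finally show ?thesis by (simp add: integral_nonneg_AE)
  qed
  then show "\<exists>no. \<forall>n\<ge>no. norm (expectation (\<lambda>\<omega>. \<bar>g (T n \<omega>) - g (X \<omega>)\<bar>) - 0) < r"
    by auto
qed

lemma L2_limit_lipschitz_prod:
  assumes lim: "\<And>k. k \<in> I \<Longrightarrow> L2_limit (T k) (X k)" and g: "\<And>k. k \<in> I \<Longrightarrow> (C k)-lipschitz_on UNIV (g k)"
    and bnd: "\<And>k y. 0 \<le> g k y" "\<And>k y. g k y \<le> (1::real)" and I: "finite I"
  shows "(\<lambda>N. expectation (\<lambda>\<omega>. \<Prod>k\<in>I. g k (T k N \<omega>))) \<longlonglongrightarrow> expectation (\<lambda>\<omega>. \<Prod>k\<in>I. g k (X k \<omega>))"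
proof -
  have [measurable]: "T k N \<in> borel_measurable M" "X k \<in> borel_measurable M" if "k \<in> I" for k N
    using lim[OF that] by (auto simp: L2_limit_def)
  have [measurable]: "g k \<in> borel_measurable borel" if "k \<in> I" for k
    by (intro borel_measurable_continuous_onI lipschitz_on_continuous_on[OF g[OF that]])
  have intp: "integrable M (\<lambda>\<omega>. \<Prod>k\<in>I. g k (Y k \<omega>))"
    if "\<And>k. k \<in> I \<Longrightarrow> Y k \<in> borel_measurable M" for Y
  proof (rule integrable_const_bound[where B = 1])
    show "AE \<omega> in M. norm (\<Prod>k\<in>I. g k (Y k \<omega>)) \<le> 1"
      using bnd by (auto simp: abs_prod intro!: prod_le_1)
  qed (use that in measurable)
  have inta: "integrable M (\<lambda>\<omega>. \<bar>g k (T k N \<omega>) - g k (X k \<omega>)\<bar>)" if "k \<in> I" for k N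
  proof (rule integrable_const_bound[where B = 1])
    show "AE \<omega> in M. norm \<bar>g k (T k N \<omega>) - g k (X k \<omega>)\<bar> \<le> 1"
    proof (rule AE_I2)
      fix \<omega> show "norm \<bar>g k (T k N \<omega>) - g k (X k \<omega>)\<bar> \<le> 1"
        using bnd[of k "T k N \<omega>"] bnd[of k "X k \<omega>"] by simp
    qed
  qed (use that in measurable)
  have "(\<lambda>N. \<Sum>k\<in>I. expectation (\<lambda>\<omega>. \<bar>g k (T k N \<omega>) - g k (X k \<omega>)\<bar>)) \<longlonglongrightarrow> (\<Sum>k\<in>I. 0)"
    by (intro tendsto_sum, rule L2_limit_lipschitz[OF lim g bnd])
  then have lim0: "(\<lambda>N. \<Sum>k\<in>I. expectation (\<lambda>\<omega>. \<bar>g k (T k N \<omega>) - g k (X k \<omega>)\<bar>)) \<longlonglongrightarrow> 0"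
    by simp
  have "(\<lambda>N. expectation (\<lambda>\<omega>. \<Prod>k\<in>I. g k (T k N \<omega>)) - expectation (\<lambda>\<omega>. \<Prod>k\<in>I. g k (X k \<omega>))) \<longlonglongrightarrow> 0"
  proof (rule Lim_null_comparison[OF always_eventually lim0], intro allI)
    fix N
    have int1: "integrable M (\<lambda>\<omega>. g k (Y \<omega>))" if "Y \<in> borel_measurable M" "k \<in> I" for Y k
      using that bnd by (intro integrable_const_bound[where B = 1]) auto
    have "norm (expectation (\<lambda>\<omega>. \<Prod>k\<in>I. g k (T k N \<omega>)) - expectation (\<lambda>\<omega>. \<Prod>k\<in>I. g k (X k \<omega>)))
      = norm (expectation (\<lambda>\<omega>. (\<Prod>k\<in>I. g k (T k N \<omega>)) - (\<Prod>k\<in>I. g k (X k \<omega>))))"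
      by (subst Bochner_Integration.integral_diff) (auto intro!: intp)
    also have "\<dots> \<le> expectation (\<lambda>\<omega>. \<bar>(\<Prod>k\<in>I. g k (T k N \<omega>)) - (\<Prod>k\<in>I. g k (X k \<omega>))\<bar>)"
      unfolding real_norm_def by (rule integral_abs_bound)
    also have "\<dots> \<le> expectation (\<lambda>\<omega>. \<Sum>k\<in>I. \<bar>g k (T k N \<omega>) - g k (X k \<omega>)\<bar>)"
      by (rule integral_mono)
         (auto intro!: intp inta Bochner_Integration.integrable_diff Bochner_Integration.integrable_sum
            integrable_abs int1 abs_prod_diff_le I bnd)
    also have "\<dots> = (\<Sum>k\<in>I. expectation (\<lambda>\<omega>. \<bar>g k (T k N \<omega>) - g k (X k \<omega>)\<bar>))"
      by (intro Bochner_Integration.integral_sum inta)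
    finally show "norm (expectation (\<lambda>\<omega>. \<Prod>k\<in>I. g k (T k N \<omega>)) - expectation (\<lambda>\<omega>. \<Prod>k\<in>I. g k (X k \<omega>)))
      \<le> (\<Sum>k\<in>I. expectation (\<lambda>\<omega>. \<bar>g k (T k N \<omega>) - g k (X k \<omega>)\<bar>))" .
  qed
  then show ?thesis by (simp add: LIM_zero_iff)
qed

text \<open>The product formula for expectations holds along the sequence for bounded Lipschitz functions, hence
  for the limit; Lipschitz approximation extends it to indicators of closed sets.\<close>

lemma indep_vars_L2_limit:
  fixes I :: "'i set"
  assumes I: "finite I" "I \<noteq> {}" and ind: "\<And>N. indep_vars (\<lambda>_. borel) (\<lambda>k. T k N) I"
    and lim: "\<And>k. k \<in> I \<Longrightarrow> L2_limit (T k) (X k)"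
  shows "indep_vars (\<lambda>_. borel) X I"
proof -
  have X[measurable]: "X k \<in> borel_measurable M" if "k \<in> I" for k
    using lim[OF that] by (auto simp: L2_limit_def)
  have lipind: "expectation (\<lambda>\<omega>. \<Prod>k\<in>I. g k (X k \<omega>)) = (\<Prod>k\<in>I. expectation (\<lambda>\<omega>. g k (X k \<omega>)))"
    if g: "\<And>k. (C k)-lipschitz_on UNIV (g k)" and bnd: "\<And>k y. 0 \<le> g k y" "\<And>k y. g k y \<le> 1"
    for g :: "'i \<Rightarrow> real \<Rightarrow> real" and C
  proof (rule LIMSEQ_unique[OF L2_limit_lipschitz_prod[OF lim g bnd I(1)]])
    have gm: "g k \<in> borel_measurable borel" for k
      by (intro borel_measurable_continuous_onI lipschitz_on_continuous_on[OF g])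
    have "expectation (\<lambda>\<omega>. \<Prod>k\<in>I. g k (T k N \<omega>)) = (\<Prod>k\<in>I. expectation (\<lambda>\<omega>. g k (T k N \<omega>)))" for N
    proof (rule indep_vars_lebesgue_integral[OF I(1)])
      show "indep_vars (\<lambda>_. borel) (\<lambda>k \<omega>. g k (T k N \<omega>)) I"
        by (rule indep_vars_compose2[OF ind gm])
      show "integrable M (\<lambda>\<omega>. g k (T k N \<omega>))" if "k \<in> I" for k
      proof (rule integrable_const_bound[where B = 1])
        show "(\<lambda>\<omega>. g k (T k N \<omega>)) \<in> borel_measurable M"
          using lim[OF that] by (intro measurable_compose[OF _ gm]) (auto simp: L2_limit_def)
      qed (use bnd in auto)
    qed
    moreover have "(\<lambda>N. \<Prod>k\<in>I. expectation (\<lambda>\<omega>. g k (T k N \<omega>))) \<longlonglongrightarrow> (\<Prod>k\<in>I. expectation (\<lambda>\<omega>. g k (X k \<omega>)))"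
    proof (rule tendsto_prod)
      fix k assume "k \<in> I"
      then show "(\<lambda>N. expectation (\<lambda>\<omega>. g k (T k N \<omega>))) \<longlonglongrightarrow> expectation (\<lambda>\<omega>. g k (X k \<omega>))"
        using L2_limit_lipschitz_prod[of "{k}" T X C g] lim g bnd by simp
    qed
    ultimately show "(\<lambda>N. expectation (\<lambda>\<omega>. \<Prod>k\<in>I. g k (T k N \<omega>))) \<longlonglongrightarrow> (\<Prod>k\<in>I. expectation (\<lambda>\<omega>. g k (X k \<omega>)))"
      by simp
  qed
  show ?thesis
  proof (subst indep_vars_finite[where E = "\<lambda>_. Collect closed"])
    show "\<forall>A\<in>I \<rightarrow> Collect closed. prob (\<Inter>j\<in>I. X j -` A j \<inter> space M) = (\<Prod>j\<in>I. prob (X j -` A j \<inter> space M))"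
    proof
      fix A :: "'i \<Rightarrow> real set" assume A: "A \<in> I \<rightarrow> Collect closed"
      define B where "B = (\<lambda>k. if k \<in> I then A k else {})"
      have B: "closed (B k)" for k using A by (auto simp: B_def)
      have "\<exists>(G :: nat \<Rightarrow> real \<Rightarrow> real) C. (\<forall>m y. 0 \<le> G m y \<and> G m y \<le> 1) \<and> (\<forall>m. (C m)-lipschitz_on UNIV (G m)) \<and>
          (\<forall>y. (\<lambda>m. G m y) \<longlonglongrightarrow> indicator (B k) y)" for k :: 'i
        by (rule closed_indicator_lipschitz_limit[OF B])
      then obtain G :: "'i \<Rightarrow> nat \<Rightarrow> real \<Rightarrow> real" and C where
        G: "\<And>k m y. 0 \<le> G k m y" "\<And>k m y. G k m y \<le> 1" "\<And>k m. (C k m)-lipschitz_on UNIV (G k m)"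
          "\<And>k y. (\<lambda>m. G k m y) \<longlonglongrightarrow> indicator (B k) y"
        by metis
      have Gm[measurable]: "G k m \<in> borel_measurable borel" for k m
        by (intro borel_measurable_continuous_onI lipschitz_on_continuous_on[OF G(3)])
      have Bm[measurable]: "B k \<in> sets borel" for k using B by auto
      have lim: "(\<lambda>m. expectation (\<lambda>\<omega>. \<Prod>k\<in>J. G k m (X k \<omega>)))
          \<longlonglongrightarrow> expectation (\<lambda>\<omega>. \<Prod>k\<in>J. indicator (B k) (X k \<omega>))" if J: "J \<subseteq> I" for J
      proof (rule integral_dominated_convergence[where w = "\<lambda>_. 1"])
        have XJ: "X k \<in> borel_measurable M" if "k \<in> J" for k using that J X by auto
        show "(\<lambda>\<omega>. \<Prod>k\<in>J. indicator (B k) (X k \<omega>) :: real) \<in> borel_measurable M"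
          by (intro borel_measurable_prod measurable_compose[OF XJ borel_measurable_indicator[OF Bm]])
        show "(\<lambda>\<omega>. \<Prod>k\<in>J. G k m (X k \<omega>)) \<in> borel_measurable M" for m
          by (intro borel_measurable_prod measurable_compose[OF XJ Gm])
        show "AE \<omega> in M. (\<lambda>m. \<Prod>k\<in>J. G k m (X k \<omega>)) \<longlonglongrightarrow> (\<Prod>k\<in>J. indicator (B k) (X k \<omega>))"
          by (intro AE_I2 tendsto_prod G(4))
        show "AE \<omega> in M. norm (\<Prod>k\<in>J. G k m (X k \<omega>)) \<le> 1" for m
          using G(1,2) by (auto simp: abs_prod intro!: prod_le_1)
      qed simp
      have ev: "X j -` B j \<inter> space M \<in> sets M" if "j \<in> I" for j
        using X[OF that] by measurable
      have one: "expectation (\<lambda>\<omega>. indicator (B k) (X k \<omega>) :: real) = prob (X k -` B k \<inter> space M)" if "k \<in> I" for k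
      proof -
        have "expectation (\<lambda>\<omega>. indicator (B k) (X k \<omega>) :: real) = expectation (indicator (X k -` B k \<inter> space M))"
          by (rule Bochner_Integration.integral_cong) (auto simp: indicator_def)
        then show ?thesis using ev[OF that] by simp
      qed
      have all: "expectation (\<lambda>\<omega>. \<Prod>k\<in>I. indicator (B k) (X k \<omega>) :: real) = prob (\<Inter>j\<in>I. X j -` B j \<inter> space M)"
      proof -
        have "(\<Prod>k\<in>I. indicator (B k) (X k \<omega>)) = (indicator (\<Inter>j\<in>I. X j -` B j \<inter> space M) \<omega> :: real)"
          if "\<omega> \<in> space M" for \<omega>
        proof (cases "\<forall>k\<in>I. X k \<omega> \<in> B k")
          case True then show ?thesis using that by simp
        next
          case False
          then have "(\<Prod>k\<in>I. indicator (B k) (X k \<omega>)) = (0::real)" using I(1) by (auto simp: prod_zero_iff indicator_def)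
          then show ?thesis using False by auto
        qed
        then have "expectation (\<lambda>\<omega>. \<Prod>k\<in>I. indicator (B k) (X k \<omega>) :: real) = expectation (indicator (\<Inter>j\<in>I. X j -` B j \<inter> space M))"
          by (intro Bochner_Integration.integral_cong) auto
        moreover have "(\<Inter>j\<in>I. X j -` B j \<inter> space M) \<in> sets M"
          using I ev by (intro sets.finite_INT) auto
        ultimately show ?thesis by simp
      qed
      have "(\<lambda>m. \<Prod>k\<in>I. expectation (\<lambda>\<omega>. G k m (X k \<omega>))) \<longlonglongrightarrow> (\<Prod>k\<in>I. expectation (\<lambda>\<omega>. indicator (B k) (X k \<omega>)))"
      proof (rule tendsto_prod)
        fix k assume "k \<in> I"
        then show "(\<lambda>m. expectation (\<lambda>\<omega>. G k m (X k \<omega>))) \<longlonglongrightarrow> expectation (\<lambda>\<omega>. indicator (B k) (X k \<omega>))"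
          using lim[of "{k}"] by simp
      qed
      then have "(\<lambda>m. expectation (\<lambda>\<omega>. \<Prod>k\<in>I. G k m (X k \<omega>))) \<longlonglongrightarrow> (\<Prod>k\<in>I. expectation (\<lambda>\<omega>. indicator (B k) (X k \<omega>)))"
        by (subst lipind[OF G(3,1,2)])
      from LIMSEQ_unique[OF lim[OF order_refl] this]
      have "prob (\<Inter>j\<in>I. X j -` B j \<inter> space M) = (\<Prod>j\<in>I. prob (X j -` B j \<inter> space M))"
        by (simp add: all one)
      then show "prob (\<Inter>j\<in>I. X j -` A j \<inter> space M) = (\<Prod>j\<in>I. prob (X j -` A j \<inter> space M))"
        by (simp add: B_def)
    qed
  qed (auto simp: I sets_borel_eq_closed Int_stable_def X)
qed

text \<open>By scaling, all expectations are written as integrals against the standard normal law, so that dominated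
  convergence applies to the standard deviations.\<close>

lemma normal_L2_limit:
  assumes lim: "L2_limit T X" and D: "\<And>N. distributed M lborel (T N) (normal_density 0 (s N))"
    and s: "\<And>N. 0 < s N" "s \<longlonglongrightarrow> s0" "0 < s0"
  shows "distributed M lborel X (normal_density 0 s0)"
proof -
  have [measurable]: "X \<in> borel_measurable M" "T N \<in> borel_measurable M" for N
    using lim by (auto simp: L2_limit_def)
  define \<nu> where "\<nu> = density lborel (\<lambda>x. ennreal (normal_density 0 s0 x))"
  interpret \<nu>: prob_space \<nu> unfolding \<nu>_def by (rule prob_space_normal_density[OF s(3)])
  have s\<nu>[measurable_cong]: "sets \<nu> = sets borel" by (simp add: \<nu>_def)
  have std: "expectation (\<lambda>\<omega>. g (Y \<omega>)) = (\<integral>x. std_normal_density x * g (r * x) \<partial>lborel)"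
    if "distributed M lborel Y (normal_density 0 r)" "0 < r" and g: "g \<in> borel_measurable borel"
    for Y r and g :: "real \<Rightarrow> real"
  proof -
    have "distributed M lborel (\<lambda>\<omega>. Y \<omega> / r) std_normal_density"
      using normal_standard_normal_convert[of r Y 0] that by simp
    from distributed_integral[OF this, of "\<lambda>x. g (r * x)"] g that(2)
    show ?thesis by simp
  qed
  have std': "(\<integral>x. g x \<partial>\<nu>) = (\<integral>x. std_normal_density x * g (s0 * x) \<partial>lborel)"
    if g[measurable]: "g \<in> borel_measurable borel" for g :: "real \<Rightarrow> real"
  proof -
    have d: "distributed \<nu> lborel (\<lambda>x. x) (normal_density 0 s0)"
      unfolding distributed_def by (simp add: \<nu>_def distr_id2)
    from \<nu>.normal_standard_normal_convert[of s0 "\<lambda>x. x" 0] d s(3)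
    have "distributed \<nu> lborel (\<lambda>\<omega>. \<omega> / s0) std_normal_density" by simp
    from distributed_integral[OF this, of "\<lambda>x. g (s0 * x)"] s(3) show ?thesis by simp
  qed
  have lip: "expectation (\<lambda>\<omega>. g (X \<omega>)) = (\<integral>x. g x \<partial>\<nu>)"
    if g: "C-lipschitz_on UNIV g" and bnd: "\<And>y. 0 \<le> g y" "\<And>y. g y \<le> (1::real)" for g C
  proof -
    have gc: "continuous_on UNIV g" by (rule lipschitz_on_continuous_on[OF g])
    have gm[measurable]: "g \<in> borel_measurable borel" by (intro borel_measurable_continuous_onI gc)
    have "(\<lambda>N. expectation (\<lambda>\<omega>. g (T N \<omega>))) \<longlonglongrightarrow> expectation (\<lambda>\<omega>. g (X \<omega>))"
      using L2_limit_lipschitz_prod[of "{()}" "\<lambda>_. T" "\<lambda>_. X" "\<lambda>_. C" "\<lambda>_. g"] lim g bnd by simp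
    moreover have "(\<lambda>N. expectation (\<lambda>\<omega>. g (T N \<omega>))) \<longlonglongrightarrow> (\<integral>x. std_normal_density x * g (s0 * x) \<partial>lborel)"
      unfolding std[OF D s(1) gm]
    proof (rule integral_dominated_convergence[where w = "std_normal_density"])
      show "AE x in lborel. (\<lambda>i. std_normal_density x * g (s i * x)) \<longlonglongrightarrow> std_normal_density x * g (s0 * x)"
      proof (intro AE_I2 tendsto_mult tendsto_const)
        fix x
        have "(\<lambda>i. s i * x) \<longlonglongrightarrow> s0 * x" by (intro tendsto_mult s tendsto_const)
        then show "(\<lambda>i. g (s i * x)) \<longlonglongrightarrow> g (s0 * x)"
          by (rule continuous_on_tendsto_compose[OF gc]) auto
      qed
      show "AE x in lborel. norm (std_normal_density x * g (s N * x)) \<le> std_normal_density x" for N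
        using bnd by (auto simp: abs_mult intro!: mult_left_le)
    qed auto
    ultimately show ?thesis using std'[OF gm] LIMSEQ_unique by metis
  qed
  interpret D: prob_space "distr M borel X" by (rule prob_space_distr) simp
  have "emeasure (distr M borel X) A = emeasure \<nu> A" if A: "closed A" for A
  proof -
    obtain G :: "nat \<Rightarrow> real \<Rightarrow> real" and C where GC: "(\<forall>m y. 0 \<le> G m y \<and> G m y \<le> 1) \<and>
        (\<forall>m. (C m)-lipschitz_on UNIV (G m)) \<and> (\<forall>y. (\<lambda>m. G m y) \<longlonglongrightarrow> indicator A y)"
      using closed_indicator_lipschitz_limit[OF A] by (elim exE) (rule that)
    have G: "\<And>m y. 0 \<le> G m y" "\<And>m y. G m y \<le> 1" "\<And>m. (C m)-lipschitz_on UNIV (G m)"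
        "\<And>y. (\<lambda>m. G m y) \<longlonglongrightarrow> indicator A y"
      using GC by auto
    have Gm[measurable]: "G m \<in> borel_measurable borel" for m
      by (intro borel_measurable_continuous_onI lipschitz_on_continuous_on[OF G(3)])
    have Am[measurable]: "A \<in> sets borel" using A by auto
    have "(\<lambda>m. expectation (\<lambda>\<omega>. G m (X \<omega>))) \<longlonglongrightarrow> expectation (\<lambda>\<omega>. indicator A (X \<omega>))"
      using G by (intro integral_dominated_convergence[where w = "\<lambda>_. 1"]) auto
    moreover have "(\<lambda>m. (\<integral>x. G m x \<partial>\<nu>)) \<longlonglongrightarrow> (\<integral>x. indicator A x \<partial>\<nu>)"
      using G by (intro integral_dominated_convergence[where w = "\<lambda>_. 1"]) auto
    ultimately have "expectation (\<lambda>\<omega>. indicator A (X \<omega>)) = (\<integral>x. indicator A x \<partial>\<nu> :: real)"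
      unfolding lip[OF G(3,1,2)] by (rule LIMSEQ_unique)
    moreover have "expectation (\<lambda>\<omega>. indicator A (X \<omega>)) = measure (distr M borel X) A"
    proof -
      have "measure (distr M borel X) A = (\<integral>x. indicator A x \<partial>distr M borel X)" by simp
      also have "\<dots> = expectation (\<lambda>\<omega>. indicator A (X \<omega>))" by (rule integral_distr) auto
      finally show ?thesis ..
    qed
    ultimately show ?thesis using s\<nu> sets_eq_imp_space_eq[OF s\<nu>] by (simp add: D.emeasure_eq_measure \<nu>.emeasure_eq_measure)
  qed
  then have "distr M borel X = \<nu>"
  proof (intro measure_eqI_generator_eq[where E = "Collect closed" and \<Omega> = UNIV and A = "\<lambda>_. UNIV"])
    show "sets (distr M borel X) = sigma_sets UNIV (Collect closed)"
      by (simp add: sets_borel_eq_closed)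
    show "sets \<nu> = sigma_sets UNIV (Collect closed)"
      unfolding s\<nu> by (rule sets_borel_eq_closed)
  qed (auto simp: Int_stable_def D.emeasure_eq_measure)
  moreover have "distr M lborel X = distr M borel X" by (rule distr_cong) auto
  ultimately show ?thesis
    unfolding distributed_def \<nu>_def by simp
qed

end

section \<open>The isometry of the Wiener integral\<close>

lemma brownian_increment:
  assumes bm: "brownian_motion M W" and st: "0 \<le> s" "s \<le> t" "t \<le> 1"
  shows "integrable M (\<lambda>\<omega>. W t \<omega> - W s \<omega>)" "(\<integral>\<omega>. W t \<omega> - W s \<omega> \<partial>M) = 0"
    "integrable M (\<lambda>\<omega>. (W t \<omega> - W s \<omega>)\<^sup>2)" "(\<integral>\<omega>. (W t \<omega> - W s \<omega>)\<^sup>2 \<partial>M) = t - s"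
proof -
  interpret prob_space M using bm by (simp add: brownian_motion_def)
  let ?D = "\<lambda>\<omega>. W t \<omega> - W s \<omega>"
  have "integrable M ?D \<and> expectation ?D = 0 \<and> integrable M (\<lambda>\<omega>. (?D \<omega>)\<^sup>2) \<and> expectation (\<lambda>\<omega>. (?D \<omega>)\<^sup>2) = t - s"
  proof (cases "s < t")
    case True
    then have d: "distributed M lborel ?D (normal_density 0 (sqrt (t - s)))"
      using bm st by (auto simp: brownian_motion_def)
    have pos: "0 < sqrt (t - s)" using True by simp
    have e: "expectation ?D = 0" by (rule normal_distributed_expectation[OF pos d])
    have i1: "integrable M ?D"
      using integrable_normal_moment[OF pos, of 0 1]
      by (subst distributed_integrable[OF d, of "\<lambda>x. x", symmetric]) auto
    have i2: "integrable M (\<lambda>\<omega>. (?D \<omega>)\<^sup>2)"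
      using integrable_normal_moment[OF pos, of 0 2]
      by (subst distributed_integrable[OF d, of "\<lambda>x. x\<^sup>2", symmetric]) auto
    have "variance ?D = (sqrt (t - s))\<^sup>2" by (rule normal_distributed_variance[OF pos d])
    then show ?thesis using e i1 i2 True by simp
  next
    case False
    then have "s = t" using st by simp
    then show ?thesis by simp
  qed
  then show "integrable M ?D" "expectation ?D = 0" "integrable M (\<lambda>\<omega>. (?D \<omega>)\<^sup>2)"
    "expectation (\<lambda>\<omega>. (?D \<omega>)\<^sup>2) = t - s" by auto
qed

lemma integrable_mult_of_squares:
  fixes f g :: "'a \<Rightarrow> real"
  assumes [measurable]: "f \<in> borel_measurable M" "g \<in> borel_measurable M"
    and "integrable M (\<lambda>x. (f x)\<^sup>2)" "integrable M (\<lambda>x. (g x)\<^sup>2)"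
  shows "integrable M (\<lambda>x. f x * g x)"
proof (rule Bochner_Integration.integrable_bound)
  show "integrable M (\<lambda>x. (f x)\<^sup>2 + (g x)\<^sup>2)" using assms by simp
  show "AE x in M. norm (f x * g x) \<le> norm ((f x)\<^sup>2 + (g x)\<^sup>2)"
  proof (rule AE_I2)
    fix x
    have "0 \<le> (\<bar>f x\<bar> - \<bar>g x\<bar>)\<^sup>2" "0 \<le> \<bar>f x\<bar> * \<bar>g x\<bar>" by simp_all
    then have "\<bar>f x\<bar> * \<bar>g x\<bar> \<le> (f x)\<^sup>2 + (g x)\<^sup>2"
      unfolding power2_diff power2_abs by linarith
    then show "norm (f x * g x) \<le> norm ((f x)\<^sup>2 + (g x)\<^sup>2)" by (simp add: abs_mult)
  qed
qed simp

text \<open>For \<open>s \<le> t\<close> write \<open>W\<^sub>t = W\<^sub>s + (W\<^sub>t - W\<^sub>s)\<close>; the increments over \<open>[0, s]\<close> and \<open>[s, t]\<close> are independent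
  and centred.\<close>

lemma brownian_covariance:
  assumes bm: "brownian_motion M W" and "s \<in> {0..1}" "t \<in> {0..1}"
  shows "integrable M (\<lambda>\<omega>. W s \<omega> * W t \<omega>)" "(\<integral>\<omega>. W s \<omega> * W t \<omega> \<partial>M) = min s t"
proof -
  interpret prob_space M using bm by (simp add: brownian_motion_def)
  have *: "integrable M (\<lambda>\<omega>. W s \<omega> * W t \<omega>) \<and> expectation (\<lambda>\<omega>. W s \<omega> * W t \<omega>) = s"
    if st: "0 \<le> s" "s \<le> t" "t \<le> 1" for s t
  proof -
    let ?D = "\<lambda>\<omega>. W s \<omega> - W 0 \<omega>" and ?E = "\<lambda>\<omega>. W t \<omega> - W s \<omega>"
    have W[measurable]: "W r \<in> borel_measurable M" if "0 \<le> r" "r \<le> 1" for r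
      using bm that by (auto simp: brownian_motion_def)
    have ms: "W s \<in> borel_measurable M" "W t \<in> borel_measurable M" "W 0 \<in> borel_measurable M"
      using st W by auto
    have s1: "s \<le> 1" using st by linarith
    note D = brownian_increment[OF bm order_refl st(1) s1] and E = brownian_increment[OF bm st]
    define r where "r = (\<lambda>i::nat. if i = 0 then 0 else if i = 1 then s else t)"
    have "mono_on {..2} r" "r ` {..2} \<subseteq> {0..1}"
      using st by (auto simp: r_def mono_on_def)
    then have ind: "indep_vars (\<lambda>_. borel) (\<lambda>i \<omega>. W (r (Suc i)) \<omega> - W (r i) \<omega>) {..<2}"
      using bm unfolding brownian_motion_def by blast
    have two: "{..<2::nat} = {0, 1}" by auto
    have prod: "expectation (\<lambda>\<omega>. \<Prod>i<2. W (r (Suc i)) \<omega> - W (r i) \<omega>) =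
      (\<Prod>i<2. expectation (\<lambda>\<omega>. W (r (Suc i)) \<omega> - W (r i) \<omega>))"
      using D E st by (intro indep_vars_lebesgue_integral ind) (auto simp: r_def two)
    have DE: "expectation (\<lambda>\<omega>. ?D \<omega> * ?E \<omega>) = 0"
      using prod D E by (simp add: two r_def)
    have intDE: "integrable M (\<lambda>\<omega>. ?D \<omega> * ?E \<omega>)"
      using ms D E st by (intro integrable_mult_of_squares) auto
    have ae: "AE \<omega> in M. (?D \<omega>)\<^sup>2 + ?D \<omega> * ?E \<omega> = W s \<omega> * W t \<omega>"
    proof -
      have "AE \<omega> in M. W 0 \<omega> = 0" using bm by (simp add: brownian_motion_def)
      then show ?thesis by eventually_elim (simp add: power2_eq_square algebra_simps)
    qed
    have "integrable M (\<lambda>\<omega>. (?D \<omega>)\<^sup>2 + ?D \<omega> * ?E \<omega>)" using D(3) intDE by simp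
    moreover have "expectation (\<lambda>\<omega>. (?D \<omega>)\<^sup>2 + ?D \<omega> * ?E \<omega>) = s"
      using D(3,4) intDE DE by simp
    moreover have "integrable M (\<lambda>\<omega>. (?D \<omega>)\<^sup>2 + ?D \<omega> * ?E \<omega>) \<longleftrightarrow> integrable M (\<lambda>\<omega>. W s \<omega> * W t \<omega>)"
      using ms ae by (intro integrable_cong_AE) auto
    moreover have "expectation (\<lambda>\<omega>. (?D \<omega>)\<^sup>2 + ?D \<omega> * ?E \<omega>) = expectation (\<lambda>\<omega>. W s \<omega> * W t \<omega>)"
      using ms ae by (intro integral_cong_AE) auto
    ultimately show ?thesis by simp
  qed
  show "integrable M (\<lambda>\<omega>. W s \<omega> * W t \<omega>)" "(\<integral>\<omega>. W s \<omega> * W t \<omega> \<partial>M) = min s t"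
  proof -
    have comm: "(\<lambda>\<omega>. W t \<omega> * W s \<omega>) = (\<lambda>\<omega>. W s \<omega> * W t \<omega>)" by (simp add: mult.commute)
    have "integrable M (\<lambda>\<omega>. W s \<omega> * W t \<omega>) \<and> (\<integral>\<omega>. W s \<omega> * W t \<omega> \<partial>M) = min s t"
    proof (cases "s \<le> t")
      case True
      then show ?thesis using *[of s t] assms by (simp add: min_def)
    next
      case False
      then show ?thesis using *[of t s] assms unfolding comm by (simp add: min_def)
    qed
    then show "integrable M (\<lambda>\<omega>. W s \<omega> * W t \<omega>)" "(\<integral>\<omega>. W s \<omega> * W t \<omega> \<partial>M) = min s t" by auto
  qed
qed

lemma integral_indicator_initial:
  assumes "s \<in> {0..1}" "t \<in> {0..1::real}"
  shows "integrable lborel (\<lambda>x. indicator {0<..s} x * indicator {0<..t} x :: real)"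
    "(\<integral>x. indicator {0<..s} x * indicator {0<..t} x \<partial>lborel) = min s t"
proof -
  have *: "(\<lambda>x. indicator {0<..s} x * indicator {0<..t} x :: real) = indicator {0<..min s t}"
    by (auto simp: indicator_def fun_eq_iff)
  show "integrable lborel (\<lambda>x. indicator {0<..s} x * indicator {0<..t} x :: real)"
    "(\<integral>x. indicator {0<..s} x * indicator {0<..t} x \<partial>lborel) = min s t"
    using assms unfolding * by auto
qed

text \<open>Both sides are quadratic forms in \<open>c\<close> with the same matrix \<open>min (t i) (t j)\<close>. Stating the isometry
  for linear combinations of the values \<open>W\<^sub>t\<close>, rather than of increments along a partition, makes it
  applicable to two different partitions at once, without a common refinement.\<close>

lemma brownian_isometry:
  assumes bm: "brownian_motion M W" and "finite I" "\<And>i. i \<in> I \<Longrightarrow> t i \<in> {0..1}"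
  shows "(\<integral>\<^sup>+\<omega>. ennreal ((\<Sum>i\<in>I. c i * W (t i) \<omega>)\<^sup>2) \<partial>M)
    = (\<integral>\<^sup>+x. ennreal ((\<Sum>i\<in>I. c i * indicator {0<..t i} x)\<^sup>2) \<partial>lborel)"
proof -
  have sq: "(\<Sum>i\<in>I. c i * y i)\<^sup>2 = (\<Sum>i\<in>I. \<Sum>j\<in>I. c i * c j * (y i * y j))" for y :: "'b \<Rightarrow> real"
    by (simp add: power2_eq_square sum_product ac_simps)
  have W: "has_bochner_integral M (\<lambda>\<omega>. (\<Sum>i\<in>I. c i * W (t i) \<omega>)\<^sup>2) (\<Sum>i\<in>I. \<Sum>j\<in>I. c i * c j * min (t i) (t j))"
    unfolding sq using brownian_covariance[OF bm] assms(3)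
    by (intro has_bochner_integral_sum has_bochner_integral_mult_right) (auto simp: has_bochner_integral_iff)
  have L: "has_bochner_integral lborel (\<lambda>x. (\<Sum>i\<in>I. c i * indicator {0<..t i} x)\<^sup>2) (\<Sum>i\<in>I. \<Sum>j\<in>I. c i * c j * min (t i) (t j))"
    unfolding sq using integral_indicator_initial assms(3)
    by (intro has_bochner_integral_sum has_bochner_integral_mult_right) (auto simp: has_bochner_integral_iff)
  show ?thesis
    using W L by (simp add: has_bochner_integral_iff nn_integral_eq_integral)
qed

definition partition01 :: "nat \<Rightarrow> (nat \<Rightarrow> real) \<Rightarrow> bool" where
  "partition01 m t \<longleftrightarrow> mono_on {..m} t \<and> t ` {..m} \<subseteq> {0..1}"

lemma step_function_initial:
  assumes "partition01 m t"
  shows "step_function m t a x = (\<Sum>i<m. a i * (indicator {0<..t (Suc i)} x - indicator {0<..t i} x))"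
proof -
  have "indicator {t i<..t (Suc i)} x = (indicator {0<..t (Suc i)} x - indicator {0<..t i} x :: real)"
    if "i < m" for i
  proof -
    have "t i \<le> t (Suc i)" using assms that by (auto simp: partition01_def mono_on_def)
    moreover have "0 \<le> t i" using assms that by (auto simp: partition01_def image_subset_iff)
    ultimately show ?thesis by (auto simp: indicator_def)
  qed
  then show ?thesis by (simp add: step_function_def)
qed

text \<open>The four families of values of \<open>W\<close>, at the left and right end points of either partition, are
  indexed by a disjoint sum.\<close>

lemma step_isometry:
  assumes bm: "brownian_motion M W" and t: "partition01 m t" and u: "partition01 l u"
  shows "(\<integral>\<^sup>+\<omega>. ennreal ((step_integral W m t a \<omega> - step_integral W l u b \<omega>)\<^sup>2) \<partial>M)
    = (\<integral>\<^sup>+x\<in>{0..1}. ennreal ((step_function m t a x - step_function l u b x)\<^sup>2) \<partial>lborel)"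
proof -
  let ?I = "({..<m} <+> {..<m}) <+> ({..<l} <+> {..<l})"
  define c where "c = case_sum (case_sum a (\<lambda>i. - a i)) (case_sum (\<lambda>i. - b i) b)"
  define r where "r = case_sum (case_sum (\<lambda>i. t (Suc i)) t) (case_sum (\<lambda>i. u (Suc i)) u)"
  have sum: "(\<Sum>i\<in>?I. c i * w (r i)) = (\<Sum>i<m. a i * (w (t (Suc i)) - w (t i))) - (\<Sum>i<l. b i * (w (u (Suc i)) - w (u i)))"
    for w :: "real \<Rightarrow> real"
    by (simp add: sum.Plus c_def r_def right_diff_distrib sum_subtractf sum_negf)
  have "r i \<in> {0..1}" if "i \<in> ?I" for i
    using that t u by (auto simp: r_def partition01_def image_subset_iff)
  then have "(\<integral>\<^sup>+\<omega>. ennreal ((\<Sum>i\<in>?I. c i * W (r i) \<omega>)\<^sup>2) \<partial>M)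
    = (\<integral>\<^sup>+x. ennreal ((\<Sum>i\<in>?I. c i * indicator {0<..r i} x)\<^sup>2) \<partial>lborel)"
    by (intro brownian_isometry[OF bm]) auto
  also have "(\<lambda>\<omega>. (\<Sum>i\<in>?I. c i * W (r i) \<omega>)) = (\<lambda>\<omega>. step_integral W m t a \<omega> - step_integral W l u b \<omega>)"
    using sum[of "\<lambda>s. W s _"] by (auto simp: step_integral_def fun_eq_iff)
  also have "(\<lambda>x. (\<Sum>i\<in>?I. c i * indicator {0<..r i} x)) = (\<lambda>x. step_function m t a x - step_function l u b x)"
    using sum[of "\<lambda>s. indicator {0<..s} _"] by (auto simp: step_function_initial[OF t] step_function_initial[OF u] fun_eq_iff)
  also have "(\<integral>\<^sup>+x. ennreal ((step_function m t a x - step_function l u b x)\<^sup>2) \<partial>lborel)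
      = (\<integral>\<^sup>+x\<in>{0..1}. ennreal ((step_function m t a x - step_function l u b x)\<^sup>2) \<partial>lborel)"
  proof (rule nn_integral_cong)
    fix x
    have z: "step_function m t a x = 0" if "x \<notin> {0..1}" "partition01 m t" for m t a
    proof -
      have "x \<notin> {t i<..t (Suc i)}" if "i < m" for i
      proof -
        have "t i \<in> {0..1}" "t (Suc i) \<in> {0..1}"
          using that \<open>partition01 m t\<close> by (auto simp: partition01_def image_subset_iff)
        then show ?thesis using \<open>x \<notin> {0..1}\<close> by auto
      qed
      then show ?thesis by (simp add: step_function_def)
    qed
    show "ennreal ((step_function m t a x - step_function l u b x)\<^sup>2) =
      ennreal ((step_function m t a x - step_function l u b x)\<^sup>2) * indicator {0..1} x"
      using z t u by (auto simp: indicator_def)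
  qed
  finally show ?thesis .
qed

text \<open>The definition of the Wiener integral provides one approximating sequence; by the isometry every other
  sequence of step functions with the same limit has integrals with the same limit. This leaves the choice of
  convenient step functions.\<close>

lemma wiener_integral_limit:
  assumes bm: "brownian_motion M W" and X: "has_wiener_integral M W f X"
    and f[measurable]: "(\<lambda>x. f x * indicator {0..1} x) \<in> borel_measurable lborel"
    and t: "\<And>N. partition01 (m N) (t N)"
    and conv: "(\<lambda>N. \<integral>\<^sup>+x\<in>{0..1}. ennreal ((step_function (m N) (t N) (a N) x - f x)\<^sup>2) \<partial>lborel) \<longlonglongrightarrow> 0"
  shows "prob_space.L2_limit M (\<lambda>N. step_integral W (m N) (t N) (a N)) X"
proof -
  interpret prob_space M using bm by (simp add: brownian_motion_def)
  have W: "W r \<in> borel_measurable M" if "r \<in> {0..1}" for r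
    using bm that by (auto simp: brownian_motion_def)
  have Xm[measurable]: "X \<in> borel_measurable M" using X by (simp add: has_wiener_integral_def)
  have Sm: "step_integral W m t a \<in> borel_measurable M" if "partition01 m t" for m t a
    unfolding step_integral_def using that
    by (intro borel_measurable_sum borel_measurable_times borel_measurable_diff W borel_measurable_const)
       (auto simp: partition01_def image_subset_iff)
  have hm[measurable]: "step_function m t a \<in> borel_measurable lborel" for m t a
    unfolding step_function_def by measurable
  obtain m' :: "nat \<Rightarrow> nat" and t' a' where
    t': "\<And>j. partition01 (m' j) (t' j)" and
    c1: "(\<lambda>j. \<integral>\<^sup>+x\<in>{0..1}. ennreal ((step_function (m' j) (t' j) (a' j) x - f x)\<^sup>2) \<partial>lborel) \<longlonglongrightarrow> 0" and
    c2: "(\<lambda>j. \<integral>\<^sup>+\<omega>. ennreal ((step_integral W (m' j) (t' j) (a' j) \<omega> - X \<omega>)\<^sup>2) \<partial>M) \<longlonglongrightarrow> 0"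
    using X unfolding has_wiener_integral_def partition01_def by blast
  let ?h = "\<lambda>N. step_function (m N) (t N) (a N)" and ?h' = "\<lambda>j. step_function (m' j) (t' j) (a' j)"
  let ?S = "\<lambda>N. step_integral W (m N) (t N) (a N)" and ?S' = "\<lambda>j. step_integral W (m' j) (t' j) (a' j)"
  define e where "e = (\<lambda>N. \<integral>\<^sup>+x\<in>{0..1}. ennreal ((?h N x - f x)\<^sup>2) \<partial>lborel)"
  define e1 where "e1 = (\<lambda>N. \<integral>\<^sup>+x\<in>{0..1}. ennreal ((?h' N x - f x)\<^sup>2) \<partial>lborel)"
  define e2 where "e2 = (\<lambda>j. \<integral>\<^sup>+\<omega>. ennreal ((?S' j \<omega> - X \<omega>)\<^sup>2) \<partial>M)"
  have fm: "(\<lambda>x. ennreal ((step_function m t a x - f x)\<^sup>2) * indicator {0..1} x) \<in> borel_measurable lborel" for m t a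
  proof -
    have "(\<lambda>x. ennreal ((step_function m t a x - f x)\<^sup>2) * indicator {0..1} x)
      = (\<lambda>x. ennreal ((step_function m t a x - f x * indicator {0..1} x)\<^sup>2) * indicator {0..1} x)"
      by (auto simp: indicator_def fun_eq_iff)
    also have "\<dots> \<in> borel_measurable lborel" by measurable
    finally show ?thesis .
  qed
  have b1: "(\<integral>\<^sup>+\<omega>. ennreal ((?S N \<omega> - X \<omega>)\<^sup>2) \<partial>M)
    \<le> 2 * (2 * e N + 2 * e1 j) + 2 * e2 j" for N j
  proof -
    note [measurable] = Sm[OF t] Sm[OF t']
    have "(\<integral>\<^sup>+\<omega>. ennreal ((?S N \<omega> - X \<omega>)\<^sup>2) \<partial>M)
      \<le> (\<integral>\<^sup>+\<omega>. 2 * ennreal ((?S N \<omega> - ?S' j \<omega>)\<^sup>2)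
          + 2 * ennreal ((?S' j \<omega> - X \<omega>)\<^sup>2) \<partial>M)"
      by (intro nn_integral_mono ennreal_square_diff_le)
    also have "\<dots> = 2 * (\<integral>\<^sup>+\<omega>. ennreal ((?S N \<omega> - ?S' j \<omega>)\<^sup>2) \<partial>M) + 2 * e2 j"
      by (simp add: nn_integral_add nn_integral_cmult e2_def)
    also have "(\<integral>\<^sup>+\<omega>. ennreal ((?S N \<omega> - ?S' j \<omega>)\<^sup>2) \<partial>M)
      = (\<integral>\<^sup>+x\<in>{0..1}. ennreal ((?h N x - ?h' j x)\<^sup>2) \<partial>lborel)"
      by (rule step_isometry[OF bm t t'])
    also have "\<dots> \<le> (\<integral>\<^sup>+x. 2 * (ennreal ((?h N x - f x)\<^sup>2) * indicator {0..1} x)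
        + 2 * (ennreal ((?h' j x - f x)\<^sup>2) * indicator {0..1} x) \<partial>lborel)"
    proof (rule nn_integral_mono)
      fix x
      show "ennreal ((?h N x - ?h' j x)\<^sup>2) * indicator {0..1} x
        \<le> 2 * (ennreal ((?h N x - f x)\<^sup>2) * indicator {0..1} x)
        + 2 * (ennreal ((?h' j x - f x)\<^sup>2) * indicator {0..1} x)"
        using ennreal_square_diff_le[of "?h N x" "?h' j x" "f x"]
        by (simp add: indicator_def power2_commute[of "f x"])
    qed
    also have "\<dots> = 2 * e N + 2 * e1 j"
      using fm by (simp add: nn_integral_add nn_integral_cmult e_def e1_def)
    finally show ?thesis by (simp add: add_mono mult_left_mono)
  qed
  (* Let j tend to infinity, with N fixed. *)
  have b2: "(\<integral>\<^sup>+\<omega>. ennreal ((?S N \<omega> - X \<omega>)\<^sup>2) \<partial>M) \<le> 2 * (2 * e N + 2 * 0) + 2 * 0" for N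
  proof (rule tendsto_lowerbound)
    show "(\<lambda>j. 2 * (2 * e N + 2 * e1 j) + 2 * e2 j) \<longlonglongrightarrow> 2 * (2 * e N + 2 * 0) + 2 * 0"
      using c1 c2 unfolding e1_def[symmetric] e2_def[symmetric]
      by (intro tendsto_add tendsto_mult_ennreal tendsto_const) auto
  qed (use b1 in auto)
  have "(\<lambda>N. \<integral>\<^sup>+\<omega>. ennreal ((?S N \<omega> - X \<omega>)\<^sup>2) \<partial>M) \<longlonglongrightarrow> 0"
  proof (rule tendsto_sandwich[OF _ _ tendsto_const])
    have "(\<lambda>N. 2 * (2 * e N + 2 * 0) + 2 * 0) \<longlonglongrightarrow> 2 * (2 * 0 + 2 * 0) + 2 * 0"
      using conv unfolding e_def[symmetric]
      by (intro tendsto_add tendsto_mult_ennreal tendsto_const) auto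
    then show "(\<lambda>N. 2 * (2 * e N + 2 * 0) + 2 * 0) \<longlonglongrightarrow> 0" by simp
  qed (use b2 in auto)
  then show ?thesis using Sm[OF t] Xm by (simp add: L2_limit_def)
qed

section \<open>The law of the increments\<close>

text \<open>The index of the cell \<open>(i / p, (i + 1) / p]\<close> that contains \<open>x > 0\<close>.\<close>

definition grid_index :: "nat \<Rightarrow> real \<Rightarrow> nat" where
  "grid_index p x = nat (\<lceil>x * real p\<rceil> - 1)"

lemma mem_grid_interval_iff:
  assumes "0 < p" "0 < x"
  shows "x \<in> {real i / real p<..real (Suc i) / real p} \<longleftrightarrow> i = grid_index p x"
proof -
  have "x \<in> {real i / real p<..real (Suc i) / real p} \<longleftrightarrow> real i < x * real p \<and> x * real p \<le> real i + 1"
    using assms by (simp add: field_simps)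
  also have "\<dots> \<longleftrightarrow> \<lceil>x * real p\<rceil> = int i + 1"
    by (auto simp: ceiling_eq_iff)
  also have "\<dots> \<longleftrightarrow> i = grid_index p x"
  proof -
    have "0 < x * real p" using assms by simp
    then have "1 \<le> \<lceil>x * real p\<rceil>" by (metis less_one linorder_not_le zero_less_ceiling int_one_le_iff_zero_less)
    then show ?thesis by (auto simp: grid_index_def)
  qed
  finally show ?thesis .
qed

lemma grid_index_close:
  assumes "0 < p" "0 < x"
  shows "\<bar>real (grid_index p x) / real p - x\<bar> \<le> 1 / real p" "real (grid_index p x) / real p \<le> x"
proof -
  have "x \<in> {real (grid_index p x) / real p<..real (Suc (grid_index p x)) / real p}"
    using mem_grid_interval_iff[OF assms] by blast
  then show "\<bar>real (grid_index p x) / real p - x\<bar> \<le> 1 / real p" "real (grid_index p x) / real p \<le> x"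
    by (auto simp: add_divide_distrib)
qed

text \<open>A step function on the grid of mesh \<open>1 / (n S)\<close>, restricted to a union of cells of mesh \<open>1 / n\<close>, takes
  at \<open>x\<close> the coefficient of the small cell that contains \<open>x\<close>.\<close>

lemma grid_step_eq:
  assumes n: "0 < n" and S: "0 < S"
  shows "(\<Sum>i\<in>{l * S..<k * S}. b i * indicator {real i / real (n * S)<..real (Suc i) / real (n * S)} x)
    = (if x \<in> {real l / real n<..real k / real n} then b (grid_index (n * S) x) else (0::real))"
proof (cases "0 < x")
  case False
  then have "indicator {real i / real (n * S)<..real (Suc i) / real (n * S)} x = (0::real)" for i
  proof -
    have "0 \<le> real i / real (n * S)" by simp
    then have "x \<notin> {real i / real (n * S)<..real (Suc i) / real (n * S)}"
      using False unfolding greaterThanAtMost_iff by linarith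
    then show ?thesis by (rule indicator_simps(2))
  qed
  moreover have "x \<notin> {real l / real n<..real k / real n}"
  proof -
    have "0 \<le> real l / real n" by simp
    then show ?thesis using False unfolding greaterThanAtMost_iff by linarith
  qed
  ultimately show ?thesis by (simp only: mult_zero_right sum.neutral_const if_False)
next
  case True
  let ?p = "n * S"
  have p: "0 < ?p" using n S by simp
  note g = mem_grid_interval_iff[OF p True]
  let ?i = "grid_index ?p x"
  have xi: "real ?i < x * real ?p" "x * real ?p \<le> real ?i + 1"
    using g[of ?i] p by (auto simp: field_simps simp del: of_nat_mult)
  have iff: "?i \<in> {l * S..<k * S} \<longleftrightarrow> x \<in> {real l / real n<..real k / real n}"
  proof -
    have nl: "real l / real n < x \<longleftrightarrow> real (l * S) < x * real ?p"
      using n S by (simp add: field_simps)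
    have nk: "x \<le> real k / real n \<longleftrightarrow> x * real ?p \<le> real (k * S)"
      using n S by (simp add: field_simps)
    have "l * S \<le> ?i \<longleftrightarrow> real (l * S) < x * real ?p"
    proof
      assume "l * S \<le> ?i"
      then have "real (l * S) \<le> real ?i" by (simp only: of_nat_le_iff)
      then show "real (l * S) < x * real ?p" using xi by linarith
    next
      assume "real (l * S) < x * real ?p"
      then have "real (l * S) < real ?i + 1" using xi by linarith
      then show "l * S \<le> ?i" by linarith
    qed
    moreover have "?i < k * S \<longleftrightarrow> x * real ?p \<le> real (k * S)"
    proof
      assume "?i < k * S"
      then have "real ?i + 1 \<le> real (k * S)" by linarith
      then show "x * real ?p \<le> real (k * S)" using xi by linarith
    next
      assume "x * real ?p \<le> real (k * S)"
      then have "real ?i < real (k * S)" using xi by linarith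
      then show "?i < k * S" by (simp only: of_nat_less_iff)
    qed
    ultimately show ?thesis using nl nk by auto
  qed
  have "(\<Sum>i\<in>{l * S..<k * S}. b i * indicator {real i / real ?p<..real (Suc i) / real ?p} x)
    = (\<Sum>i\<in>{l * S..<k * S}. if ?i = i then b i else 0)"
    by (intro sum.cong refl) (use g in \<open>auto simp: indicator_def simp del: of_nat_mult of_nat_Suc\<close>)
  also have "\<dots> = (if ?i \<in> {l * S..<k * S} then b ?i else 0)"
    by (subst sum.delta') auto
  finally show ?thesis unfolding iff .
qed

lemma grid_value_bound:
  assumes "0 < n" "0 < S" "0 < x" "x \<le> 1"
  shows "real (grid_index (n * S) x) / real (n * S) \<in> {0..1}"
proof -
  have "0 < n * S" using assms by simp
  from grid_index_close(2)[OF this assms(3)] assms(4)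
  have "real (grid_index (n * S) x) / real (n * S) \<le> 1" by (rule order_trans)
  moreover have "0 \<le> real (grid_index (n * S) x) / real (n * S)" by simp
  ultimately show ?thesis by simp
qed

lemma grid_value_limit:
  fixes f :: "real \<Rightarrow> real"
  assumes f: "continuous_on {0..1} f" and n: "0 < n" and x: "0 < x" "x \<le> 1"
  shows "(\<lambda>N. f (real (grid_index (n * Suc N) x) / real (n * Suc N))) \<longlonglongrightarrow> f x"
proof (rule continuous_on_tendsto_compose[OF f])
  have p: "0 < n * Suc N" for N using n by simp
  show "(\<lambda>N. real (grid_index (n * Suc N) x) / real (n * Suc N)) \<longlonglongrightarrow> x"
  proof (rule LIM_zero_cancel, rule Lim_null_comparison)
    show "\<forall>\<^sub>F N in sequentially. norm (real (grid_index (n * Suc N) x) / real (n * Suc N) - x) \<le> 1 / real (n * Suc N)"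
      using grid_index_close(1)[OF p x(1)] by (simp del: of_nat_mult)
    have "(\<lambda>N. 1 / real n * (1 / real (Suc N))) \<longlonglongrightarrow> 1 / real n * 0"
      by (intro tendsto_mult tendsto_const LIMSEQ_Suc lim_1_over_n)
    then show "(\<lambda>N. 1 / real (n * Suc N)) \<longlonglongrightarrow> 0"
      by (simp only: of_nat_mult times_divide_times_eq mult_1 mult_zero_right)
  qed
  show "\<forall>\<^sub>F N in sequentially. real (grid_index (n * Suc N) x) / real (n * Suc N) \<in> {0..1}"
    by (intro always_eventually allI grid_value_bound[OF n zero_less_Suc x])
qed (use x in auto)

text \<open>Approximate \<open>\<sigma>\<close> by its values at the left end points of a grid that refines the observation times. The
  approximating increments are sums over disjoint blocks of Brownian increments, hence independent and
  normal; positivity of \<open>\<sigma>\<close> keeps all variances positive, so that normal densities exist. Both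
  properties survive the \<open>L\<^sup>2\<close>-limit.\<close>

lemma Z_increment_law:
  assumes vm: "volatility_model M z0 \<sigma> Z" and cont: "continuous_on {0..1} \<sigma>"
    and pos: "\<And>t. t \<in> {0..1} \<Longrightarrow> 0 < \<sigma> t" and n: "0 < n"
  shows "prob_space.indep_vars M (\<lambda>_. borel) (\<lambda>k \<omega>. Z (real (Suc k) / real n) \<omega> - Z (real k / real n) \<omega>) {..<n}"
    and "\<And>k. k < n \<Longrightarrow> distributed M lborel (\<lambda>\<omega>. Z (real (Suc k) / real n) \<omega> - Z (real k / real n) \<omega>)
      (normal_density 0 (sqrt (\<integral>x. indicator {real k / real n<..real (Suc k) / real n} x * (\<sigma> x)\<^sup>2 \<partial>lborel)))"
proof -
  obtain W where bm: "brownian_motion M W" and Z: "\<And>t. t \<in> {0..1} \<Longrightarrow> Z t \<in> borel_measurable M"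
    "\<And>t. t \<in> {0..1} \<Longrightarrow> has_wiener_integral M W (\<lambda>s. indicator {0..t} s * \<sigma> s) (\<lambda>\<omega>. Z t \<omega> - z0)"
    using vm unfolding volatility_model_def by blast
  interpret prob_space M using bm by (simp add: brownian_motion_def)
  have Wm: "W r \<in> borel_measurable M" if "r \<in> {0..1}" for r
    using bm that by (auto simp: brownian_motion_def)
  have "compact (\<sigma> ` {0..1})" using cont by (intro compact_continuous_image) auto
  then have "\<exists>B. \<forall>x\<in>\<sigma> ` {0..1}. norm x \<le> B" using compact_imp_bounded bounded_iff by metis
  then obtain B where "\<forall>x\<in>\<sigma> ` {0..1}. norm x \<le> B" by (elim exE) (rule that)
  then have B: "\<bar>\<sigma> t\<bar> \<le> B" if "t \<in> {0..1}" for t using that by auto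
  have B0: "0 \<le> B" using B[of 0] by auto
  have sm[measurable]: "(\<lambda>x. indicator {0..1} x * \<sigma> x) \<in> borel_measurable borel"
    using borel_measurable_continuous_on_indicator[OF _ cont] by (simp add: scaleR_conv_of_real)
  define S where "S = Suc"
  have S: "0 < S N" for N by (simp add: S_def)
  define u where "u = (\<lambda>N i. real i / real (n * S N))"
  define a where "a = (\<lambda>N i. \<sigma> (u N i))"
  have p: "0 < real (n * S N)" for N using n S[of N] by simp
  have u01: "u N i \<in> {0..1}" if "i \<le> n * S N" for N i
  proof -
    have "real i \<le> real (n * S N)" using that by (simp only: of_nat_le_iff)
    then show ?thesis using p[of N] by (simp add: u_def del: of_nat_mult)
  qed
  have part: "partition01 (k * S N) (u N)" if "k \<le> n" for k N
  proof -
    have "k * S N \<le> n * S N" using that by (rule mult_le_mono1)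
    then have "u N ` {..k * S N} \<subseteq> {0..1}" by (intro image_subsetI u01) (metis atMost_iff order_trans)
    moreover have "mono_on {..k * S N} (u N)"
      by (auto simp: mono_on_def u_def intro!: divide_right_mono simp del: of_nat_mult)
    ultimately show ?thesis by (simp add: partition01_def)
  qed
  have stepf: "step_function (k * S N) (u N) (a N) x
      = (if x \<in> {0<..real k / real n} then a N (grid_index (n * S N) x) else 0)" for k N x
    using grid_step_eq[OF n S[of N], where l = 0 and k = k and b = "a N" and x = x]
    by (simp add: step_function_def u_def atLeast0LessThan del: of_nat_mult of_nat_Suc)
  have k01: "real k / real n \<in> {0..1}" if "k \<le> n" for k using that n by auto
  have aB: "\<bar>a N (grid_index (n * S N) x)\<bar> \<le> B" if "0 < x" "x \<le> 1" for N x
    unfolding a_def u_def using grid_value_bound[OF n S that] by (rule B)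
  have alim: "(\<lambda>N. a N (grid_index (n * S N) x)) \<longlonglongrightarrow> \<sigma> x" if "0 < x" "x \<le> 1" for x
    unfolding a_def u_def S_def by (rule grid_value_limit[OF cont n that])
  have lim1: "L2_limit (\<lambda>N. step_integral W (k * S N) (u N) (a N)) (\<lambda>\<omega>. Z (real k / real n) \<omega> - z0)"
    if k: "k \<le> n" for k
  proof (rule wiener_integral_limit[OF bm Z(2)[OF k01[OF k]]])
    let ?t = "real k / real n"
    have *: "indicator {0..?t} x * \<sigma> x * indicator {0..1} x = indicator {0..?t} x * (indicator {0..1} x * \<sigma> x)" for x
      by simp
    show fm: "(\<lambda>x. indicator {0..?t} x * \<sigma> x * indicator {0..1} x) \<in> borel_measurable lborel"
      unfolding * by measurable
    show "partition01 (k * S N) (u N)" for N by (rule part[OF k])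
    let ?d = "\<lambda>N x. step_function (k * S N) (u N) (a N) x - indicator {0..?t} x * \<sigma> x"
    have "(\<lambda>N. \<integral>\<^sup>+x. ennreal ((?d N x)\<^sup>2) * indicator {0..1} x \<partial>lborel) \<longlonglongrightarrow> nn_integral lborel (\<lambda>_::real. 0)"
    proof (rule nn_integral_dominated_convergence)
      show "(\<lambda>x. ennreal ((?d N x)\<^sup>2) * indicator {0..1} x) \<in> borel_measurable lborel" for N
      proof -
        have "(\<lambda>x. ennreal ((?d N x)\<^sup>2) * indicator {0..1} x)
          = (\<lambda>x. ennreal ((step_function (k * S N) (u N) (a N) x - indicator {0..?t} x * \<sigma> x * indicator {0..1} x)\<^sup>2) * indicator {0..1} x)"
          by (auto simp: indicator_def fun_eq_iff)
        also have "\<dots> \<in> borel_measurable lborel"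
          using fm unfolding step_function_def by measurable
        finally show ?thesis .
      qed
      show "(\<lambda>x. ennreal ((2 * B)\<^sup>2) * indicator {0..1::real} x) \<in> borel_measurable lborel"
        by measurable
      show "AE x in lborel. ennreal ((?d N x)\<^sup>2) * indicator {0..1} x \<le> ennreal ((2 * B)\<^sup>2) * indicator {0..1} x" for N
      proof (rule AE_I2)
        fix x
        show "ennreal ((?d N x)\<^sup>2) * indicator {0..1} x \<le> ennreal ((2 * B)\<^sup>2) * indicator {0..1} x"
        proof (cases "x \<in> {0..1}")
          case True
          have "\<bar>step_function (k * S N) (u N) (a N) x\<bar> \<le> B"
            using aB[of x N] True B0 by (auto simp: stepf)
          moreover have "\<bar>indicator {0..?t} x * \<sigma> x\<bar> \<le> B"
            using B[OF True] B0 by (simp add: indicator_def)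
          ultimately have "\<bar>?d N x\<bar> \<le> 2 * B" by linarith
          then have "(?d N x)\<^sup>2 \<le> (2 * B)\<^sup>2" by (rule abs_le_square_iff[THEN iffD1, OF order_trans]) (use B0 in auto)
          then show ?thesis using True by (simp add: ennreal_leI)
        qed simp
      qed
      have "(\<integral>\<^sup>+x. ennreal ((2 * B)\<^sup>2) * indicator {0..1::real} x \<partial>lborel) = ennreal ((2 * B)\<^sup>2)"
        by (subst nn_integral_cmult_indicator) auto
      then show "(\<integral>\<^sup>+x. ennreal ((2 * B)\<^sup>2) * indicator {0..1::real} x \<partial>lborel) < \<infinity>" by simp
      have "AE x in lborel. x \<noteq> (0::real)" by (rule AE_lborel_singleton)
      then show "AE x in lborel. (\<lambda>N. ennreal ((?d N x)\<^sup>2) * indicator {0..1} x) \<longlonglongrightarrow> 0"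
      proof eventually_elim
        fix x :: real assume x0: "x \<noteq> 0"
        show "(\<lambda>N. ennreal ((?d N x)\<^sup>2) * indicator {0..1} x) \<longlonglongrightarrow> 0"
        proof (cases "x \<in> {0<..?t} \<and> x \<le> 1")
          case True
          then have "(\<lambda>N. a N (grid_index (n * S N) x) - \<sigma> x) \<longlonglongrightarrow> \<sigma> x - \<sigma> x"
            by (intro tendsto_diff alim tendsto_const) auto
          then have "(\<lambda>N. ennreal ((a N (grid_index (n * S N) x) - \<sigma> x)\<^sup>2)) \<longlonglongrightarrow> ennreal ((\<sigma> x - \<sigma> x)\<^sup>2)"
            by (intro tendsto_ennrealI tendsto_power)
          then show ?thesis using True by (simp add: stepf)
        next
          case False
          then show ?thesis using x0 by (auto simp: stepf indicator_def)
        qed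
      qed
    qed auto
    then show "(\<lambda>N. \<integral>\<^sup>+x. ennreal ((?d N x)\<^sup>2) * indicator {0..1} x \<partial>lborel) \<longlonglongrightarrow> 0" by simp
  qed
  define K where "K = (\<lambda>N k. {k * S N..<Suc k * S N})"
  define dW where "dW = (\<lambda>N i \<omega>. W (u N (Suc i)) \<omega> - W (u N i) \<omega>)"
  define T where "T = (\<lambda>k N \<omega>. \<Sum>i\<in>K N k. a N i * dW N i \<omega>)"
  have Kn: "K N k \<subseteq> {..<n * S N}" if "k < n" for N k
  proof -
    have "Suc k * S N \<le> n * S N" using that by (intro mult_le_mono1) simp
    then show ?thesis unfolding K_def by (intro subsetI) (metis atLeastLessThan_iff lessThan_iff order_less_le_trans)
  qed
  have lim2: "L2_limit (T k) (\<lambda>\<omega>. Z (real (Suc k) / real n) \<omega> - Z (real k / real n) \<omega>)" if k: "k < n" for k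
  proof -
    have "L2_limit (\<lambda>N \<omega>. step_integral W (Suc k * S N) (u N) (a N) \<omega> - step_integral W (k * S N) (u N) (a N) \<omega>)
      (\<lambda>\<omega>. (Z (real (Suc k) / real n) \<omega> - z0) - (Z (real k / real n) \<omega> - z0))"
      using k by (intro L2_limit_diff lim1) auto
    moreover have "step_integral W (Suc k * S N) (u N) (a N) \<omega> - step_integral W (k * S N) (u N) (a N) \<omega> = T k N \<omega>" for N \<omega>
    proof -
      have "{..<Suc k * S N} = {..<k * S N} \<union> K N k" "{..<k * S N} \<inter> K N k = {}"
        by (auto simp: K_def)
      then have "(\<Sum>i<Suc k * S N. a N i * dW N i \<omega>) = (\<Sum>i<k * S N. a N i * dW N i \<omega>) + T k N \<omega>"
        unfolding T_def by (simp only:) (rule sum.union_disjoint, auto simp: K_def)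
      then show ?thesis by (simp add: step_integral_def dW_def)
    qed
    ultimately show ?thesis by simp
  qed
  have indW: "indep_vars (\<lambda>_. borel) (dW N) {..<n * S N}" for N
    using bm part[of n N] unfolding brownian_motion_def partition01_def dW_def by auto
  have indT: "indep_vars (\<lambda>_. borel) (\<lambda>k. T k N) {..<n}" for N
  proof -
    have disj: "disjoint_family_on (K N) {..<n}"
      unfolding disjoint_family_on_def
    proof (intro ballI impI)
      fix k l :: nat assume "k \<noteq> l"
      have "K N k \<inter> K N l = {}" if "k < l" for k l
      proof -
        have "Suc k * S N \<le> l * S N" using that by (intro mult_le_mono1) simp
        then show ?thesis by (auto simp: K_def simp del: mult_Suc mult_Suc_right)
      qed
      then show "K N k \<inter> K N l = {}" using \<open>k \<noteq> l\<close> by (metis Int_commute nat_neq_iff)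
    qed
    have "indep_vars (\<lambda>k. PiM (K N k) (\<lambda>_. borel)) (\<lambda>k \<omega>. restrict (\<lambda>i. dW N i \<omega>) (K N k)) {..<n}"
      by (rule indep_vars_restrict[OF indW _ disj]) (use Kn in auto)
    then have "indep_vars (\<lambda>_. borel) (\<lambda>k \<omega>. (\<lambda>x. \<Sum>i\<in>K N k. a N i * x i) (restrict (\<lambda>i. dW N i \<omega>) (K N k))) {..<n}"
      by (rule indep_vars_compose2) measurable
    then show ?thesis by (simp add: T_def)
  qed
  show "indep_vars (\<lambda>_. borel) (\<lambda>k \<omega>. Z (real (Suc k) / real n) \<omega> - Z (real k / real n) \<omega>) {..<n}"
    by (rule indep_vars_L2_limit[OF _ _ indT]) (use n lim2 in \<open>simp_all add: lessThan_empty_iff\<close>)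
  fix k assume k: "k < n"
  let ?J = "{real k / real n<..real (Suc k) / real n}"
  let ?v = "\<lambda>N. \<Sum>i\<in>K N k. (a N i)\<^sup>2 / real (n * S N)"
  have apos: "0 < a N i" if "i \<in> K N k" for N i
  proof -
    have "i \<le> n * S N" using Kn[OF k, of N] that by auto
    then show ?thesis unfolding a_def by (intro pos u01)
  qed
  have Kne: "K N k \<noteq> {}" "finite (K N k)" for N using S[of N] by (auto simp: K_def)
  have normT: "distributed M lborel (T k N) (normal_density 0 (sqrt (?v N)))" for N
  proof -
    have "distributed M lborel (\<lambda>\<omega>. \<Sum>i\<in>K N k. a N i * dW N i \<omega>)
      (normal_density (\<Sum>i\<in>K N k. 0) (sqrt (\<Sum>i\<in>K N k. (a N i * sqrt (1 / real (n * S N)))\<^sup>2)))"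
    proof (rule sum_indep_normal)
      show "indep_vars (\<lambda>i. borel) (\<lambda>i \<omega>. a N i * dW N i \<omega>) (K N k)"
        by (rule indep_vars_compose2[OF indep_vars_subset[OF indW Kn[OF k]]]) measurable
      fix i assume i: "i \<in> K N k"
      show "0 < a N i * sqrt (1 / real (n * S N))" using apos[OF i] p[of N] by (simp del: of_nat_mult)
      have i': "Suc i \<le> n * S N" using Kn[OF k, of N] i by auto
      have "u N (Suc i) - u N i = 1 / real (n * S N)"
        by (simp add: u_def add_divide_distrib del: of_nat_mult)
      moreover have "0 \<le> u N i" "u N i < u N (Suc i)" "u N (Suc i) \<le> 1"
        using u01[OF i'] p[of N] by (auto simp: u_def simp del: of_nat_mult intro!: divide_strict_right_mono)
      ultimately have "distributed M lborel (dW N i) (normal_density 0 (sqrt (1 / real (n * S N))))"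
        using bm unfolding brownian_motion_def dW_def by metis
      from normal_density_affine[OF this, of "a N i" 0] apos[OF i] p[of N]
      show "distributed M lborel (\<lambda>\<omega>. a N i * dW N i \<omega>) (normal_density 0 (a N i * sqrt (1 / real (n * S N))))"
        by (simp del: of_nat_mult)
    qed (use Kne in auto)
    then show ?thesis by (simp add: T_def power_mult_distrib del: of_nat_mult)
  qed
  have vlim: "?v \<longlonglongrightarrow> (\<integral>x. indicator ?J x * (\<sigma> x)\<^sup>2 \<partial>lborel)"
  proof -
    let ?h = "\<lambda>N x. \<Sum>i\<in>K N k. (a N i)\<^sup>2 * indicator {u N i<..u N (Suc i)} x"
    have J01: "0 < x \<and> x \<le> 1" if "x \<in> ?J" for x
    proof -
      have "real k / real n \<in> {0..1}" "real (Suc k) / real n \<in> {0..1}" using k by (intro k01; simp)+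
      moreover have "0 \<le> real k / real n" by simp
      ultimately show ?thesis using that unfolding greaterThanAtMost_iff atLeastAtMost_iff by linarith
    qed
    have h: "?h N x = (if x \<in> ?J then (a N (grid_index (n * S N) x))\<^sup>2 else 0)" for N x
      unfolding u_def K_def using grid_step_eq[OF n S[of N], where l = k and k = "Suc k" and b = "\<lambda>i. (a N i)\<^sup>2" and x = x] by simp
    have "(\<integral>x. ?h N x \<partial>lborel) = ?v N" for N
    proof -
      have "u N i \<le> u N (Suc i)" "u N (Suc i) - u N i = 1 / real (n * S N)" for i
        by (simp_all add: u_def add_divide_distrib del: of_nat_mult)
      then have "(\<integral>x. ?h N x \<partial>lborel) = (\<Sum>i\<in>K N k. (a N i)\<^sup>2 * (1 / real (n * S N)))"
        by (subst Bochner_Integration.integral_sum) (auto simp del: of_nat_mult)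
      then show ?thesis by simp
    qed
    moreover have "(\<lambda>N. \<integral>x. ?h N x \<partial>lborel) \<longlonglongrightarrow> (\<integral>x. indicator ?J x * (\<sigma> x)\<^sup>2 \<partial>lborel)"
    proof (rule integral_dominated_convergence[where w = "\<lambda>x. indicator {0..1} x * B\<^sup>2"])
      have "(\<lambda>x. indicator ?J x * (\<sigma> x)\<^sup>2) = (\<lambda>x. indicator ?J x * (indicator {0..1} x * \<sigma> x)\<^sup>2)"
      proof
        fix x show "indicator ?J x * (\<sigma> x)\<^sup>2 = indicator ?J x * (indicator {0..1} x * \<sigma> x)\<^sup>2"
          using J01[of x] by (cases "x \<in> ?J") (simp_all del: greaterThanAtMost_iff)
      qed
      also have "\<dots> \<in> borel_measurable lborel" by measurable
      finally show "(\<lambda>x. indicator ?J x * (\<sigma> x)\<^sup>2) \<in> borel_measurable lborel" .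
      show "?h N \<in> borel_measurable lborel" for N by measurable
      show "integrable lborel (\<lambda>x::real. indicator {0..1} x * B\<^sup>2 :: real)"
        by (intro integrable_mult_left integrable_real_indicator) auto
      show "AE x in lborel. (\<lambda>N. ?h N x) \<longlonglongrightarrow> indicator ?J x * (\<sigma> x)\<^sup>2"
        unfolding h using alim J01 by (intro AE_I2) (auto intro!: tendsto_power simp: indicator_def)
      show "AE x in lborel. norm (?h N x) \<le> indicator {0..1} x * B\<^sup>2" for N
      proof (rule AE_I2)
        fix x
        have "(a N (grid_index (n * S N) x))\<^sup>2 \<le> B\<^sup>2" if "x \<in> ?J"
          using aB[of x N] J01[OF that] B0 by (simp flip: abs_le_square_iff)
        then show "norm (?h N x) \<le> indicator {0..1} x * B\<^sup>2"
          unfolding h using J01[of x] by (auto simp: indicator_def)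
      qed
    qed
    ultimately show ?thesis by simp
  qed
  have vpos: "0 < ?v N" for N
    by (rule sum_pos[OF Kne(2) Kne(1)], rule divide_pos_pos[OF zero_less_power[OF apos] p])
  have ipos: "0 < (\<integral>x. indicator ?J x * (\<sigma> x)\<^sup>2 \<partial>lborel)"
  proof -
    obtain t0 where t0: "t0 \<in> {0..1}" "\<And>t. t \<in> {0..1} \<Longrightarrow> \<sigma> t0 \<le> \<sigma> t"
      using continuous_attains_inf[OF _ _ cont] by auto
    have s0: "0 < \<sigma> t0" using pos t0 by auto
    have "(\<sigma> t0)\<^sup>2 / real n \<le> ?v N" for N
    proof -
      have "(\<Sum>i\<in>K N k. (\<sigma> t0)\<^sup>2 / real (n * S N)) \<le> ?v N"
      proof (intro sum_mono divide_right_mono power_mono)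
        fix i assume "i \<in> K N k"
        then have "i \<le> n * S N" using Kn[OF k, of N] by auto
        then show "\<sigma> t0 \<le> a N i" unfolding a_def by (intro t0(2) u01)
      qed (use s0 in auto)
      moreover have "(\<Sum>i\<in>K N k. (\<sigma> t0)\<^sup>2 / real (n * S N)) = (\<sigma> t0)\<^sup>2 / real n"
      proof -
        have "card (K N k) = S N" by (simp add: K_def)
        moreover have "real (S N) * ((\<sigma> t0)\<^sup>2 / real (n * S N)) = (\<sigma> t0)\<^sup>2 / real n"
          using n S[of N] by simp
        ultimately show ?thesis by (simp only: sum_constant)
      qed
      ultimately show ?thesis by simp
    qed
    then have "(\<sigma> t0)\<^sup>2 / real n \<le> (\<integral>x. indicator ?J x * (\<sigma> x)\<^sup>2 \<partial>lborel)"
      by (intro LIMSEQ_le_const[OF vlim]) auto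
    moreover have "0 < (\<sigma> t0)\<^sup>2 / real n" using s0 n by simp
    ultimately show ?thesis by linarith
  qed
  show "distributed M lborel (\<lambda>\<omega>. Z (real (Suc k) / real n) \<omega> - Z (real k / real n) \<omega>)
      (normal_density 0 (sqrt (\<integral>x. indicator ?J x * (\<sigma> x)\<^sup>2 \<partial>lborel)))"
    by (rule normal_L2_limit[OF lim2[OF k] normT])
       (use vpos ipos vlim in \<open>auto intro!: tendsto_real_sqrt\<close>)
qed

definition centred_normal :: "real \<Rightarrow> real measure" where
  "centred_normal v = density lborel (\<lambda>x. ennreal (normal_density 0 (sqrt v) x))"

lemma sets_centred_normal[simp, measurable_cong]: "sets (centred_normal v) = sets borel"
  and space_centred_normal[simp]: "space (centred_normal v) = UNIV"
  by (simp_all add: centred_normal_def)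

lemma prob_space_centred_normal: "0 < v \<Longrightarrow> prob_space (centred_normal v)"
  unfolding centred_normal_def by (intro prob_space_normal_density) simp

definition sample_path :: "real \<Rightarrow> nat \<Rightarrow> (nat \<Rightarrow> real) \<Rightarrow> nat \<Rightarrow> real" where
  "sample_path z0 n x = (\<lambda>k\<in>{..n}. z0 + (\<Sum>i<k. x i))"

lemma measurable_sample_path[measurable]:
  "sample_path z0 n \<in> measurable (PiM {..<n} (\<lambda>_. borel)) (PiM {..n} (\<lambda>_. borel))"
  unfolding sample_path_def
proof (rule measurable_restrict)
  fix k assume "k \<in> {..n}"
  then show "(\<lambda>x. z0 + (\<Sum>i<k. x i)) \<in> borel_measurable (PiM {..<n} (\<lambda>_. borel))"
    by (intro borel_measurable_add borel_measurable_const borel_measurable_sum measurable_component_singleton) auto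
qed

text \<open>The observations are almost surely a function of the increments, because the path starts at \<open>z0\<close>.\<close>

lemma expectation_observations:
  assumes vm: "volatility_model M z0 \<sigma> Z" and cont: "continuous_on {0..1} \<sigma>"
    and pos: "\<And>t. t \<in> {0..1} \<Longrightarrow> 0 < \<sigma> t" and n: "0 < n" and g: "is_test n g"
  shows "(\<integral>\<omega>. g (observations n Z \<omega>) \<partial>M) = (\<integral>x. g (sample_path z0 n x) \<partial>PiM {..<n} (\<lambda>k. centred_normal
    (\<integral>t. indicator {real k / real n<..real (Suc k) / real n} t * (\<sigma> t)\<^sup>2 \<partial>lborel)))"
proof -
  interpret prob_space M using vm by (auto simp: volatility_model_def brownian_motion_def)
  define X where "X = (\<lambda>k \<omega>. Z (real (Suc k) / real n) \<omega> - Z (real k / real n) \<omega>)"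
  let ?v = "\<lambda>k. \<integral>t. indicator {real k / real n<..real (Suc k) / real n} t * (\<sigma> t)\<^sup>2 \<partial>lborel"
  have indX: "indep_vars (\<lambda>_. borel) X {..<n}"
    unfolding X_def by (rule Z_increment_law(1)[OF vm cont _ n]) (rule pos)
  have normX: "distributed M lborel (X k) (normal_density 0 (sqrt (?v k)))" if "k < n" for k
    unfolding X_def by (rule Z_increment_law(2)[OF vm cont _ n that]) (rule pos)
  have Zm: "Z (real k / real n) \<in> borel_measurable M" if "k \<le> n" for k
    using vm that n unfolding volatility_model_def by auto
  have Xm: "X k \<in> borel_measurable M" if "k \<in> {..<n}" for k
    using that unfolding X_def by (intro borel_measurable_diff Zm) auto
  have dX: "distr M borel (X k) = centred_normal (?v k)" if "k \<in> {..<n}" for k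
  proof -
    have "distr M lborel (X k) = centred_normal (?v k)"
      unfolding centred_normal_def using normX[of k] that by (intro distributed_distr_eq_density) auto
    moreover have "distr M lborel (X k) = distr M borel (X k)" by (rule distr_cong) auto
    ultimately show ?thesis by simp
  qed
  define Y where "Y = (\<lambda>\<omega>. \<lambda>k\<in>{..<n}. X k \<omega>)"
  have Ym[measurable]: "Y \<in> measurable M (PiM {..<n} (\<lambda>_. borel))"
    unfolding Y_def by (intro measurable_restrict Xm)
  have "distr M (PiM {..<n} (\<lambda>_. borel)) Y = PiM {..<n} (\<lambda>k. distr M borel (X k))"
    unfolding Y_def using indX n Xm by (subst (asm) indep_vars_iff_distr_eq_PiM') (auto simp: lessThan_empty_iff)
  also have "\<dots> = PiM {..<n} (\<lambda>k. centred_normal (?v k))"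
    using dX by (intro PiM_cong) auto
  finally have dY: "distr M (PiM {..<n} (\<lambda>_. borel)) Y = PiM {..<n} (\<lambda>k. centred_normal (?v k))" .
  have gm[measurable]: "g \<in> borel_measurable (PiM {..n} (\<lambda>_. borel))"
    using g by (simp add: is_test_def)
  have om: "observations n Z \<in> measurable M (PiM {..n} (\<lambda>_. borel))"
    unfolding observations_def by (intro measurable_restrict Zm) auto
  have ae: "AE \<omega> in M. observations n Z \<omega> = sample_path z0 n (Y \<omega>)"
  proof -
    have "AE \<omega> in M. Z 0 \<omega> = z0" using vm by (simp add: volatility_model_def)
    then show ?thesis
    proof eventually_elim
      fix \<omega> assume z: "Z 0 \<omega> = z0"
      have "z0 + (\<Sum>i<k. Y \<omega> i) = Z (real k / real n) \<omega>" if "k \<le> n" for k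
        using that by (induction k) (simp_all add: z Y_def X_def)
      then show "observations n Z \<omega> = sample_path z0 n (Y \<omega>)"
        by (auto simp: observations_def sample_path_def fun_eq_iff)
    qed
  qed
  have "(\<integral>\<omega>. g (observations n Z \<omega>) \<partial>M) = (\<integral>\<omega>. g (sample_path z0 n (Y \<omega>)) \<partial>M)"
    by (rule integral_cong_AE) (use ae measurable_compose[OF om gm] in auto)
  also have "\<dots> = (\<integral>x. g (sample_path z0 n x) \<partial>distr M (PiM {..<n} (\<lambda>_. borel)) Y)"
    by (subst integral_distr) auto
  finally show ?thesis unfolding dY .
qed

section \<open>Mixtures of independent likelihood ratios\<close>

lemma (in prob_space) abs_expectation_le_sqrt:
  fixes U :: "'a \<Rightarrow> real"
  assumes [simp]: "integrable M U" "integrable M (\<lambda>x. (U x)\<^sup>2)"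
  shows "expectation (\<lambda>x. \<bar>U x\<bar>) \<le> sqrt (expectation (\<lambda>x. (U x)\<^sup>2))"
proof -
  have "0 \<le> variance (\<lambda>x. \<bar>U x\<bar>)" by (rule variance_positive)
  then have "(expectation (\<lambda>x. \<bar>U x\<bar>))\<^sup>2 \<le> expectation (\<lambda>x. (U x)\<^sup>2)"
    by (subst (asm) variance_eq) simp_all
  then show ?thesis by (rule real_le_rsqrt)
qed

lemma (in prob_space) variance_sum_indep:
  fixes Y :: "nat \<Rightarrow> 'a \<Rightarrow> real"
  assumes ind: "indep_vars (\<lambda>_. borel) Y {..<m}"
    and bnd: "\<And>j x. j < m \<Longrightarrow> \<bar>Y j x\<bar> \<le> B"
    and zero: "\<And>j. j < m \<Longrightarrow> expectation (Y j) = 0"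
  shows "expectation (\<lambda>x. (\<Sum>j<m. Y j x)\<^sup>2) = (\<Sum>j<m. expectation (\<lambda>x. (Y j x)\<^sup>2))"
proof -
  have Ym: "Y j \<in> borel_measurable M" if "j < m" for j
    using ind that by (auto simp: indep_vars_def)
  have int: "integrable M (Y j)" if "j < m" for j
    using Ym[OF that] bnd[OF that] by (intro integrable_const_bound[where B = B]) auto
  have int2: "integrable M (\<lambda>x. Y i x * Y j x)" if "i < m" "j < m" for i j
  proof (rule integrable_const_bound[where B = "B * B"])
    show "(\<lambda>x. Y i x * Y j x) \<in> borel_measurable M" using Ym that by auto
    have "norm (Y i x * Y j x) \<le> B * B" for x
      unfolding real_norm_def abs_mult using bnd[OF that(1), of x] bnd[OF that(2), of x]
      by (intro mult_mono) auto
    then show "AE x in M. norm (Y i x * Y j x) \<le> B * B" by simp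
  qed
  have cross: "expectation (\<lambda>x. Y i x * Y j x) = 0" if "i < m" "j < m" "i \<noteq> j" for i j
  proof -
    have "indep_vars (\<lambda>_. borel) Y {i, j}"
      by (rule indep_vars_subset[OF ind]) (use that in auto)
    then have "expectation (\<lambda>x. \<Prod>l\<in>{i, j}. Y l x) = (\<Prod>l\<in>{i, j}. expectation (Y l))"
      using int that by (intro indep_vars_lebesgue_integral) auto
    then show ?thesis using that zero by simp
  qed
  have "expectation (\<lambda>x. (\<Sum>j<m. Y j x)\<^sup>2) = expectation (\<lambda>x. \<Sum>i<m. \<Sum>j<m. Y i x * Y j x)"
    by (simp add: power2_eq_square sum_product)
  also have "\<dots> = (\<Sum>i<m. \<Sum>j<m. expectation (\<lambda>x. Y i x * Y j x))"
    using int2 by (subst Bochner_Integration.integral_sum, force intro!: Bochner_Integration.integrable_sum)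
      (intro sum.cong refl Bochner_Integration.integral_sum, auto)
  also have "\<dots> = (\<Sum>i<m. \<Sum>j<m. if i = j then expectation (\<lambda>x. (Y i x)\<^sup>2) else 0)"
    using cross by (intro sum.cong refl) (auto simp: power2_eq_square)
  also have "\<dots> = (\<Sum>i<m. expectation (\<lambda>x. (Y i x)\<^sup>2))" by simp
  finally show ?thesis .
qed

text \<open>Split \<open>X\<^sub>j\<close> into its part \<open>Y\<^sub>j\<close> below the level \<open>m\<close> and the remainder \<open>R\<^sub>j\<close>. The moment of order \<open>1 + \<kappa>\<close>
  bounds \<open>E R\<^sub>j\<close> by \<open>\<eta>\<close> and \<open>E Y\<^sub>j\<^sup>2\<close> by \<open>m \<eta>\<close>; by independence the variance of the mean of the \<open>Y\<^sub>j\<close> is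
  then at most \<open>\<eta>\<close>.\<close>

lemma (in prob_space) mixture_L1_bound:
  fixes X :: "nat \<Rightarrow> 'a \<Rightarrow> real" and \<kappa> G :: real
  assumes m: "0 < m" and \<kappa>: "0 \<le> \<kappa>" "\<kappa> \<le> 1"
    and ind: "indep_vars (\<lambda>_. borel) X {..<m}"
    and X0: "\<And>j x. j < m \<Longrightarrow> 0 \<le> X j x"
    and int: "\<And>j. j < m \<Longrightarrow> integrable M (X j)" and one: "\<And>j. j < m \<Longrightarrow> expectation (X j) = 1"
    and intp: "\<And>j. j < m \<Longrightarrow> integrable M (\<lambda>x. X j x powr (1 + \<kappa>))"
    and mom: "\<And>j. j < m \<Longrightarrow> expectation (\<lambda>x. X j x powr (1 + \<kappa>)) \<le> G"
  defines "\<eta> \<equiv> real m powr (-\<kappa>) * G"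
  shows "expectation (\<lambda>x. \<bar>(\<Sum>j<m. X j x) / real m - 1\<bar>) \<le> sqrt \<eta> + 2 * \<eta>"
proof -
  have Xm[measurable]: "X j \<in> borel_measurable M" if "j < m" for j
    using int[OF that] by simp
  (* The level m balances the two error terms: both are governed by the same power of m. *)
  define Y where "Y = (\<lambda>j x. if X j x \<le> real m then X j x else 0)"
  define R where "R = (\<lambda>j x. X j x - Y j x)"
  define y where "y = (\<lambda>j. expectation (Y j))"
  have Ym[measurable]: "Y j \<in> borel_measurable M" if "j < m" for j
    using Xm[OF that] unfolding Y_def by measurable
  have Yb: "0 \<le> Y j x" "Y j x \<le> real m" if "j < m" for j x
    using X0[OF that] by (auto simp: Y_def)
  have intY: "integrable M (Y j)" if "j < m" for j
    using Ym[OF that] Yb[OF that] by (intro integrable_const_bound[where B = "real m"]) auto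
  have intY2: "integrable M (\<lambda>x. (Y j x)\<^sup>2)" if "j < m" for j
    using Ym[OF that] Yb[OF that]
    by (intro integrable_const_bound[where B = "(real m)\<^sup>2"]) (auto intro!: power_mono)
  have intR: "integrable M (R j)" if "j < m" for j
    unfolding R_def using int[OF that] intY[OF that] by simp
  have R0: "0 \<le> R j x" if "j < m" for j x using X0[OF that] by (simp add: R_def Y_def)
  have R\<eta>: "expectation (R j) \<le> \<eta>" if j: "j < m" for j
  proof -
    have "expectation (R j) \<le> expectation (\<lambda>x. real m powr (-\<kappa>) * X j x powr (1 + \<kappa>))"
    proof (rule integral_mono[OF intR[OF j]])
      show "integrable M (\<lambda>x. real m powr (-\<kappa>) * X j x powr (1 + \<kappa>))" using intp[OF j] by simp
      fix x
      show "R j x \<le> real m powr (-\<kappa>) * X j x powr (1 + \<kappa>)"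
      proof (cases "X j x \<le> real m")
        case False
        then have x: "0 < X j x" "real m < X j x" using m by auto
        have "real m powr \<kappa> \<le> X j x powr \<kappa>" using x \<kappa> by (intro powr_mono2) auto
        then have "1 \<le> X j x powr \<kappa> * real m powr (-\<kappa>)"
          using m by (simp add: powr_minus field_simps)
        then have "X j x * 1 \<le> X j x * (X j x powr \<kappa> * real m powr (-\<kappa>))"
          using x by (intro mult_left_mono) auto
        then show ?thesis using False x by (simp add: R_def Y_def powr_add mult_ac)
      qed (simp add: R_def Y_def)
    qed
    also have "\<dots> \<le> \<eta>" unfolding \<eta>_def using mom[OF j] by (simp add: mult_left_mono)
    finally show ?thesis .
  qed
  have Y2: "expectation (\<lambda>x. (Y j x)\<^sup>2) \<le> real m * \<eta>" if j: "j < m" for j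
  proof -
    have "expectation (\<lambda>x. (Y j x)\<^sup>2) \<le> expectation (\<lambda>x. real m powr (1 - \<kappa>) * X j x powr (1 + \<kappa>))"
    proof (rule integral_mono[OF intY2[OF j]])
      show "integrable M (\<lambda>x. real m powr (1 - \<kappa>) * X j x powr (1 + \<kappa>))" using intp[OF j] by simp
      fix x
      show "(Y j x)\<^sup>2 \<le> real m powr (1 - \<kappa>) * X j x powr (1 + \<kappa>)"
      proof (cases "X j x \<le> real m \<and> X j x \<noteq> 0")
        case True
        then have x: "0 < X j x" using X0[OF j, of x] by simp
        have "(X j x)\<^sup>2 = X j x powr (1 - \<kappa>) * X j x powr (1 + \<kappa>)"
          using x by (simp add: powr_add[symmetric] powr_numeral)
        also have "\<dots> \<le> real m powr (1 - \<kappa>) * X j x powr (1 + \<kappa>)"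
          using True x \<kappa> by (intro mult_right_mono powr_mono2) auto
        finally show ?thesis using True by (simp add: Y_def)
      qed (auto simp: Y_def)
    qed
    also have "\<dots> = real m powr (1 - \<kappa>) * expectation (\<lambda>x. X j x powr (1 + \<kappa>))" by simp
    also have "\<dots> \<le> real m powr (1 - \<kappa>) * G" using mom[OF j] by (intro mult_left_mono) auto
    also have "\<dots> = real m * \<eta>" using m by (simp add: \<eta>_def powr_diff powr_minus field_simps)
    finally show ?thesis .
  qed
  define U where "U = (\<lambda>x. \<Sum>j<m. (Y j x - y j))"
  define V where "V = (\<lambda>x. \<Sum>j<m. (R j x - expectation (R j)))"
  have intU: "integrable M U" unfolding U_def using intY by auto
  have intV: "integrable M V" unfolding V_def using intR by auto
  have intU2: "integrable M (\<lambda>x. (U x)\<^sup>2)"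
  proof (rule integrable_const_bound[where B = "(\<Sum>j<m. real m + \<bar>y j\<bar>)\<^sup>2"])
    have "\<bar>U x\<bar> \<le> (\<Sum>j<m. real m + \<bar>y j\<bar>)" for x
    proof -
      have "\<bar>U x\<bar> \<le> (\<Sum>j<m. \<bar>Y j x - y j\<bar>)" unfolding U_def by (rule sum_abs)
      also have "\<dots> \<le> (\<Sum>j<m. real m + \<bar>y j\<bar>)"
      proof (rule sum_mono)
        fix j assume "j \<in> {..<m}"
        then show "\<bar>Y j x - y j\<bar> \<le> real m + \<bar>y j\<bar>" using Yb[of j x] by auto
      qed
      finally show ?thesis .
    qed
    then have "norm ((U x)\<^sup>2) \<le> (\<Sum>j<m. real m + \<bar>y j\<bar>)\<^sup>2" for x
      using power_mono[of "\<bar>U x\<bar>" _ 2] by simp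
    then show "AE x in M. norm ((U x)\<^sup>2) \<le> (\<Sum>j<m. real m + \<bar>y j\<bar>)\<^sup>2" by simp
  qed (use intU in simp)
  have EU2: "expectation (\<lambda>x. (U x)\<^sup>2) \<le> real m * (real m * \<eta>)"
  proof -
    have "expectation (\<lambda>x. (U x)\<^sup>2) = (\<Sum>j<m. expectation (\<lambda>x. (Y j x - y j)\<^sup>2))"
      unfolding U_def
    proof (rule variance_sum_indep)
      have "indep_vars (\<lambda>_. borel) (\<lambda>j x. (\<lambda>t. (if t \<le> real m then t else 0) - y j) (X j x)) {..<m}"
        by (rule indep_vars_compose2[OF ind]) measurable
      then show "indep_vars (\<lambda>_. borel) (\<lambda>j x. Y j x - y j) {..<m}" by (simp add: Y_def)
      show "\<bar>Y j x - y j\<bar> \<le> real m" if "j < m" for j x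
      proof -
        have "0 \<le> y j" unfolding y_def using Yb[OF that] by (intro integral_nonneg_AE) auto
        moreover have "y j \<le> expectation (\<lambda>_. real m)"
          unfolding y_def using Yb[OF that] by (intro integral_mono intY[OF that]) auto
        ultimately show ?thesis using Yb[OF that, of x] by (simp add: prob_space)
      qed
      show "expectation (\<lambda>x. Y j x - y j) = 0" if "j < m" for j
        using intY[OF that] by (simp add: y_def prob_space)
    qed
    also have "\<dots> \<le> (\<Sum>j<m. real m * \<eta>)"
    proof (rule sum_mono)
      fix j assume "j \<in> {..<m}"
      then have j: "j < m" by simp
      have "expectation (\<lambda>x. (Y j x - y j)\<^sup>2) = expectation (\<lambda>x. (Y j x)\<^sup>2) - (y j)\<^sup>2"
        unfolding y_def by (rule variance_eq[OF intY[OF j] intY2[OF j]])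
      then show "expectation (\<lambda>x. (Y j x - y j)\<^sup>2) \<le> real m * \<eta>" using Y2[OF j] by (smt (verit) zero_le_power2)
    qed
    finally show ?thesis by simp
  qed
  have EU: "expectation (\<lambda>x. \<bar>U x\<bar>) \<le> real m * sqrt \<eta>"
  proof -
    have "expectation (\<lambda>x. \<bar>U x\<bar>) \<le> sqrt (expectation (\<lambda>x. (U x)\<^sup>2))"
      by (rule abs_expectation_le_sqrt[OF intU intU2])
    also have "\<dots> \<le> sqrt (real m * (real m * \<eta>))" using EU2 by simp
    also have "\<dots> = real m * sqrt \<eta>" by (simp add: real_sqrt_mult flip: mult.assoc)
    finally show ?thesis .
  qed
  have EV: "expectation (\<lambda>x. \<bar>V x\<bar>) \<le> real m * (2 * \<eta>)"
  proof -
    have "expectation (\<lambda>x. \<bar>V x\<bar>) \<le> expectation (\<lambda>x. \<Sum>j<m. (R j x + expectation (R j)))"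
    proof (rule integral_mono)
      show "integrable M (\<lambda>x. \<bar>V x\<bar>)" using intV by simp
      show "integrable M (\<lambda>x. \<Sum>j<m. (R j x + expectation (R j)))" using intR by auto
      fix x
      have "\<bar>V x\<bar> \<le> (\<Sum>j<m. \<bar>R j x - expectation (R j)\<bar>)" unfolding V_def by (rule sum_abs)
      also have "\<dots> \<le> (\<Sum>j<m. (R j x + expectation (R j)))"
      proof (rule sum_mono)
        fix j assume "j \<in> {..<m}"
        then have "0 \<le> R j x" "0 \<le> expectation (R j)" using R0 by (auto intro!: integral_nonneg_AE)
        then show "\<bar>R j x - expectation (R j)\<bar> \<le> R j x + expectation (R j)" by simp
      qed
      finally show "\<bar>V x\<bar> \<le> (\<Sum>j<m. (R j x + expectation (R j)))" .
    qed
    also have "\<dots> = (\<Sum>j<m. 2 * expectation (R j))"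
      using intR by (subst Bochner_Integration.integral_sum) (auto simp: prob_space)
    also have "\<dots> \<le> (\<Sum>j<m. 2 * \<eta>)" using R\<eta> by (intro sum_mono) auto
    finally show ?thesis by simp
  qed
  have split: "(\<Sum>j<m. X j x) / real m - 1 = (U x + V x) / real m" for x
  proof -
    have "y j + expectation (R j) = 1" if "j < m" for j
      unfolding y_def R_def using int[OF that] intY[OF that] one[OF that] by simp
    then have "(\<Sum>j<m. y j + expectation (R j)) = real m" by simp
    moreover have "U x + V x = (\<Sum>j<m. X j x) - (\<Sum>j<m. y j + expectation (R j))"
      by (simp add: U_def V_def R_def flip: sum.distrib sum_subtractf) (simp add: algebra_simps)
    ultimately show ?thesis using m by (simp add: field_simps)
  qed
  have "expectation (\<lambda>x. \<bar>(\<Sum>j<m. X j x) / real m - 1\<bar>) \<le> expectation (\<lambda>x. (\<bar>U x\<bar> + \<bar>V x\<bar>) / real m)"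
  proof (rule integral_mono)
    show "integrable M (\<lambda>x. \<bar>(\<Sum>j<m. X j x) / real m - 1\<bar>)"
      unfolding split using intU intV by auto
    show "integrable M (\<lambda>x. (\<bar>U x\<bar> + \<bar>V x\<bar>) / real m)" using intU intV by auto
    show "\<bar>(\<Sum>j<m. X j x) / real m - 1\<bar> \<le> (\<bar>U x\<bar> + \<bar>V x\<bar>) / real m" for x
      unfolding split using m by (simp add: divide_right_mono)
  qed
  also have "\<dots> = (expectation (\<lambda>x. \<bar>U x\<bar>) + expectation (\<lambda>x. \<bar>V x\<bar>)) / real m"
    using intU intV by simp
  also have "\<dots> \<le> (real m * sqrt \<eta> + real m * (2 * \<eta>)) / real m"
    using EU EV by (intro divide_right_mono add_mono) auto
  also have "\<dots> = sqrt \<eta> + 2 * \<eta>" using m by (simp add: field_simps)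
  finally show ?thesis .
qed

section \<open>Likelihood ratios of centred normal laws\<close>

lemma ln_one_plus_lower:
  fixes x :: real
  assumes "0 \<le> x"
  shows "x - x\<^sup>2 / 2 \<le> ln (1 + x)"
proof -
  let ?D = "\<lambda>t. ln (1 + t) - t + t\<^sup>2 / 2"
  have "?D 0 \<le> ?D x"
  proof (rule DERIV_nonneg_imp_nondecreasing[OF assms])
    fix t :: real assume t: "0 \<le> t" "t \<le> x"
    have "(?D has_real_derivative (1 / (1 + t) - 1 + t)) (at t)"
      using t by (auto intro!: derivative_eq_intros)
    moreover have "1 / (1 + t) - 1 + t = t\<^sup>2 / (1 + t)" using t by (simp add: field_simps power2_eq_square)
    ultimately show "\<exists>y. (?D has_real_derivative y) (at t) \<and> y \<ge> 0" using t by (intro exI[of _ "t\<^sup>2 / (1 + t)"]) simp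
  qed
  then show ?thesis by simp
qed

lemma ln_one_minus_lower:
  fixes x :: real
  assumes "0 \<le> x" "x \<le> 1 / 2"
  shows "- x - x\<^sup>2 / 2 - x ^ 3 \<le> ln (1 - x)"
proof -
  let ?D = "\<lambda>t. ln (1 - t) + t + t\<^sup>2 / 2 + t ^ 3"
  have "?D 0 \<le> ?D x"
  proof (rule DERIV_nonneg_imp_nondecreasing[OF assms(1)])
    fix t :: real assume t: "0 \<le> t" "t \<le> x"
    have t': "t \<le> 1 / 2" using t assms by simp
    have "(?D has_real_derivative (- 1 / (1 - t) + 1 + t + 3 * t\<^sup>2)) (at t)"
      using t' by (auto intro!: derivative_eq_intros)
    moreover have "- 1 / (1 - t) + 1 + t + 3 * t\<^sup>2 = t\<^sup>2 * (2 - 3 * t) / (1 - t)"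
      using t' by (simp add: field_simps power2_eq_square)
    ultimately show "\<exists>y. (?D has_real_derivative y) (at t) \<and> y \<ge> 0"
      using t t' by (intro exI[of _ "t\<^sup>2 * (2 - 3 * t) / (1 - t)"]) simp
  qed
  then show ?thesis by simp
qed

text \<open>The moment of order \<open>1 + \<kappa>\<close>, under the normal law of variance \<open>w\<close>, of the density ratio of the normal law
  of variance \<open>w (1 + f)\<close>; it does not depend on \<open>w\<close>.\<close>

definition moment_factor :: "real \<Rightarrow> real \<Rightarrow> real" where
  "moment_factor \<kappa> f = (1 + f) powr (- \<kappa> / 2) * (1 - \<kappa> * f) powr (- 1 / 2)"

text \<open>The terms of first order in \<open>f\<close> of the two logarithms cancel, the terms of second order add up to
  \<open>\<kappa> (1 + \<kappa>) f\<^sup>2 / 4\<close>, and the factor \<open>1 + 2 A\<close> absorbs the third order. The sharp constant depends on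
  the coefficient \<open>1 / 4\<close>.\<close>

lemma moment_factor_le:
  assumes f: "0 \<le> f" "f \<le> A" "A \<le> 1 / 2" and \<kappa>: "0 \<le> \<kappa>" "\<kappa> \<le> 1"
  shows "moment_factor \<kappa> f \<le> exp (\<kappa> * (1 + \<kappa>) / 4 * (1 + 2 * A) * f\<^sup>2)"
proof -
  have kf: "0 \<le> \<kappa> * f" "\<kappa> * f \<le> 1 / 2"
    using f \<kappa> mult_mono[of \<kappa> 1 f "1/2"] by auto
  have "moment_factor \<kappa> f = exp (- (\<kappa> / 2) * ln (1 + f) - 1 / 2 * ln (1 - \<kappa> * f))"
    using f kf by (simp add: moment_factor_def powr_def exp_add[symmetric])
  also have "- (\<kappa> / 2) * ln (1 + f) - 1 / 2 * ln (1 - \<kappa> * f)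
      \<le> - (\<kappa> / 2) * (f - f\<^sup>2 / 2) - 1 / 2 * (- (\<kappa> * f) - (\<kappa> * f)\<^sup>2 / 2 - (\<kappa> * f) ^ 3)"
  proof -
    have "\<kappa> / 2 * (f - f\<^sup>2 / 2) \<le> \<kappa> / 2 * ln (1 + f)"
      using \<kappa> by (intro mult_left_mono ln_one_plus_lower f) simp
    moreover have "- (\<kappa> / 2) * b - 1 / 2 * d \<le> - (\<kappa> / 2) * a - 1 / 2 * c"
      if "\<kappa> / 2 * a \<le> \<kappa> / 2 * b" "c \<le> d" for a b c d using that by simp
    ultimately show ?thesis using ln_one_minus_lower[OF kf] by blast
  qed
  also have "\<dots> = \<kappa> * (1 + \<kappa>) / 4 * f\<^sup>2 + \<kappa> ^ 3 * f ^ 3 / 2"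
    by (simp add: field_simps power2_eq_square power3_eq_cube)
  also have "\<kappa> ^ 3 * f ^ 3 / 2 \<le> \<kappa> * (1 + \<kappa>) / 4 * (2 * A) * f\<^sup>2"
  proof -
    have "\<kappa> ^ 3 \<le> \<kappa> ^ 1" using \<kappa> by (intro power_decreasing) auto
    also have "\<dots> \<le> \<kappa> * (1 + \<kappa>)" using \<kappa> by (simp add: distrib_left)
    finally have k3: "\<kappa> ^ 3 \<le> \<kappa> * (1 + \<kappa>)" .
    have "f ^ 3 = f * f\<^sup>2" by (simp add: power3_eq_cube power2_eq_square)
    also have "\<dots> \<le> A * f\<^sup>2" using f by (intro mult_right_mono) auto
    finally have "\<kappa> ^ 3 * f ^ 3 \<le> \<kappa> * (1 + \<kappa>) * (A * f\<^sup>2)" using k3 \<kappa> f by (intro mult_mono) auto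
    then show ?thesis by (simp add: field_simps)
  qed
  also have "\<kappa> * (1 + \<kappa>) / 4 * f\<^sup>2 + \<kappa> * (1 + \<kappa>) / 4 * (2 * A) * f\<^sup>2 = \<kappa> * (1 + \<kappa>) / 4 * (1 + 2 * A) * f\<^sup>2"
    by (simp add: field_simps)
  finally show ?thesis by simp
qed

lemma moment_factor_0: "0 \<le> f \<Longrightarrow> moment_factor 0 f = 1"
  by (simp add: moment_factor_def)

definition likelihood_ratio :: "real \<Rightarrow> real \<Rightarrow> real \<Rightarrow> real" where
  "likelihood_ratio w f y = (1 + f) powr (- 1 / 2) * exp (y\<^sup>2 / (2 * w) * (f / (1 + f)))"

lemma measurable_likelihood_ratio[measurable]: "likelihood_ratio w f \<in> borel_measurable borel"
  unfolding likelihood_ratio_def by measurable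

lemma likelihood_ratio_0: "likelihood_ratio w 0 y = 1"
  by (simp add: likelihood_ratio_def)

lemma likelihood_ratio_nonneg: "0 \<le> likelihood_ratio w f y"
  by (simp add: likelihood_ratio_def)

text \<open>Multiplication by a power of the likelihood ratio changes a centred normal density into a multiple of
  another one. With \<open>\<kappa> = 0\<close> this is the density of variance \<open>w (1 + f)\<close>.\<close>

lemma normal_density_likelihood_ratio_powr:
  assumes w: "0 < w" and f: "0 \<le> f" and kf: "\<kappa> * f < 1"
  shows "normal_density 0 (sqrt w) y * likelihood_ratio w f y powr (1 + \<kappa>)
    = moment_factor \<kappa> f * normal_density 0 (sqrt (w * (1 + f) / (1 - \<kappa> * f))) y"
proof -
  let ?s = "w * (1 + f) / (1 - \<kappa> * f)"
  have f1: "0 < 1 + f" and k1: "0 < 1 - \<kappa> * f" using f kf by auto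
  have s: "0 < ?s" using w f1 k1 by simp
  have dens: "normal_density 0 (sqrt v) y = (2 * pi) powr (- 1 / 2) * v powr (- 1 / 2) * exp (- y\<^sup>2 / (2 * v))"
    if "0 < v" for v
    using that by (simp add: normal_density_def powr_minus powr_half_sqrt real_sqrt_mult field_simps)
  have "likelihood_ratio w f y powr (1 + \<kappa>)
    = (1 + f) powr (- (1 + \<kappa>) / 2) * exp ((1 + \<kappa>) * (y\<^sup>2 / (2 * w) * (f / (1 + f))))"
  proof -
    have e: "- 1 / 2 * (1 + \<kappa>) = - (1 + \<kappa>) / 2" by (simp add: field_simps)
    have "likelihood_ratio w f y powr (1 + \<kappa>)
      = ((1 + f) powr (- 1 / 2)) powr (1 + \<kappa>) * exp (y\<^sup>2 / (2 * w) * (f / (1 + f))) powr (1 + \<kappa>)"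
      unfolding likelihood_ratio_def by (rule powr_mult)
    then show ?thesis unfolding powr_powr exp_powr_real e by (simp only: mult.commute)
  qed
  then have "normal_density 0 (sqrt w) y * likelihood_ratio w f y powr (1 + \<kappa>)
    = (2 * pi) powr (- 1 / 2) * (w powr (- 1 / 2) * (1 + f) powr (- (1 + \<kappa>) / 2))
      * exp (- y\<^sup>2 / (2 * w) + (1 + \<kappa>) * (y\<^sup>2 / (2 * w) * (f / (1 + f))))"
    unfolding dens[OF w] by (simp only: exp_add mult_ac)
  also have "- y\<^sup>2 / (2 * w) + (1 + \<kappa>) * (y\<^sup>2 / (2 * w) * (f / (1 + f))) = - y\<^sup>2 / (2 * ?s)"
    using w f1 k1 by (simp add: divide_simps) (simp add: algebra_simps)
  also have "w powr (- 1 / 2) * (1 + f) powr (- (1 + \<kappa>) / 2) = moment_factor \<kappa> f * ?s powr (- 1 / 2)"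
  proof -
    have "?s powr (- 1 / 2) = w powr (- 1 / 2) * (1 + f) powr (- 1 / 2) * (1 - \<kappa> * f) powr (1 / 2)"
    proof -
      have inv: "inverse (t powr (- 1 / 2)) = t powr (1 / 2)" for t :: real
        using powr_minus[of t "- 1 / 2"] by simp
      have "?s powr (- 1 / 2) = (w * (1 + f)) powr (- 1 / 2) / (1 - \<kappa> * f) powr (- 1 / 2)"
        by (rule powr_divide)
      also have "(w * (1 + f)) powr (- 1 / 2) = w powr (- 1 / 2) * (1 + f) powr (- 1 / 2)"
        by (rule powr_mult)
      also have "w powr (- 1 / 2) * (1 + f) powr (- 1 / 2) / (1 - \<kappa> * f) powr (- 1 / 2)
        = w powr (- 1 / 2) * (1 + f) powr (- 1 / 2) * (1 - \<kappa> * f) powr (1 / 2)"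
        unfolding inv[symmetric] by (rule divide_inverse)
      finally show ?thesis .
    qed
    then have "moment_factor \<kappa> f * ?s powr (- 1 / 2)
      = w powr (- 1 / 2) * ((1 + f) powr (- \<kappa> / 2) * (1 + f) powr (- 1 / 2))
        * ((1 - \<kappa> * f) powr (- 1 / 2) * (1 - \<kappa> * f) powr (1 / 2))"
      by (simp add: moment_factor_def mult_ac)
    also have "(1 - \<kappa> * f) powr (- 1 / 2) * (1 - \<kappa> * f) powr (1 / 2) = 1"
      using k1 by (simp flip: powr_add)
    also have "(1 + f) powr (- \<kappa> / 2) * (1 + f) powr (- 1 / 2) = (1 + f) powr (- (1 + \<kappa>) / 2)"
      by (simp add: powr_add[symmetric] field_simps)
    finally show ?thesis by simp
  qed
  finally show ?thesis unfolding dens[OF s] by (simp add: mult_ac)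
qed

lemma likelihood_ratio_moment:
  assumes w: "0 < w" and f: "0 \<le> f" and kf: "\<kappa> * f < 1"
  shows "integrable (centred_normal w) (\<lambda>y. likelihood_ratio w f y powr (1 + \<kappa>))"
    "(\<integral>y. likelihood_ratio w f y powr (1 + \<kappa>) \<partial>centred_normal w) = moment_factor \<kappa> f"
proof -
  have s: "0 < sqrt (w * (1 + f) / (1 - \<kappa> * f))" using w f kf by simp
  show "integrable (centred_normal w) (\<lambda>y. likelihood_ratio w f y powr (1 + \<kappa>))"
    unfolding centred_normal_def
    by (subst integrable_density)
       (use s in \<open>auto simp: normal_density_likelihood_ratio_powr[OF assms]\<close>)
  show "(\<integral>y. likelihood_ratio w f y powr (1 + \<kappa>) \<partial>centred_normal w) = moment_factor \<kappa> f"
    unfolding centred_normal_def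
    by (subst integral_density)
       (use s in \<open>auto simp: normal_density_likelihood_ratio_powr[OF assms]\<close>)
qed

lemma centred_normal_density:
  assumes w: "0 < w" and f: "0 \<le> f"
  shows "centred_normal (w * (1 + f)) = density (centred_normal w) (likelihood_ratio w f)"
proof -
  have "normal_density 0 (sqrt w) y * likelihood_ratio w f y = normal_density 0 (sqrt (w * (1 + f))) y" for y
    using normal_density_likelihood_ratio_powr[OF w f, of 0 y] f
    by (simp add: moment_factor_0 likelihood_ratio_nonneg)
  then show ?thesis
    unfolding centred_normal_def
    by (subst density_density_eq) (auto simp: ennreal_mult'[symmetric] likelihood_ratio_nonneg)
qed

lemma PiM_density_prod:
  fixes M :: "'i \<Rightarrow> 'a measure" and r :: "'i \<Rightarrow> 'a \<Rightarrow> real"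
  assumes I: "finite I" and M: "\<And>i. prob_space (M i)"
    and r[measurable]: "\<And>i. r i \<in> borel_measurable (M i)" and r0: "\<And>i y. 0 \<le> r i y"
    and D: "\<And>i. prob_space (density (M i) (r i))"
  shows "PiM I (\<lambda>i. density (M i) (r i)) = density (PiM I M) (\<lambda>x. \<Prod>i\<in>I. r i (x i))"
proof -
  interpret M: product_prob_space M using M by (intro product_prob_space.intro product_sigma_finite.intro) (auto intro: prob_space_imp_sigma_finite product_prob_space_axioms.intro)
  interpret D: product_prob_space "\<lambda>i. density (M i) (r i)" using D by (intro product_prob_space.intro product_sigma_finite.intro) (auto intro: prob_space_imp_sigma_finite product_prob_space_axioms.intro)
  have sets: "sets (PiM I (\<lambda>i. density (M i) (r i))) = sets (PiM I M)" by (intro sets_PiM_cong) auto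
  show ?thesis
  proof (rule D.PiM_eqI[OF I, symmetric])
    show "sets (density (PiM I M) (\<lambda>x. \<Prod>i\<in>I. r i (x i))) = sets (PiM I (\<lambda>i. density (M i) (r i)))"
      by (simp add: sets)
    fix A assume A: "\<And>i. i \<in> I \<Longrightarrow> A i \<in> sets (density (M i) (r i))"
    then have A'[measurable]: "\<And>i. i \<in> I \<Longrightarrow> A i \<in> sets (M i)" by simp
    have rm: "(\<lambda>x. ennreal (\<Prod>i\<in>I. r i (x i))) \<in> borel_measurable (PiM I M)"
      by measurable
    have "emeasure (density (PiM I M) (\<lambda>x. \<Prod>i\<in>I. r i (x i))) (Pi\<^sub>E I A)
      = (\<integral>\<^sup>+x. ennreal (\<Prod>i\<in>I. r i (x i)) * indicator (Pi\<^sub>E I A) x \<partial>PiM I M)"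
      using I A' by (intro emeasure_density rm sets_PiM_I_finite)
    also have "\<dots> = (\<integral>\<^sup>+x. (\<Prod>i\<in>I. ennreal (r i (x i)) * indicator (A i) (x i)) \<partial>PiM I M)"
    proof (rule nn_integral_cong)
      fix x assume x: "x \<in> space (PiM I M)"
      have "(\<Prod>i\<in>I. indicator (A i) (x i)) = (indicator (Pi\<^sub>E I A) x :: ennreal)"
      proof (cases "\<forall>i\<in>I. x i \<in> A i")
        case True
        then have "x \<in> Pi\<^sub>E I A" using x by (auto simp: space_PiM PiE_def)
        then show ?thesis using True by simp
      next
        case False
        then have "x \<notin> Pi\<^sub>E I A" by (auto simp: PiE_def)
        moreover have "(\<Prod>i\<in>I. indicator (A i) (x i)) = (0 :: ennreal)"
          using False I by (auto simp: prod_zero_iff indicator_def)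
        ultimately show ?thesis by simp
      qed
      then show "ennreal (\<Prod>i\<in>I. r i (x i)) * indicator (Pi\<^sub>E I A) x
        = (\<Prod>i\<in>I. ennreal (r i (x i)) * indicator (A i) (x i))"
        using r0 by (simp add: prod.distrib prod_ennreal)
    qed
    also have "\<dots> = (\<Prod>i\<in>I. \<integral>\<^sup>+y. ennreal (r i y) * indicator (A i) y \<partial>M i)"
      by (rule M.product_nn_integral_prod[OF I]) (use A' in measurable)
    also have "\<dots> = (\<Prod>i\<in>I. emeasure (density (M i) (r i)) (A i))"
      using A' by (intro prod.cong refl emeasure_density[symmetric]) auto
    finally show "emeasure (density (PiM I M) (\<lambda>x. \<Prod>i\<in>I. r i (x i))) (Pi\<^sub>E I A)
      = (\<Prod>i\<in>I. emeasure (density (M i) (r i)) (A i))" .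
  qed
qed

text \<open>The rows of \<open>F\<close> have disjoint supports, so their likelihood ratios depend on disjoint groups of
  coordinates and are independent under the null hypothesis. The smallest of the \<open>m\<close> expectations is at most their
  average.\<close>

lemma gaussian_mixture_testing_bound:
  fixes F :: "nat \<Rightarrow> nat \<Rightarrow> real" and g :: "(nat \<Rightarrow> real) \<Rightarrow> real"
  assumes n: "0 < n" and m: "0 < m" and w: "0 < w" and \<kappa>: "0 \<le> \<kappa>" "\<kappa> \<le> 1"
    and F: "\<And>j k. 0 \<le> F j k" "\<And>j k. F j k < 1"
    and disj: "\<And>i j k. i < m \<Longrightarrow> j < m \<Longrightarrow> i \<noteq> j \<Longrightarrow> k < n \<Longrightarrow> F i k = 0 \<or> F j k = 0"
    and G: "\<And>j. j < m \<Longrightarrow> (\<Prod>k<n. moment_factor \<kappa> (F j k)) \<le> G"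
    and g[measurable]: "g \<in> borel_measurable (PiM {..<n} (\<lambda>_. borel))"
    and g01: "\<And>x. x \<in> space (PiM {..<n} (\<lambda>_. borel :: real measure)) \<Longrightarrow> g x \<in> {0..1}"
  defines "\<eta> \<equiv> real m powr (-\<kappa>) * G"
  shows "\<exists>j<m. (\<integral>x. g x \<partial>PiM {..<n} (\<lambda>k. centred_normal (w * (1 + F j k))))
    \<le> (\<integral>x. g x \<partial>PiM {..<n} (\<lambda>k. centred_normal w)) + sqrt \<eta> + 2 * \<eta>"
proof -
  define Q where "Q = PiM {..<n} (\<lambda>k. centred_normal w)"
  interpret N: product_prob_space "\<lambda>k::nat. centred_normal w"
    using prob_space_centred_normal[OF w] by (intro product_prob_space.intro product_sigma_finite.intro)
      (auto intro: prob_space_imp_sigma_finite product_prob_space_axioms.intro)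
  interpret Q: prob_space Q unfolding Q_def by (rule prob_space_PiM) (rule prob_space_centred_normal[OF w])
  have sQ[measurable_cong]: "sets Q = sets (PiM {..<n} (\<lambda>_. borel))"
    unfolding Q_def by (intro sets_PiM_cong) auto
  have spQ: "space Q = space (PiM {..<n} (\<lambda>_. borel :: real measure))"
    by (rule sets_eq_imp_space_eq[OF sQ])
  define X where "X = (\<lambda>j x. \<Prod>k<n. likelihood_ratio w (F j k) (x k))"
  have Xm[measurable]: "X j \<in> borel_measurable Q" for j
    unfolding X_def by measurable
  have X0: "0 \<le> X j x" for j x unfolding X_def by (intro prod_nonneg) (auto simp: likelihood_ratio_nonneg)
  have \<kappa>F: "\<kappa> * F j k < 1" for j k
    using \<kappa> F[of j k] mult_right_mono[of \<kappa> 1 "F j k"] by simp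
  have mom: "integrable Q (\<lambda>x. X j x powr (1 + c)) \<and> Q.expectation (\<lambda>x. X j x powr (1 + c)) = (\<Prod>k<n. moment_factor c (F j k))"
    if c: "\<And>k. c * F j k < 1" for j c
  proof -
    have e: "X j x powr (1 + c) = (\<Prod>k<n. likelihood_ratio w (F j k) (x k) powr (1 + c))" for x
      unfolding X_def by (rule prod_powr_distrib)
    note lm = likelihood_ratio_moment[OF w F(1) c]
    show ?thesis
      unfolding e Q_def
      by (subst N.product_integral_prod) (use lm in \<open>auto intro!: N.product_integrable_prod\<close>)
  qed
  have X1: "integrable Q (X j)" "Q.expectation (X j) = 1" for j
    using mom[of 0 j] X0 by (simp_all add: moment_factor_0 F)
  have ind: "Q.indep_vars (\<lambda>_. borel) X {..<m}"
  proof -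
    have c: "Q.indep_vars (\<lambda>_. borel) (\<lambda>k x. x k) {..<n}"
    proof (subst Q.indep_vars_iff_distr_eq_PiM')
      show "{..<n} \<noteq> {}" using n by (simp add: lessThan_empty_iff)
      show "(\<lambda>x. x k) \<in> borel_measurable Q" if "k \<in> {..<n}" for k using that by measurable
      have "distr Q (PiM {..<n} (\<lambda>_. borel)) (\<lambda>x. \<lambda>k\<in>{..<n}. x k) = distr Q Q (\<lambda>x. x)"
        by (rule distr_cong) (auto simp: sQ spQ space_PiM PiE_def extensional_def restrict_def)
      also have "\<dots> = Q" by (rule distr_id)
      also have "\<dots> = PiM {..<n} (\<lambda>k. distr Q borel (\<lambda>x. x k))"
        unfolding Q_def
      proof (intro PiM_cong refl)
        fix k assume k: "k \<in> {..<n}"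
        have "distr (PiM {..<n} (\<lambda>k. centred_normal w)) (centred_normal w) (\<lambda>x. x k) = centred_normal w"
          by (rule distr_PiM_component[OF prob_space_centred_normal[OF w] k])
        moreover have "distr (PiM {..<n} (\<lambda>k. centred_normal w)) (centred_normal w) (\<lambda>x. x k)
          = distr (PiM {..<n} (\<lambda>k. centred_normal w)) borel (\<lambda>x. x k)"
          by (rule distr_cong) auto
        ultimately show "centred_normal w = distr (PiM {..<n} (\<lambda>k. centred_normal w)) borel (\<lambda>x. x k)" by simp
      qed
      finally show "distr Q (PiM {..<n} (\<lambda>_. borel)) (\<lambda>x. \<lambda>k\<in>{..<n}. x k) = PiM {..<n} (\<lambda>k. distr Q borel (\<lambda>x. x k))" .
    qed
    define K where "K = (\<lambda>j. {k\<in>{..<n}. F j k \<noteq> 0})"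
    have "Q.indep_vars (\<lambda>j. PiM (K j) (\<lambda>_. borel)) (\<lambda>j x. restrict (\<lambda>k. x k) (K j)) {..<m}"
      by (rule Q.indep_vars_restrict[OF c]) (use disj in \<open>auto simp: K_def disjoint_family_on_def\<close>)
    then have "Q.indep_vars (\<lambda>_. borel) (\<lambda>j x. (\<lambda>y. \<Prod>k\<in>K j. likelihood_ratio w (F j k) (y k)) (restrict (\<lambda>k. x k) (K j))) {..<m}"
      by (rule Q.indep_vars_compose2) measurable
    moreover have "(\<Prod>k\<in>K j. likelihood_ratio w (F j k) (restrict (\<lambda>k. x k) (K j) k)) = X j x" for j x
    proof -
      have "(\<Prod>k\<in>K j. likelihood_ratio w (F j k) (restrict (\<lambda>k. x k) (K j) k)) = (\<Prod>k\<in>K j. likelihood_ratio w (F j k) (x k))"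
        by (intro prod.cong) auto
      also have "\<dots> = X j x" unfolding X_def
        by (rule prod.mono_neutral_left) (auto simp: K_def likelihood_ratio_0)
      finally show ?thesis .
    qed
    ultimately show ?thesis by simp
  qed
  have L1: "Q.expectation (\<lambda>x. \<bar>(\<Sum>j<m. X j x) / real m - 1\<bar>) \<le> sqrt \<eta> + 2 * \<eta>"
    unfolding \<eta>_def
    by (rule Q.mixture_L1_bound[OF m \<kappa> ind]) (use X0 X1 mom[OF \<kappa>F] G in auto)
  have ig: "integrable Q (\<lambda>x. X j x * g x)" for j
  proof (rule Bochner_Integration.integrable_bound[OF X1(1)])
    show "(\<lambda>x. X j x * g x) \<in> borel_measurable Q" by measurable
    show "AE x in Q. norm (X j x * g x) \<le> norm (X j x)"
    proof (rule AE_I2)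
      fix x assume "x \<in> space Q"
      then have "g x \<in> {0..1}" using g01 spQ by simp
      then show "norm (X j x * g x) \<le> norm (X j x)" by (simp add: abs_mult mult_left_le)
    qed
  qed
  have gi: "integrable Q g"
  proof (rule Q.integrable_const_bound[where B = 1])
    show "AE x in Q. norm (g x) \<le> 1"
    proof (rule AE_I2)
      fix x assume "x \<in> space Q"
      then have "g x \<in> {0..1}" using g01 spQ by simp
      then show "norm (g x) \<le> 1" by simp
    qed
  qed measurable
  have alt: "(\<integral>x. g x \<partial>PiM {..<n} (\<lambda>k. centred_normal (w * (1 + F j k)))) = Q.expectation (\<lambda>x. X j x * g x)" for j
  proof -
    have pd: "prob_space (density (centred_normal w) (likelihood_ratio w (F j k)))" for k
      unfolding centred_normal_density[OF w F(1), symmetric] using w F(1)[of j k]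
      by (intro prob_space_centred_normal) (simp add: add_pos_nonneg)
    have "PiM {..<n} (\<lambda>k. centred_normal (w * (1 + F j k)))
      = PiM {..<n} (\<lambda>k. density (centred_normal w) (likelihood_ratio w (F j k)))"
      by (intro PiM_cong refl centred_normal_density w F)
    also have "\<dots> = density Q (X j)"
      unfolding Q_def X_def
      by (rule PiM_density_prod) (auto simp: prob_space_centred_normal[OF w] likelihood_ratio_nonneg pd)
    finally show ?thesis using X0 by (simp add: integral_density)
  qed
  have avg: "(\<Sum>j<m. Q.expectation (\<lambda>x. X j x * g x)) / real m \<le> Q.expectation g + (sqrt \<eta> + 2 * \<eta>)"
  proof -
    let ?A = "\<lambda>x. (\<Sum>j<m. X j x) / real m - 1"
    have eq: "g x + ?A x * g x = (\<Sum>j<m. X j x * g x) / real m" for x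
      unfolding sum_distrib_right[symmetric] by (simp add: algebra_simps)
    have "(\<Sum>j<m. Q.expectation (\<lambda>x. X j x * g x)) / real m = Q.expectation (\<lambda>x. (\<Sum>j<m. X j x * g x) / real m)"
      using ig by simp
    also have "\<dots> = Q.expectation (\<lambda>x. g x + ?A x * g x)"
      unfolding eq ..
    also have "\<dots> \<le> Q.expectation (\<lambda>x. g x + \<bar>?A x\<bar>)"
    proof (rule integral_mono)
      show "integrable Q (\<lambda>x. g x + ?A x * g x)" unfolding eq using ig by simp
      show "integrable Q (\<lambda>x. g x + \<bar>?A x\<bar>)" using gi X1(1) by simp
      fix x assume "x \<in> space Q"
      then have gx: "g x \<in> {0..1}" using g01 spQ by simp
      have "?A x * g x \<le> \<bar>?A x\<bar> * g x" using gx by (intro mult_right_mono) auto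
      also have "\<dots> \<le> \<bar>?A x\<bar>" using gx by (intro mult_left_le) auto
      finally show "g x + ?A x * g x \<le> g x + \<bar>?A x\<bar>" by simp
    qed
    also have "\<dots> = Q.expectation g + Q.expectation (\<lambda>x. \<bar>?A x\<bar>)"
      using gi X1(1) by (subst Bochner_Integration.integral_add) auto
    finally show ?thesis using L1 by linarith
  qed
  have "\<exists>j<m. Q.expectation (\<lambda>x. X j x * g x) \<le> Q.expectation g + (sqrt \<eta> + 2 * \<eta>)"
  proof (rule ccontr)
    assume "\<not> ?thesis"
    then have "(\<Sum>j<m. Q.expectation g + (sqrt \<eta> + 2 * \<eta>)) < (\<Sum>j<m. Q.expectation (\<lambda>x. X j x * g x))"
      using m by (intro sum_strict_mono) (auto simp: lessThan_empty_iff)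
    then have "Q.expectation g + (sqrt \<eta> + 2 * \<eta>) < (\<Sum>j<m. Q.expectation (\<lambda>x. X j x * g x)) / real m"
      using m by (simp add: pos_less_divide_eq mult.commute)
    then show False using avg by linarith
  qed
  then show ?thesis unfolding alt by (simp add: Q_def add.assoc)
qed

section \<open>Localized kernels in Hoelder classes\<close>

lemma hoelder_class_mono:
  assumes "f \<in> hoelder_class D \<beta> K" "K \<le> L"
  shows "f \<in> hoelder_class D \<beta> L"
proof -
  obtain g where g: "\<forall>x\<in>D. g 0 x = f x"
      "\<forall>i<strict_floor \<beta>. \<forall>x\<in>D. (g i has_real_derivative g (Suc i) x) (at x within D)"
      "\<forall>x\<in>D. \<forall>y\<in>D. \<bar>g (strict_floor \<beta>) x - g (strict_floor \<beta>) y\<bar>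
        \<le> K * \<bar>x - y\<bar> powr (\<beta> - real (strict_floor \<beta>))"
    using assms(1) unfolding hoelder_class_def by blast
  have "K * \<bar>x - y\<bar> powr (\<beta> - real (strict_floor \<beta>)) \<le> L * \<bar>x - y\<bar> powr (\<beta> - real (strict_floor \<beta>))" for x y
    using assms(2) by (intro mult_right_mono) auto
  then have "\<forall>x\<in>D. \<forall>y\<in>D. \<bar>g (strict_floor \<beta>) x - g (strict_floor \<beta>) y\<bar>
        \<le> L * \<bar>x - y\<bar> powr (\<beta> - real (strict_floor \<beta>))"
    using g(3) order_trans by blast
  then show ?thesis using g(1,2) unfolding hoelder_class_def by blast
qed

lemma hoelder_class_affine:
  assumes f: "f \<in> hoelder_class UNIV \<beta> K" and h: "0 < h"
  shows "(\<lambda>x. p + q * f ((x - t) / h)) \<in> hoelder_class D \<beta> (\<bar>q\<bar> * K / h powr \<beta>)"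
proof -
  let ?m = "strict_floor \<beta>"
  obtain g where g: "\<And>x. g 0 x = f x"
      "\<And>i x. i < ?m \<Longrightarrow> (g i has_real_derivative g (Suc i) x) (at x)"
      "\<And>x y. \<bar>g ?m x - g ?m y\<bar> \<le> K * \<bar>x - y\<bar> powr (\<beta> - real ?m)"
    using f unfolding hoelder_class_def by auto
  define g' where "g' = (\<lambda>i x. (if i = 0 then p else 0) + q / h ^ i * g i ((x - t) / h))"
  have "(g' i has_real_derivative g' (Suc i) x) (at x within D)" if "i < ?m" for i x
  proof -
    have "((\<lambda>x. (x - t) / h) has_real_derivative 1 / h) (at x within D)"
      using h by (auto intro!: derivative_eq_intros)
    note chain = DERIV_chain2[OF g(2)[OF that] this]
    have "((\<lambda>x. c + q / h ^ i * g i ((x - t) / h)) has_real_derivative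
        q / h ^ i * (g (Suc i) ((x - t) / h) * (1 / h))) (at x within D)" for c
      using DERIV_add[OF DERIV_const[of c] DERIV_cmult[OF chain, of "q / h ^ i"]] by (simp only: add_0_left)
    moreover have "q / h ^ i * (g (Suc i) ((x - t) / h) * (1 / h)) = g' (Suc i) x"
      by (simp add: g'_def)
    ultimately show ?thesis unfolding g'_def by (simp only:)
  qed
  moreover have "\<bar>g' ?m x - g' ?m y\<bar> \<le> \<bar>q\<bar> * K / h powr \<beta> * \<bar>x - y\<bar> powr (\<beta> - real ?m)" for x y
  proof -
    have "g' ?m x - g' ?m y = q / h ^ ?m * (g ?m ((x - t) / h) - g ?m ((y - t) / h))"
      by (simp only: g'_def right_diff_distrib)
    then have "\<bar>g' ?m x - g' ?m y\<bar> = \<bar>q\<bar> / h ^ ?m * \<bar>g ?m ((x - t) / h) - g ?m ((y - t) / h)\<bar>"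
      using h by (simp add: abs_mult)
    also have "\<dots> \<le> \<bar>q\<bar> / h ^ ?m * (K * \<bar>(x - t) / h - (y - t) / h\<bar> powr (\<beta> - real ?m))"
      using h by (intro mult_left_mono g(3)) auto
    also have "(x - t) / h - (y - t) / h = (x - y) / h" by (simp add: diff_divide_distrib)
    also have "\<bar>(x - y) / h\<bar> powr (\<beta> - real ?m) = \<bar>x - y\<bar> powr (\<beta> - real ?m) / h powr (\<beta> - real ?m)"
      using h by (simp add: powr_divide)
    also have "h powr (\<beta> - real ?m) = h powr \<beta> / h ^ ?m"
      using h by (simp add: powr_diff powr_realpow)
    also have "\<bar>q\<bar> / h ^ ?m * (K * (\<bar>x - y\<bar> powr (\<beta> - real ?m) / (h powr \<beta> / h ^ ?m)))
      = \<bar>q\<bar> * K / h powr \<beta> * \<bar>x - y\<bar> powr (\<beta> - real ?m)"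
      using h by (simp add: field_simps)
    finally show ?thesis .
  qed
  moreover have "g' 0 x = p + q * f ((x - t) / h)" for x by (simp add: g'_def g(1))
  ultimately show ?thesis unfolding hoelder_class_def by blast
qed

text \<open>The properties of a bump that the lower bound uses; the Hoelder constant and the height are normalized to 1,
  and the radius \<open>R\<close> is left free instead.\<close>

definition localized_kernel :: "real \<Rightarrow> real \<Rightarrow> (real \<Rightarrow> real) \<Rightarrow> bool" where
  "localized_kernel \<beta> R \<psi> \<longleftrightarrow> 0 < R \<and> \<psi> \<in> hoelder_class UNIV \<beta> 1 \<and> continuous_on UNIV \<psi> \<and>
     (\<forall>x. 0 \<le> \<psi> x \<and> \<psi> x \<le> 1) \<and> \<psi> 0 = 1 \<and> (\<forall>x. R < \<bar>x\<bar> \<longrightarrow> \<psi> x = 0)"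

lemma localized_kernel_recovery_kernel:
  assumes b: "0 < \<beta>" "\<beta> \<le> 1"
  shows "localized_kernel \<beta> 1 (recovery_kernel \<beta>)"
proof -
  have k: "recovery_kernel \<beta> x = max 0 (1 - \<bar>x\<bar> powr \<beta>)" for x
  proof (cases "\<bar>x\<bar> \<le> 1")
    case True
    then have "\<bar>x\<bar> powr \<beta> \<le> 1" using powr_mono2[of \<beta> "\<bar>x\<bar>" 1] b by auto
    then show ?thesis using True by (auto simp: recovery_kernel_le_1[OF b] abs_le_iff)
  next
    case False
    then have "1 \<le> \<bar>x\<bar> powr \<beta>" using powr_mono2[of \<beta> 1 "\<bar>x\<bar>"] b by auto
    moreover have "x \<notin> {-1..1}" using False by auto
    ultimately show ?thesis by (simp add: recovery_kernel_le_1[OF b])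
  qed
  have le: "\<bar>x\<bar> powr \<beta> - \<bar>y\<bar> powr \<beta> \<le> \<bar>x - y\<bar> powr \<beta>" for x y :: real
  proof (cases "\<bar>y\<bar> \<le> \<bar>x\<bar>")
    case True
    then have "\<bar>x\<bar> powr \<beta> - \<bar>y\<bar> powr \<beta> \<le> (\<bar>x\<bar> - \<bar>y\<bar>) powr \<beta>" using b by (intro powr_diff_le) auto
    also have "\<dots> \<le> \<bar>x - y\<bar> powr \<beta>" using True b by (intro powr_mono2) auto
    finally show ?thesis .
  next
    case False
    then have "\<bar>x\<bar> powr \<beta> \<le> \<bar>y\<bar> powr \<beta>" using b by (intro powr_mono2) auto
    then show ?thesis by (smt (verit) powr_ge_zero)
  qed
  have "\<bar>recovery_kernel \<beta> x - recovery_kernel \<beta> y\<bar> \<le> 1 * \<bar>x - y\<bar> powr \<beta>" for x y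
    unfolding k using le[of x y] le[of y x] by (simp add: abs_minus_commute[of y x] max_def abs_if split: if_splits)
  then have "recovery_kernel \<beta> \<in> hoelder_class UNIV \<beta> 1"
    unfolding hoelder_class_le_1[OF b] by blast
  moreover have "continuous_on UNIV (recovery_kernel \<beta>)"
  proof -
    have "continuous_on UNIV (\<lambda>x::real. max 0 (1 - \<bar>x\<bar> powr \<beta>))"
      using b by (intro continuous_intros continuous_on_powr') auto
    moreover have "recovery_kernel \<beta> = (\<lambda>x. max 0 (1 - \<bar>x\<bar> powr \<beta>))" by (rule ext) (rule k)
    ultimately show ?thesis by simp
  qed
  moreover have "recovery_kernel \<beta> x = 0" if "1 < \<bar>x\<bar>" for x
    using ge_one_powr_ge_zero[of "\<bar>x\<bar>" \<beta>] that b by (simp add: k)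
  moreover have "recovery_kernel \<beta> 0 = 1" using k[of 0] b by simp
  ultimately show ?thesis
    unfolding localized_kernel_def by (auto simp: k)
qed

text \<open>A polynomial with a zero of order \<open>k\<close> can be continued by 0 with \<open>k - 1\<close> continuous derivatives.\<close>

lemma power_dvd_higher_pderiv:
  fixes d :: "real poly"
  assumes "d ^ k dvd p" "i \<le> k"
  shows "d ^ (k - i) dvd (pderiv ^^ i) p"
  using assms(2)
proof (induction i)
  case 0
  then show ?case using assms(1) by simp
next
  case (Suc i)
  then obtain q where q: "(pderiv ^^ i) p = d ^ (k - i) * q" by (auto elim: dvdE)
  have ki: "k - i = Suc (k - Suc i)" using Suc.prems by simp
  have "(pderiv ^^ Suc i) p = pderiv (d ^ Suc (k - Suc i) * q)" using q ki by simp
  also have "\<dots> = d ^ (k - Suc i) * (d * pderiv q + smult (of_nat (Suc (k - Suc i))) (pderiv d * q))"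
    unfolding pderiv_mult pderiv_power_Suc by (simp add: algebra_simps del: of_nat_Suc)
  finally show ?case by simp
qed

lemma DERIV_zero_of_abs_le:
  fixes f g :: "real \<Rightarrow> real"
  assumes "(f has_real_derivative 0) (at a)" "f a = 0" "\<And>x. \<bar>g x\<bar> \<le> \<bar>f x\<bar>"
  shows "(g has_real_derivative 0) (at a)"
proof -
  have ga: "g a = 0" using assms(2) assms(3)[of a] by simp
  have lim: "((\<lambda>x. \<bar>f x / (x - a)\<bar>) \<longlongrightarrow> 0) (at a)"
    using assms(1,2) by (intro tendsto_rabs_zero) (simp add: has_field_derivative_iff)
  have "((\<lambda>x. g x / (x - a)) \<longlongrightarrow> 0) (at a)"
  proof (rule Lim_null_comparison[OF always_eventually lim], rule allI)
    fix x show "norm (g x / (x - a)) \<le> \<bar>f x / (x - a)\<bar>"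
      using assms(3)[of x] by (simp add: abs_divide divide_right_mono)
  qed
  then show ?thesis by (simp add: has_field_derivative_iff ga)
qed

text \<open>At the end points the glued function is dominated by the polynomial, whose difference quotients tend to 0.\<close>

lemma poly_glue_zero_DERIV:
  fixes P :: "real poly"
  assumes "poly P 0 = 0" "poly P 1 = 0" "poly (pderiv P) 0 = 0" "poly (pderiv P) 1 = 0"
  defines "G \<equiv> \<lambda>Q x. if x \<in> {0..1} then poly Q x else 0"
  shows "(G P has_real_derivative G (pderiv P) x) (at x)"
proof -
  have le: "\<bar>G P x\<bar> \<le> \<bar>poly P x\<bar>" for x by (simp add: G_def)
  consider "x = 0" | "x = 1" | "x \<in> {0<..<1}" | "x \<in> {..<0} \<union> {1<..}" by fastforce
  then show ?thesis
  proof cases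
    case 1
    have "(poly P has_real_derivative 0) (at 0)" using poly_DERIV[of P 0] assms(3) by simp
    then have "(G P has_real_derivative 0) (at 0)" using assms(1) le by (rule DERIV_zero_of_abs_le)
    then show ?thesis using 1 assms by (simp add: G_def)
  next
    case 2
    have "(poly P has_real_derivative 0) (at 1)" using poly_DERIV[of P 1] assms(4) by simp
    then have "(G P has_real_derivative 0) (at 1)" using assms(2) le by (rule DERIV_zero_of_abs_le)
    then show ?thesis using 2 assms by (simp add: G_def)
  next
    case 3
    have "(G P has_real_derivative poly (pderiv P) x) (at x)"
      by (rule DERIV_cong_ev[THEN iffD1, OF refl _ refl poly_DERIV])
         (use 3 in \<open>auto intro!: eventually_mono[OF eventually_nhds_in_open[of "{0<..<1}"]] simp: G_def\<close>)
    then show ?thesis using 3 by (simp add: G_def)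
  next
    case 4
    have "(G P has_real_derivative 0) (at x)"
      by (rule DERIV_cong_ev[THEN iffD1, OF refl _ refl DERIV_const[of 0]])
         (use 4 in \<open>auto intro!: eventually_mono[OF eventually_nhds_in_open[of "{..<0} \<union> {1<..}"]] simp: G_def\<close>)
    then show ?thesis using 4 by (auto simp: G_def)
  qed
qed

text \<open>A high power of \<open>4 x (1 - x)\<close>, continued by 0, is smooth enough and bounded with its derivatives; centring and
  stretching it makes its Hoelder constant at most 1.\<close>

lemma ex_localized_kernel:
  assumes b: "0 < \<beta>"
  shows "\<exists>R \<psi>. localized_kernel \<beta> R \<psi>"
proof -
  define m where "m = strict_floor \<beta>"
  have ceil: "1 \<le> \<lceil>\<beta>\<rceil>" using b by (simp add: one_le_ceiling)
  then have "real m = of_int \<lceil>\<beta>\<rceil> - 1" by (simp add: m_def strict_floor_def)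
  then have m: "real m < \<beta>" "\<beta> \<le> real m + 1" by linarith+
  (* The exponent m + 2 makes derivatives up to order m + 1 vanish at the end points, so that the m-th is Lipschitz. *)
  define d :: "real poly" where "d = [:0, 4, - 4:]"
  define P where "P = (\<lambda>i. (pderiv ^^ i) (d ^ (m + 2)))"
  define g where "g = (\<lambda>i x. if x \<in> {0..1} then poly (P i) x else 0)"
  have dv: "poly d x = 4 * x * (1 - x)" for x by (simp add: d_def algebra_simps)
  have P0: "poly (P i) 0 = 0" "poly (P i) 1 = 0" if "i \<le> m + 1" for i
  proof -
    have "d ^ (m + 2 - i) dvd P i" unfolding P_def using that by (intro power_dvd_higher_pderiv) auto
    moreover have "m + 2 - i = Suc (m + 1 - i)" using that by simp
    ultimately have "d * d ^ (m + 1 - i) dvd P i" by simp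
    then have "d dvd P i" by (rule dvd_mult_left)
    then show "poly (P i) 0 = 0" "poly (P i) 1 = 0" by (auto simp: dvd_def dv)
  qed
  have deriv: "(g i has_real_derivative g (Suc i) x) (at x)" if "i \<le> m" for i x
  proof -
    have "P (Suc i) = pderiv (P i)" by (simp add: P_def)
    then show ?thesis
      unfolding g_def using P0[of i] P0[of "Suc i"] that by (simp only: ) (rule poly_glue_zero_DERIV; simp)
  qed
  have bnd: "\<exists>B. \<forall>x. \<bar>g i x\<bar> \<le> B" for i
  proof -
    have "compact (poly (P i) ` {0..1})" by (intro compact_continuous_image continuous_intros) auto
    then have "bounded (poly (P i) ` {0..1})" by (rule compact_imp_bounded)
    then obtain B where "\<forall>y\<in>poly (P i) ` {0..1}. norm y \<le> B" unfolding bounded_iff by (elim exE) (rule that)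
    then have "\<bar>g i x\<bar> \<le> max 0 B" for x by (auto simp: g_def le_max_iff_disj)
    then show ?thesis by blast
  qed
  obtain B where B: "\<And>x. \<bar>g m x\<bar> \<le> B" using bnd[of m] by auto
  obtain C where C: "\<And>x. \<bar>g (Suc m) x\<bar> \<le> C" using bnd[of "Suc m"] by auto
  (* C serves for distances up to 1, and 2 * B, the range of the m-th derivative, for larger ones. *)
  define K where "K = max 1 (max (2 * B) C)"
  have lip: "\<bar>g m x - g m y\<bar> \<le> C * \<bar>x - y\<bar>" for x y
    using field_differentiable_bound[of UNIV "g m" "g (Suc m)" C x y] deriv[of m] C by simp
  have hol: "\<bar>g m x - g m y\<bar> \<le> K * \<bar>x - y\<bar> powr (\<beta> - real m)" for x y
  proof (cases "\<bar>x - y\<bar> \<le> 1")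
    case True
    have "\<bar>g m x - g m y\<bar> \<le> C * \<bar>x - y\<bar>" by (rule lip)
    also have "\<dots> \<le> K * \<bar>x - y\<bar> powr (\<beta> - real m)"
    proof (intro mult_mono)
      show "\<bar>x - y\<bar> \<le> \<bar>x - y\<bar> powr (\<beta> - real m)"
        using powr_mono'[of "\<beta> - real m" 1 "\<bar>x - y\<bar>"] True m by (cases "x = y") auto
    qed (auto simp: K_def)
    finally show ?thesis .
  next
    case False
    have "\<bar>g m x - g m y\<bar> \<le> 2 * B" using B[of x] B[of y] by linarith
    also have "\<dots> \<le> K * 1" by (simp add: K_def)
    also have "\<dots> \<le> K * \<bar>x - y\<bar> powr (\<beta> - real m)"
      using False m by (intro mult_left_mono ge_one_powr_ge_zero) (auto simp: K_def)
    finally show ?thesis .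
  qed
  have H: "g 0 \<in> hoelder_class UNIV \<beta> K"
    unfolding hoelder_class_def mem_Collect_eq m_def[symmetric]
    using deriv hol by (intro exI[of _ g]) auto
  (* Stretching by s divides the Hoelder constant by s powr \<beta>. *)
  define s where "s = K powr (1 / \<beta>)"
  have K1: "1 \<le> K" by (simp add: K_def)
  have s: "0 < s" "s powr \<beta> = K" using K1 b by (auto simp: s_def powr_powr)
  define \<psi> where "\<psi> = (\<lambda>x. 0 + 1 * g 0 ((x - (- s / 2)) / s))"
  have "\<psi> \<in> hoelder_class UNIV \<beta> (\<bar>1\<bar> * K / s powr \<beta>)"
    unfolding \<psi>_def by (rule hoelder_class_affine[OF H s(1)])
  then have "\<psi> \<in> hoelder_class UNIV \<beta> 1" using s(2) K1 by simp
  moreover have "continuous_on UNIV \<psi>"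
  proof -
    have cg: "continuous_on UNIV (g 0)"
      using deriv[of 0] by (intro DERIV_continuous_on[where D = "g 1"]) (auto simp: has_field_derivative_at_within)
    have "continuous_on UNIV (\<lambda>x. g 0 ((x - (- s / 2)) / s))"
      by (rule continuous_on_compose2[OF cg]) (use s(1) in \<open>auto intro!: continuous_intros\<close>)
    then show ?thesis by (simp add: \<psi>_def)
  qed
  moreover have "0 \<le> g 0 x \<and> g 0 x \<le> 1" for x
  proof (cases "x \<in> {0..1}")
    case True
    have "0 \<le> (2 * x - 1)\<^sup>2" by simp
    then have "4 * x * (1 - x) \<le> 1" by (simp add: power2_eq_square algebra_simps)
    moreover have "0 \<le> 4 * x * (1 - x)" using True by simp
    ultimately show ?thesis using True by (simp add: g_def P_def poly_power dv power_le_one del: power_Suc)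
  qed (auto simp: g_def)
  then have "0 \<le> \<psi> x \<and> \<psi> x \<le> 1" for x by (simp add: \<psi>_def)
  moreover have "\<psi> 0 = 1" using s(1) by (simp add: \<psi>_def g_def P_def poly_power dv)
  moreover have "\<psi> x = 0" if "s < \<bar>x\<bar>" for x
  proof -
    have "(x - (- s / 2)) / s \<notin> {0..1}" using s(1) that by (auto simp: field_simps abs_if split: if_splits)
    then show ?thesis by (simp only: \<psi>_def g_def if_False)
  qed
  ultimately have "localized_kernel \<beta> s \<psi>" using s(1) by (simp add: localized_kernel_def)
  then show ?thesis by blast
qed

lemma localized_kernel_square_integral:
  assumes "localized_kernel \<beta> R \<psi>"
  shows "integrable lborel (\<lambda>x. (\<psi> x)\<^sup>2)" "0 < (\<integral>x. (\<psi> x)\<^sup>2 \<partial>lborel)"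
    "(L2_norm UNIV \<psi>)\<^sup>2 = (\<integral>x. (\<psi> x)\<^sup>2 \<partial>lborel)"
proof -
  have R: "0 < R" and c: "continuous_on UNIV \<psi>" and b: "\<And>x. 0 \<le> \<psi> x" "\<And>x. \<psi> x \<le> 1"
    and one: "\<psi> 0 = 1" and z: "\<And>x. R < \<bar>x\<bar> \<Longrightarrow> \<psi> x = 0"
    using assms by (auto simp: localized_kernel_def)
  have [measurable]: "\<psi> \<in> borel_measurable borel" by (rule borel_measurable_continuous_onI[OF c])
  show int: "integrable lborel (\<lambda>x. (\<psi> x)\<^sup>2)"
  proof (rule Bochner_Integration.integrable_bound)
    show "integrable lborel (indicator {-R..R} :: real \<Rightarrow> real)"
      using R by (intro integrable_real_indicator) auto
    have "(\<psi> x)\<^sup>2 \<le> indicator {-R..R} x" for x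
    proof (cases "x \<in> {-R..R}")
      case True
      then show ?thesis using b[of x] by (simp add: power_le_one)
    next
      case False
      then have "R < \<bar>x\<bar>" by auto
      then show ?thesis by (simp add: z)
    qed
    then show "AE x in lborel. norm ((\<psi> x)\<^sup>2) \<le> norm (indicator {-R..R} x :: real)" by simp
  qed simp
  show "0 < (\<integral>x. (\<psi> x)\<^sup>2 \<partial>lborel)"
  proof -
    have "isCont \<psi> 0" using c by (simp add: continuous_on_eq_continuous_at)
    then have "\<exists>e>0. \<forall>x. dist x 0 < e \<longrightarrow> dist (\<psi> x) (\<psi> 0) < 1 / 2"
      unfolding continuous_at_eps_delta by (rule allE[of _ "1 / 2"]) simp
    then obtain e where e: "0 < e" "\<And>x. \<bar>x\<bar> < e \<Longrightarrow> \<bar>\<psi> x - \<psi> 0\<bar> < 1 / 2"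
      by (auto simp: dist_real_def)
    have "(\<integral>x. 1 / 4 * indicator {0<..<e} x \<partial>lborel) \<le> (\<integral>x. (\<psi> x)\<^sup>2 \<partial>lborel)"
    proof (rule integral_mono[OF _ int])
      show "integrable lborel (\<lambda>x. 1 / 4 * indicator {0<..<e} x :: real)"
        using e(1) by (intro integrable_mult_right integrable_real_indicator) auto
      fix x
      show "1 / 4 * indicator {0<..<e} x \<le> (\<psi> x)\<^sup>2"
      proof (cases "x \<in> {0<..<e}")
        case True
        then have "\<bar>\<psi> x - 1\<bar> < 1 / 2" using e(2)[of x] one by auto
          then have "1 / 2 \<le> \<psi> x" by linarith
        then have "(1 / 2)\<^sup>2 \<le> (\<psi> x)\<^sup>2" by (intro power_mono) auto
        then show ?thesis using True by (simp add: power2_eq_square)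
      qed simp
    qed
    then show ?thesis using e(1) by simp
  qed
  show "(L2_norm UNIV \<psi>)\<^sup>2 = (\<integral>x. (\<psi> x)\<^sup>2 \<partial>lborel)"
    by (simp add: L2_norm_def set_lebesgue_integral_def)
qed

section \<open>A least favourable family of volatilities\<close>

lemma integrable_cell: "integrable lborel (indicator {s<..t} :: real \<Rightarrow> real)"
  by (cases "s \<le> t") auto

text \<open>The Cauchy-Schwarz inequality \<open>\<mu>\<^sup>2 \<le> n \<integral> f\<^sup>2\<close> on each cell is what makes discrete observation no more
  informative than the energy of \<open>f\<close>. The last claim localizes \<open>f\<close> on the cells that it affects.\<close>

lemma cell_average:
  fixes f :: "real \<Rightarrow> real"
  assumes n: "0 < n" and f[measurable]: "f \<in> borel_measurable borel" and b: "\<And>x. 0 \<le> f x" "\<And>x. f x \<le> A"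
  defines "I \<equiv> \<lambda>k. {real k / real n<..real (Suc k) / real n}"
  defines "\<mu> \<equiv> \<lambda>k. real n * (\<integral>x. indicator (I k) x * f x \<partial>lborel)"
  shows "integrable lborel (\<lambda>x. indicator (I k) x * f x)"
    and "0 \<le> \<mu> k" and "\<mu> k \<le> A" and "(\<mu> k)\<^sup>2 \<le> real n * (\<integral>x. indicator (I k) x * (f x)\<^sup>2 \<partial>lborel)"
    and "(\<integral>x. indicator (I k) x * (1 + f x) \<partial>lborel) = 1 / real n * (1 + \<mu> k)"
    and "\<mu> k \<noteq> 0 \<Longrightarrow> \<exists>x\<in>I k. f x \<noteq> 0"
proof -
  have len: "(\<integral>x. indicator (I k) x \<partial>lborel) = 1 / real n"
    using n by (simp add: I_def measure_lborel_Ioc divide_right_mono flip: diff_divide_distrib)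
  have i1: "integrable lborel (indicator (I k) :: real \<Rightarrow> real)" unfolding I_def by (rule integrable_cell)
  have Im[measurable]: "I k \<in> sets borel" by (simp add: I_def)
  have i2: "integrable lborel (\<lambda>x. indicator (I k) x * f x)"
    using b by (intro Bochner_Integration.integrable_bound[OF integrable_mult_right[OF i1, of A]])
      (auto simp: indicator_def intro!: order_trans[OF b(2)])
  have A0: "0 \<le> A" using b[of 0] by linarith
  have i3: "integrable lborel (\<lambda>x. indicator (I k) x * (f x)\<^sup>2)"
  proof (rule Bochner_Integration.integrable_bound[OF integrable_mult_right[OF i1, of "A\<^sup>2"]])
    have "norm (indicator (I k) x * (f x)\<^sup>2) \<le> norm (A\<^sup>2 * indicator (I k) x)" for x
      using b[of x] by (auto simp: indicator_def intro!: power_mono)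
    then show "AE x in lborel. norm (indicator (I k) x * (f x)\<^sup>2) \<le> norm (A\<^sup>2 * indicator (I k) x)" by simp
  qed simp
  show "integrable lborel (\<lambda>x. indicator (I k) x * f x)" by (rule i2)
  let ?J = "\<integral>x. indicator (I k) x * f x \<partial>lborel"
  have J0: "0 \<le> ?J" using b by (intro integral_nonneg_AE) auto
  show "0 \<le> \<mu> k" using J0 by (simp add: \<mu>_def)
  have "?J \<le> (\<integral>x. A * indicator (I k) x \<partial>lborel)"
    using b by (intro integral_mono i2 integrable_mult_right i1) (auto simp: indicator_def)
  also have "\<dots> = A / real n" using len by simp
  finally show "\<mu> k \<le> A" using n by (simp add: \<mu>_def field_simps)
  show "(\<mu> k)\<^sup>2 \<le> real n * (\<integral>x. indicator (I k) x * (f x)\<^sup>2 \<partial>lborel)"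
  proof -
    let ?q = "\<integral>x. indicator (I k) x * (f x)\<^sup>2 \<partial>lborel"
    have "0 \<le> (\<integral>x. indicator (I k) x * (f x - \<mu> k)\<^sup>2 \<partial>lborel)" by (intro integral_nonneg_AE) auto
    also have "\<dots> = (\<integral>x. indicator (I k) x * (f x)\<^sup>2 - 2 * \<mu> k * (indicator (I k) x * f x) + (\<mu> k)\<^sup>2 * indicator (I k) x \<partial>lborel)"
      by (intro Bochner_Integration.integral_cong refl) (simp add: power2_diff algebra_simps)
    also have "\<dots> = ?q - 2 * \<mu> k * ?J + (\<mu> k)\<^sup>2 * (1 / real n)"
      using i1 i2 i3 len by simp
    also have "?J = \<mu> k / real n" using n by (simp add: \<mu>_def)
    finally show ?thesis using n by (simp add: field_simps power2_eq_square)
  qed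
  have "(\<integral>x. indicator (I k) x * (1 + f x) \<partial>lborel) = 1 / real n + ?J"
    using i1 i2 len by (simp add: distrib_left)
  then show "(\<integral>x. indicator (I k) x * (1 + f x) \<partial>lborel) = 1 / real n * (1 + \<mu> k)"
    using n by (simp add: \<mu>_def field_simps)
  show "\<exists>x\<in>I k. f x \<noteq> 0" if "\<mu> k \<noteq> 0"
  proof (rule ccontr)
    assume "\<not> ?thesis"
    then have zero: "indicator (I k) x * f x = 0" for x by (auto simp: indicator_def)
    have "?J = 0" unfolding zero by simp
    then show False using that by (simp add: \<mu>_def)
  qed
qed

lemma sum_cells_le:
  fixes q :: "real \<Rightarrow> real"
  assumes n: "0 < n" and q: "integrable lborel q" "\<And>x. 0 \<le> q x"
  shows "(\<Sum>k<n. \<integral>x. indicator {real k / real n<..real (Suc k) / real n} x * q x \<partial>lborel) \<le> (\<integral>x. q x \<partial>lborel)"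
proof -
  let ?I = "\<lambda>k. {real k / real n<..real (Suc k) / real n}"
  have i: "integrable lborel (\<lambda>x. indicator (?I k) x * q x)" for k
    by (rule Bochner_Integration.integrable_bound[OF q(1)])
       (use q in \<open>auto simp: indicator_def\<close>)
  have s: "(\<Sum>k<n. indicator (?I k) x) \<le> (1 :: real)" for x
    using grid_step_eq[OF n, of 1 "\<lambda>_. 1" x 0 n] n by (simp add: atLeast0LessThan)
  have "(\<Sum>k<n. \<integral>x. indicator (?I k) x * q x \<partial>lborel) = (\<integral>x. (\<Sum>k<n. indicator (?I k) x * q x) \<partial>lborel)"
    using i by (subst Bochner_Integration.integral_sum) auto
  also have "\<dots> \<le> (\<integral>x. q x \<partial>lborel)"
  proof (rule integral_mono)
    show "integrable lborel (\<lambda>x. \<Sum>k<n. indicator (?I k) x * q x)"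
      using i by (intro Bochner_Integration.integrable_sum)
    show "(\<Sum>k<n. indicator (?I k) x * q x) \<le> q x" for x
      unfolding sum_distrib_right[symmetric] using s[of x] q(2)[of x] by (intro mult_left_le_one_le) (auto intro: sum_nonneg)
  qed (rule q)
  finally show ?thesis .
qed

text \<open>The alternatives \<open>1 + f\<^sub>j\<close> are not normalized. Dividing by the total variance \<open>1 + I\<close> can only decrease the
  Hoelder constant, and since \<open>I\<close> is at most \<open>2 R h A\<close> it costs little of the height of the bump.\<close>

lemma lower_bound_fixed_n:
  fixes P :: "(real \<Rightarrow> real) \<Rightarrow> 'a measure" and n m :: nat
  assumes ker: "localized_kernel \<beta> R \<psi>" and L: "0 < L"
    and model: "\<And>\<sigma>. volatility \<sigma> \<Longrightarrow> volatility_model (P \<sigma>) z0 \<sigma> Z"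
    and g: "is_test n g" and level: "(\<integral>\<omega>. g (observations n Z \<omega>) \<partial>P (\<lambda>_. 1)) \<le> \<alpha>"
    and n: "0 < n" and m: "0 < m" and h: "0 < h" "1 / real n \<le> R * h" "real m * (3 * R * h) \<le> b - a"
    and A: "0 \<le> A" "A \<le> 1 / 2" "A / h powr \<beta> \<le> L" and \<kappa>: "0 \<le> \<kappa>" "\<kappa> \<le> 1"
    and \<delta>: "\<delta> \<le> (1 + A) / (1 + 2 * R * h * A) - 1"
  defines "\<eta> \<equiv> real m powr (-\<kappa>) *
    exp (\<kappa> * (1 + \<kappa>) / 4 * (1 + 2 * A) * (real n * (A\<^sup>2 * h * (\<integral>x. (\<psi> x)\<^sup>2 \<partial>lborel))))"
  shows "\<exists>\<sigma>. volatility \<sigma> \<and> normalized_sq \<sigma> \<in> hoelder_class {0..1} \<beta> L \<and>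
    ereal \<delta> \<le> dist_const {a..b} \<sigma> \<and>
    (\<integral>\<omega>. g (observations n Z \<omega>) \<partial>P \<sigma>) \<le> \<alpha> + sqrt \<eta> + 2 * \<eta>"
proof -
  have R: "0 < R" and hol: "\<psi> \<in> hoelder_class UNIV \<beta> 1" and c: "continuous_on UNIV \<psi>"
    and \<psi>01: "\<And>x. 0 \<le> \<psi> x" "\<And>x. \<psi> x \<le> 1" and one: "\<psi> 0 = 1" and z: "\<And>x. R < \<bar>x\<bar> \<Longrightarrow> \<psi> x = 0"
    using ker by (auto simp: localized_kernel_def)
  have \<psi>m[measurable]: "\<psi> \<in> borel_measurable borel" by (rule borel_measurable_continuous_onI[OF c])
  (* Two bumps of radius R h need the distance 2 R h; the third R h is at least one cell length. *)
  define t where "t = (\<lambda>j::nat. a + 3 * R * h * real j)"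
  define f where "f = (\<lambda>j x. A * \<psi> ((x - t j) / h))"
  have fc: "continuous_on UNIV (f j)" for j
  proof -
    have "continuous_on UNIV (\<lambda>x. \<psi> ((x - t j) / h))"
      by (rule continuous_on_compose2[OF c]) (use h in \<open>auto intro!: continuous_intros\<close>)
    then show ?thesis unfolding f_def by (intro continuous_intros)
  qed
  have fm[measurable]: "f j \<in> borel_measurable borel" for j by (rule borel_measurable_continuous_onI[OF fc])
  have f0: "0 \<le> f j x" "f j x \<le> A" for j x
    using A \<psi>01 by (auto simp: f_def mult_left_le)
  have fz: "\<bar>x - t j\<bar> \<le> R * h" if "f j x \<noteq> 0" for j x
  proof (rule ccontr)
    assume "\<not> ?thesis"
    then have "R < \<bar>(x - t j) / h\<bar>" using h by (simp add: field_simps)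
    then show False using z that by (simp add: f_def)
  qed
  define \<sigma> where "\<sigma> = (\<lambda>j x. sqrt (1 + f j x))"
  have s2: "(\<sigma> j x)\<^sup>2 = 1 + f j x" for j x using f0[of j x] by (simp add: \<sigma>_def)
  have scont: "continuous_on S (\<sigma> j)" for S j
    unfolding \<sigma>_def by (intro continuous_intros continuous_on_subset[OF fc]) auto
  have spos: "0 < \<sigma> j x" for j x using f0[of j x] by (simp add: \<sigma>_def)
  have vol: "volatility \<tau>" if "continuous_on {0..1} \<tau>" "\<And>x. x \<in> {0..1} \<Longrightarrow> 0 < \<tau> x" for \<tau>
  proof -
    have "set_borel_measurable lborel {0..1} \<tau>"
      unfolding set_borel_measurable_def using borel_measurable_continuous_on_indicator[OF _ that(1)] by simp
    moreover have "set_integrable lborel {0..1} (\<lambda>x. (\<tau> x)\<^sup>2)"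
      by (rule borel_integrable_atLeastAtMost') (intro continuous_intros that(1))
    ultimately show ?thesis using that(2) by (simp add: volatility_def)
  qed
  have vs: "volatility (\<sigma> j)" for j using scont spos by (intro vol)
  define F where "F = (\<lambda>j k. real n * (\<integral>x. indicator {real k / real n<..real (Suc k) / real n} x * f j x \<partial>lborel))"
  have Fe: "F j k = real n * (\<integral>x. indicator {real k / real n<..real (Suc k) / real n} x * f j x \<partial>lborel)" for j k
    by (simp only: F_def)
  note cell = cell_average[OF n fm f0, folded Fe]
  have N2: "integrable lborel (\<lambda>x. (\<psi> x)\<^sup>2)" by (rule localized_kernel_square_integral(1)[OF ker])
  have f2: "integrable lborel (\<lambda>x. (f j x)\<^sup>2)" "(\<integral>x. (f j x)\<^sup>2 \<partial>lborel) = A\<^sup>2 * h * (\<integral>x. (\<psi> x)\<^sup>2 \<partial>lborel)" for j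
  proof -
    have e: "(f j (t j + h * x))\<^sup>2 = A\<^sup>2 * (\<psi> x)\<^sup>2" for x using h by (simp add: f_def power_mult_distrib)
    show "integrable lborel (\<lambda>x. (f j x)\<^sup>2)"
      by (subst lborel_integrable_real_affine_iff[of h _ "t j", symmetric]) (use h N2 e in auto)
    show "(\<integral>x. (f j x)\<^sup>2 \<partial>lborel) = A\<^sup>2 * h * (\<integral>x. (\<psi> x)\<^sup>2 \<partial>lborel)"
      by (subst lborel_integral_real_affine[of h _ "t j"]) (use h e in auto)
  qed
  let ?G = "exp (\<kappa> * (1 + \<kappa>) / 4 * (1 + 2 * A) * (real n * (A\<^sup>2 * h * (\<integral>x. (\<psi> x)\<^sup>2 \<partial>lborel))))"
  have G: "(\<Prod>k<n. moment_factor \<kappa> (F j k)) \<le> ?G" for j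
  proof -
    let ?c = "\<kappa> * (1 + \<kappa>) / 4 * (1 + 2 * A)"
    have c0: "0 \<le> ?c" using \<kappa> A by simp
    have "(\<Prod>k<n. moment_factor \<kappa> (F j k)) \<le> (\<Prod>k<n. exp (?c * (F j k)\<^sup>2))"
    proof (rule prod_mono, intro conjI)
      fix k
      show "0 \<le> moment_factor \<kappa> (F j k)" by (simp add: moment_factor_def)
      show "moment_factor \<kappa> (F j k) \<le> exp (?c * (F j k)\<^sup>2)"
        by (rule moment_factor_le[OF cell(2) cell(3) A(2) \<kappa>])
    qed
    also have "\<dots> = exp (?c * (\<Sum>k<n. (F j k)\<^sup>2))" by (simp add: exp_sum sum_distrib_left)
    also have "(\<Sum>k<n. (F j k)\<^sup>2) \<le> (\<Sum>k<n. real n * (\<integral>x. indicator {real k / real n<..real (Suc k) / real n} x * (f j x)\<^sup>2 \<partial>lborel))"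
      by (intro sum_mono cell(4))
    also have "\<dots> \<le> real n * (\<integral>x. (f j x)\<^sup>2 \<partial>lborel)"
      unfolding sum_distrib_left[symmetric] by (intro mult_left_mono sum_cells_le n f2) auto
    also have "\<dots> = real n * (A\<^sup>2 * h * (\<integral>x. (\<psi> x)\<^sup>2 \<partial>lborel))" unfolding f2 ..
    finally show ?thesis using c0 by (simp add: mult_left_mono)
  qed
  have disj: "F i k = 0 \<or> F j k = 0" if "i \<noteq> j" for i j k
  proof (rule ccontr)
    assume "\<not> ?thesis"
    then obtain x y where x: "x \<in> {real k / real n<..real (Suc k) / real n}" "f i x \<noteq> 0"
      and y: "y \<in> {real k / real n<..real (Suc k) / real n}" "f j y \<noteq> 0"
      using cell(6) by blast
    have "real (Suc k) / real n = real k / real n + 1 / real n" by (simp add: add_divide_distrib)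
    then have "\<bar>x - y\<bar> < 1 / real n" using x(1) y(1) unfolding greaterThanAtMost_iff by linarith
    then have "\<bar>t i - t j\<bar> < 3 * (R * h)" using fz[OF x(2)] fz[OF y(2)] h(2) by linarith
    moreover have "\<bar>t i - t j\<bar> = 3 * (R * h) * \<bar>real i - real j\<bar>"
      using R h(1) by (simp add: t_def abs_mult flip: right_diff_distrib)
    moreover have "3 * (R * h) * 1 \<le> 3 * (R * h) * \<bar>real i - real j\<bar>"
      using R h(1) that by (intro mult_left_mono) auto
    ultimately show False by linarith
  qed
  have gm: "g \<in> borel_measurable (PiM {..n} (\<lambda>_. borel))"
    and g01: "\<And>x. x \<in> space (PiM {..n} (\<lambda>_. borel :: real measure)) \<Longrightarrow> g x \<in> {0..1}"
    using g by (auto simp: is_test_def)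
  let ?g = "\<lambda>x. g (sample_path z0 n x)"
  have "\<exists>j<m. (\<integral>x. ?g x \<partial>PiM {..<n} (\<lambda>k. centred_normal (1 / real n * (1 + F j k))))
    \<le> (\<integral>x. ?g x \<partial>PiM {..<n} (\<lambda>k. centred_normal (1 / real n))) + sqrt \<eta> + 2 * \<eta>"
    unfolding \<eta>_def
  proof (rule gaussian_mixture_testing_bound[OF n m _ \<kappa>])
    show "?g \<in> borel_measurable (PiM {..<n} (\<lambda>_. borel))"
      using gm by measurable
    show "?g x \<in> {0..1}" if "x \<in> space (PiM {..<n} (\<lambda>_. borel :: real measure))" for x
      by (intro g01 measurable_space[OF measurable_sample_path that])
    show "F j k < 1" for j k using cell(3)[of j k] A by linarith
  qed (use n cell(2) G disj in auto)
  then obtain j where j: "j < m" "(\<integral>x. ?g x \<partial>PiM {..<n} (\<lambda>k. centred_normal (1 / real n * (1 + F j k))))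
    \<le> (\<integral>x. ?g x \<partial>PiM {..<n} (\<lambda>k. centred_normal (1 / real n))) + sqrt \<eta> + 2 * \<eta>" by blast
  have E1: "(\<integral>\<omega>. g (observations n Z \<omega>) \<partial>P (\<sigma> j)) = (\<integral>x. ?g x \<partial>PiM {..<n} (\<lambda>k. centred_normal (1 / real n * (1 + F j k))))"
    using expectation_observations[OF model[OF vs] scont spos n g] unfolding s2 cell(5) .
  have E0: "(\<integral>\<omega>. g (observations n Z \<omega>) \<partial>P (\<lambda>_. 1)) = (\<integral>x. ?g x \<partial>PiM {..<n} (\<lambda>k. centred_normal (1 / real n)))"
  proof -
    have "volatility (\<lambda>_. 1)" by (intro vol) auto
    from expectation_observations[OF model[OF this] _ _ n g]
    have "(\<integral>\<omega>. g (observations n Z \<omega>) \<partial>P (\<lambda>_. 1)) = (\<integral>x. ?g x \<partial>PiM {..<n} (\<lambda>k. centred_normal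
      (\<integral>t. indicator {real k / real n<..real (Suc k) / real n} t * (1::real)\<^sup>2 \<partial>lborel)))" by simp
    moreover have "(\<integral>t. indicator {real k / real n<..real (Suc k) / real n} t * (1::real)\<^sup>2 \<partial>lborel) = 1 / real n" for k
      using cell_average(5)[of n "\<lambda>_. 0" 0 k] n by simp
    ultimately show ?thesis by simp
  qed
  define I where "I = (LINT x:{0..1}|lborel. f j x)"
  have fi: "set_integrable lborel {0..1} (f j)"
    by (rule borel_integrable_atLeastAtMost') (rule continuous_on_subset[OF fc], simp)
  have I0: "0 \<le> I" unfolding I_def set_lebesgue_integral_def using f0 by (intro integral_nonneg_AE) auto
  have I1: "I \<le> 2 * R * h * A"
  proof -
    have tl: "t j - R * h \<le> t j + R * h" using R h by simp
    have "I \<le> (\<integral>x. A * indicator {t j - R * h..t j + R * h} x \<partial>lborel)"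
      unfolding I_def set_lebesgue_integral_def
    proof (rule integral_mono)
      show "integrable lborel (\<lambda>x. indicator {0..1} x *\<^sub>R f j x)" using fi by (simp add: set_integrable_def)
      show "integrable lborel (\<lambda>x. A * indicator {t j - R * h..t j + R * h} x)"
        using tl by (intro integrable_mult_right integrable_real_indicator) auto
      fix x
      show "indicator {0..1} x *\<^sub>R f j x \<le> A * indicator {t j - R * h..t j + R * h} x"
      proof (cases "f j x = 0")
        case False
        then have "x \<in> {t j - R * h..t j + R * h}" using fz[OF False] by (auto simp: abs_le_iff)
        then show ?thesis using f0[of j x] A by (simp add: indicator_def)
      qed (use A in simp)
    qed
    also have "\<dots> = 2 * R * h * A" using tl by simp
    finally show ?thesis .
  qed
  have nrm: "(L2_norm {0..1} (\<sigma> j))\<^sup>2 = 1 + I"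
  proof -
    have "(LINT x:{0..1}|lborel. (\<sigma> j x)\<^sup>2) = (LINT x:{0..1::real}|lborel. 1) + I"
      unfolding s2 I_def by (rule set_integral_add(2)[OF _ fi]) (simp add: set_integrable_def)
    also have "(LINT x:{0..1::real}|lborel. 1) = (1::real)" by (simp add: set_lebesgue_integral_def)
    finally show ?thesis using I0 by (simp add: L2_norm_def)
  qed
  have ns: "normalized_sq (\<sigma> j) x = 1 / (1 + I) + A / (1 + I) * \<psi> ((x - t j) / h)" for x
    unfolding normalized_sq_def nrm s2 by (simp add: f_def add_divide_distrib)
  have nf: "normalized_sq (\<sigma> j) = (\<lambda>x. 1 / (1 + I) + A / (1 + I) * \<psi> ((x - t j) / h))" by (rule ext) (rule ns)
  have "normalized_sq (\<sigma> j) \<in> hoelder_class {0..1} \<beta> (\<bar>A / (1 + I)\<bar> * 1 / h powr \<beta>)"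
    unfolding nf by (rule hoelder_class_affine[OF hol h(1)])
  moreover have "\<bar>A / (1 + I)\<bar> * 1 / h powr \<beta> \<le> L"
  proof -
    have "A / (1 + I) \<le> A / 1" using A I0 by (intro divide_left_mono) auto
    then have "A / (1 + I) / h powr \<beta> \<le> A / h powr \<beta>" by (intro divide_right_mono) auto
    then show ?thesis using A I0 by simp
  qed
  ultimately have H: "normalized_sq (\<sigma> j) \<in> hoelder_class {0..1} \<beta> L" by (rule hoelder_class_mono)
  have D: "ereal \<delta> \<le> dist_const {a..b} (\<sigma> j)"
  proof -
    have "(1 + A) / (1 + 2 * R * h * A) \<le> (1 + A) / (1 + I)"
      using I0 I1 A by (intro divide_left_mono) auto
    then have "\<delta> \<le> (1 + A) / (1 + I) - 1" using \<delta> by linarith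
    also have "\<dots> = normalized_sq (\<sigma> j) (t j) - 1" using one by (simp add: ns add_divide_distrib)
    also have "\<dots> \<le> \<bar>normalized_sq (\<sigma> j) (t j) - 1\<bar>" by simp
    finally have "ereal \<delta> \<le> ereal \<bar>normalized_sq (\<sigma> j) (t j) - 1\<bar>" by simp
    also have "\<dots> \<le> dist_const {a..b} (\<sigma> j)"
      unfolding dist_const_def
    proof (rule SUP_upper)
      have "3 * R * h * real j \<le> 3 * R * h * real m" using j(1) R h(1) by (intro mult_left_mono) auto
      also have "\<dots> \<le> b - a" using h(3) by (simp add: mult.commute)
      finally show "t j \<in> {a..b}" using R h(1) by (simp add: t_def)
    qed
    finally show ?thesis .
  qed
  have "(\<integral>\<omega>. g (observations n Z \<omega>) \<partial>P (\<sigma> j)) \<le> \<alpha> + sqrt \<eta> + 2 * \<eta>"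
    using j(2) level unfolding E1 E0 by linarith
  then show ?thesis using vs[of j] H D by blast
qed

section \<open>The asymptotic lower bound\<close>

text \<open>At the critical energy \<open>4 \<Lambda>\<close> the exponent would be \<open>\<kappa>\<close> times \<open>(1 + \<kappa>) (1 + 2 A) \<Lambda> - log m\<close>, which is
  positive. Lowering the bumps by \<open>1 - e / 2\<close> gains a factor \<open>(1 - e / 2)\<^sup>2\<close>, of which \<open>1 - e / 4\<close> is left after
  paying for \<open>\<kappa> = e / 4\<close> and for \<open>A\<close>; the error in \<open>log m\<close> takes half of that gain.\<close>

lemma mixture_error_bound:
  fixes m n :: nat
  assumes e: "0 < e" "e \<le> 1" and H: "0 \<le> H" "H \<le> e / 16" and \<Lambda>: "0 \<le> \<Lambda>"
    and energy: "real n * (H\<^sup>2 * h * N2) = 4 * \<Lambda>"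
    and m: "0 < m" "\<Lambda> - e * \<Lambda> / 8 \<le> ln (real m)"
  defines "\<kappa> \<equiv> e / 4" and "A \<equiv> (1 - e / 2) * H"
  shows "real m powr (-\<kappa>) * exp (\<kappa> * (1 + \<kappa>) / 4 * (1 + 2 * A) * (real n * (A\<^sup>2 * h * N2))) \<le> exp (- (e\<^sup>2 * \<Lambda> / 32))"
proof -
  have A: "0 \<le> A" "2 * A \<le> e / 8" using e H mult_right_mono[of "1 - e / 2" 1 H] by (auto simp: A_def)
  have energyA: "real n * (A\<^sup>2 * h * N2) = (1 - e / 2)\<^sup>2 * (4 * \<Lambda>)"
    unfolding energy[symmetric] by (simp add: A_def power_mult_distrib)
  have c: "(1 + \<kappa>) * (1 + 2 * A) * (1 - e / 2)\<^sup>2 \<le> 1 - e / 4"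
  proof -
    have "(1 + \<kappa>) * (1 - e / 2) \<le> 1 - e / 4" using e by (simp add: \<kappa>_def algebra_simps)
    moreover have "(1 + 2 * A) * (1 - e / 2) \<le> 1"
    proof -
      have "(1 + 2 * A) * (1 - e / 2) \<le> (1 + e / 8) * (1 - e / 2)" using A e by (intro mult_right_mono) auto
      also have "\<dots> \<le> 1" using e by (simp add: algebra_simps)
      finally show ?thesis .
    qed
    ultimately have "((1 + \<kappa>) * (1 - e / 2)) * ((1 + 2 * A) * (1 - e / 2)) \<le> (1 - e / 4) * 1"
      using e A by (intro mult_mono) auto
    then show ?thesis by (simp add: power2_eq_square mult_ac)
  qed
  have "real m powr (-\<kappa>) * exp (\<kappa> * (1 + \<kappa>) / 4 * (1 + 2 * A) * (real n * (A\<^sup>2 * h * N2)))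
    = exp (\<kappa> * (((1 + \<kappa>) * (1 + 2 * A) * (1 - e / 2)\<^sup>2) * \<Lambda> - ln (real m)))"
    unfolding energyA using m(1) by (simp add: powr_def exp_add[symmetric] algebra_simps)
  also have "\<dots> \<le> exp (\<kappa> * ((1 - e / 4) * \<Lambda> - (\<Lambda> - e * \<Lambda> / 8)))"
    using c m(2) \<Lambda> e by (simp add: \<kappa>_def) (intro mult_left_mono diff_mono mult_right_mono, auto)
  also have "\<kappa> * ((1 - e / 4) * \<Lambda> - (\<Lambda> - e * \<Lambda> / 8)) = - (e\<^sup>2 * \<Lambda> / 32)"
    by (simp add: \<kappa>_def field_simps power2_eq_square)
  finally show ?thesis .
qed

text \<open>Here \<open>w A\<close> bounds the total mass of a bump of height \<open>A\<close>. Half of the slack \<open>e\<close>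
  is spent in the definition of \<open>A\<close>, the other half pays for the normalization.\<close>

lemma separation_bound:
  fixes e H w :: real
  assumes e: "0 < e" "e \<le> 1" and H: "0 \<le> H" "H \<le> 1" and w: "0 \<le> w" "4 * w \<le> e"
  defines "A \<equiv> (1 - e / 2) * H"
  shows "(1 - e) * H \<le> (1 + A) / (1 + w * A) - 1"
proof -
  have A: "0 \<le> A" "A \<le> 1" using e H mult_mono[of "1 - e / 2" 1 H 1] by (auto simp: A_def)
  have w1: "w \<le> 1" using w e by linarith
  have pos: "0 < 1 + w * A" using w A by (simp add: add_pos_nonneg)
  have "(1 - e) * H * (1 + w * A) \<le> A * (1 - w)"
  proof -
    have "(1 - e) * (1 + w * A) \<le> (1 - e) * (1 + w)"
      using e A w by (intro mult_left_mono add_left_mono mult_left_le) auto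
    also have "\<dots> \<le> (1 - e / 2) * (1 - w)"
    proof -
      have "(1 - e / 2) * (1 - w) - (1 - e) * (1 + w) = e / 2 - 2 * w + 3 / 2 * (e * w)"
        by (simp add: field_simps)
      moreover have "0 \<le> e * w" using e w by simp
      ultimately show ?thesis using w by linarith
    qed
    finally have "(1 - e) * (1 + w * A) * H \<le> (1 - e / 2) * (1 - w) * H" using H by (intro mult_right_mono)
    then show ?thesis by (simp add: A_def mult_ac)
  qed
  also have "A * (1 - w) = (1 + A) - (1 + w * A)" by (simp add: algebra_simps)
  finally have "(1 - e) * H \<le> ((1 + A) - (1 + w * A)) / (1 + w * A)" using pos by (simp add: pos_le_divide_eq)
  also have "((1 + A) - (1 + w * A)) / (1 + w * A) = (1 + A) / (1 + w * A) - 1"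
    using pos by (subst diff_divide_distrib) simp
  finally show ?thesis .
qed

lemma nat_floor_ge_half:
  assumes "1 \<le> (y::real)"
  shows "0 < nat \<lfloor>y\<rfloor>" "y / 2 \<le> real (nat \<lfloor>y\<rfloor>)" "real (nat \<lfloor>y\<rfloor>) \<le> y"
proof -
  have f: "1 \<le> \<lfloor>y\<rfloor>" using assms by simp
  then show "0 < nat \<lfloor>y\<rfloor>" by simp
  have "real (nat \<lfloor>y\<rfloor>) = of_int \<lfloor>y\<rfloor>" using f by simp
  moreover have "of_int \<lfloor>y\<rfloor> \<le> y" "y < of_int \<lfloor>y\<rfloor> + 1" "1 \<le> real_of_int \<lfloor>y\<rfloor>" using f by linarith+
  ultimately show "y / 2 \<le> real (nat \<lfloor>y\<rfloor>)" "real (nat \<lfloor>y\<rfloor>) \<le> y" by linarith+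
qed

definition kernel_constant :: "real \<Rightarrow> real \<Rightarrow> (real \<Rightarrow> real) \<Rightarrow> real" where
  "kernel_constant \<beta> L \<psi> = (4 * L powr (1 / \<beta>) / ((2 * \<beta> + 1) * (L2_norm UNIV \<psi>)\<^sup>2)) powr (\<beta> / (2 * \<beta> + 1))"

text \<open>The bandwidth \<open>h\<close> solves \<open>n (L h\<^sup>\<beta>)\<^sup>2 h \<parallel>\<psi>\<parallel>\<^sup>2 = 4 log n / (2\<beta> + 1)\<close>, and then \<open>L h\<^sup>\<beta>\<close> is the kernel constant
  times the rate. Since \<open>\<epsilon> n\<close> eventually exceeds \<open>1 / sqrt (log n)\<close>, every error term that is of smaller order than
  \<open>1 / sqrt (log n)\<close> may be charged to \<open>\<epsilon> n\<close>.\<close>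

lemma limsup_power_le_level:
  fixes P :: "(real \<Rightarrow> real) \<Rightarrow> 'a measure" and \<phi> :: "nat \<Rightarrow> (nat \<Rightarrow> real) \<Rightarrow> real"
  assumes \<beta>: "0 < \<beta>" and L: "0 < L" and ker: "localized_kernel \<beta> R \<psi>"
    and model: "\<forall>\<sigma>. volatility \<sigma> \<longrightarrow> volatility_model (P \<sigma>) z0 \<sigma> Z"
    and test: "\<forall>n\<ge>1. is_test n (\<phi> n)"
    and null: "\<forall>n\<ge>1. (SUP v\<in>{0<..}. ereal (\<integral>\<omega>. \<phi> n (observations n Z \<omega>) \<partial>P (\<lambda>_. v))) \<le> ereal \<alpha>"
    and \<epsilon>: "\<forall>n\<ge>1. 0 < \<epsilon> n" "\<epsilon> \<longlonglongrightarrow> 0"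
      "filterlim (\<lambda>n. (\<epsilon> n)\<^sup>2 * ln (real n)) at_top sequentially"
    and ab: "a < b"
  shows "limsup (\<lambda>n. INF \<sigma> \<in> {\<sigma>. volatility \<sigma> \<and> normalized_sq \<sigma> \<in> hoelder_class {0..1} \<beta> L \<and>
            dist_const {a..b} \<sigma> \<ge> ereal ((1 - \<epsilon> n) * kernel_constant \<beta> L \<psi> * rate \<beta> n)}.
          ereal (\<integral>\<omega>. \<phi> n (observations n Z \<omega>) \<partial>P \<sigma>)) \<le> ereal \<alpha>"
    (is "limsup ?power \<le> _")
proof -
  have level: "(\<integral>\<omega>. \<phi> n (observations n Z \<omega>) \<partial>P (\<lambda>_. 1)) \<le> \<alpha>" if "1 \<le> n" for n
  proof -
    have "ereal (\<integral>\<omega>. \<phi> n (observations n Z \<omega>) \<partial>P (\<lambda>_. 1))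
      \<le> (SUP v\<in>{0<..}. ereal (\<integral>\<omega>. \<phi> n (observations n Z \<omega>) \<partial>P (\<lambda>_. v)))"
      by (rule SUP_upper) simp
    also have "\<dots> \<le> ereal \<alpha>" using null that by blast
    finally show ?thesis by simp
  qed
  define N2 where "N2 = (\<integral>x. (\<psi> x)\<^sup>2 \<partial>lborel)"
  have N2: "0 < N2" "(L2_norm UNIV \<psi>)\<^sup>2 = N2"
    using localized_kernel_square_integral[OF ker] by (auto simp: N2_def)
  have R: "0 < R" using ker by (simp add: localized_kernel_def)
  define p where "p = 1 / (2 * \<beta> + 1)"
  have p: "0 < p" "p < 1" "p * (2 * \<beta> + 1) = 1" using \<beta> by (auto simp: p_def)
  define K where "K = 4 / (L\<^sup>2 * (2 * \<beta> + 1) * N2)"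
  have K: "0 < K" using \<beta> L N2 by (simp add: K_def)
  define h where "h = (\<lambda>n::nat. (K * (ln (real n) / real n)) powr p)"
  define H where "H = (\<lambda>n. L * h n powr \<beta>)"
  (* p * ln (ln n) + C is the amount by which ln m may fall short of p * ln n. *)
  define C where "C = p * ln K - ln ((b - a) / (6 * R))"
  define s where "s = (\<lambda>n::nat. sqrt (ln (real n)))"
  define D where "D = (\<lambda>n::nat. p * ln (ln (real n)) + C)"
  have ev_eps: "eventually (\<lambda>n. 1 / s n \<le> \<epsilon> n) sequentially"
  proof -
    have "eventually (\<lambda>n. 1 \<le> (\<epsilon> n)\<^sup>2 * ln (real n)) sequentially"
      using \<epsilon>(3) by (simp add: filterlim_at_top)
    then show ?thesis using eventually_gt_at_top[of 1]
    proof eventually_elim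
      fix n :: nat assume n: "1 < n" and le: "1 \<le> (\<epsilon> n)\<^sup>2 * ln (real n)"
      have e: "0 < \<epsilon> n" using \<epsilon>(1) n by simp
      have l: "0 < ln (real n)" using n by simp
      have sq: "1\<^sup>2 \<le> (\<epsilon> n * s n)\<^sup>2" using le l by (simp add: s_def power_mult_distrib)
      have "1 \<le> \<epsilon> n * s n" by (rule power2_le_imp_le[OF sq]) (use e l in \<open>simp add: s_def\<close>)
      then show "1 / s n \<le> \<epsilon> n" using l by (simp add: s_def field_simps)
    qed
  qed
  have small: "eventually (\<lambda>n. q * x n \<le> \<epsilon> n) sequentially"
    if "(\<lambda>n. x n * s n) \<longlonglongrightarrow> 0" "0 < q" for x q
  proof -
    have "eventually (\<lambda>n. x n * s n < 1 / q) sequentially"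
      using that by (intro order_tendstoD(2)[of _ 0]) auto
    then show ?thesis using ev_eps eventually_gt_at_top[of 1]
    proof eventually_elim
      fix n :: nat assume n: "1 < n" and le: "x n * s n < 1 / q" "1 / s n \<le> \<epsilon> n"
      have "0 < s n" using n by (simp add: s_def)
      then have "q * x n \<le> 1 / s n" using le that(2) by (simp add: field_simps)
      then show "q * x n \<le> \<epsilon> n" using le by linarith
    qed
  qed
  have "(\<lambda>n. h n * s n) \<longlonglongrightarrow> 0" unfolding h_def s_def using K p by real_asymp
  then have e1: "eventually (\<lambda>n. 8 * R * h n \<le> \<epsilon> n) sequentially" using R by (intro small) auto
  have "(\<lambda>n. h n powr \<beta> * s n) \<longlonglongrightarrow> 0" unfolding h_def s_def using K p \<beta> by real_asymp
  then have e2: "eventually (\<lambda>n. 16 * L * h n powr \<beta> \<le> \<epsilon> n) sequentially" using L by (intro small) auto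
  have "filterlim (\<lambda>n. real n * h n) at_top sequentially" unfolding h_def using K p by real_asymp
  then have e3: "eventually (\<lambda>n. 1 / R \<le> real n * h n) sequentially" by (simp add: filterlim_at_top)
  have "h \<longlonglongrightarrow> 0" unfolding h_def using K p by real_asymp
  then have e4: "eventually (\<lambda>n. h n < (b - a) / (3 * R)) sequentially"
    using ab R by (intro order_tendstoD(2)[of _ 0]) auto
  have "(\<lambda>n. D n / s n) \<longlonglongrightarrow> 0" unfolding D_def s_def using p by real_asymp
  then have e5: "eventually (\<lambda>n. D n / s n < p / 8) sequentially"
    using p by (intro order_tendstoD(2)[of _ 0]) auto
  have e6: "eventually (\<lambda>n. \<epsilon> n < 1) sequentially" using \<epsilon>(2) by (intro order_tendstoD(2)[of _ 0]) auto
  define B where "B = (\<lambda>n. exp (- ((\<epsilon> n)\<^sup>2 * (p * ln (real n)) / 32)))"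
  have bound: "eventually (\<lambda>n. ?power n \<le> ereal (\<alpha> + sqrt (B n) + 2 * B n)) sequentially"
    using e1 e2 e3 e4 e5 e6 ev_eps eventually_gt_at_top[of 1]
  proof eventually_elim
    fix n :: nat
    assume hR: "8 * R * h n \<le> \<epsilon> n" and hL: "16 * L * h n powr \<beta> \<le> \<epsilon> n" and nh: "1 / R \<le> real n * h n"
      and hab: "h n < (b - a) / (3 * R)" and Ds: "D n / s n < p / 8" and e1: "\<epsilon> n < 1"
      and es: "1 / s n \<le> \<epsilon> n" and n: "1 < n"
    have e0: "0 < \<epsilon> n" using \<epsilon>(1) n by simp
    have ln: "0 < ln (real n)" using n by simp
    let ?x = "ln (real n) / real n" and ?\<Lambda> = "p * ln (real n)"
    have x: "0 < ?x" using ln n by simp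
    have h: "0 < h n" using mult_pos_pos[OF K x] unfolding h_def powr_gt_zero by (rule less_imp_neq[symmetric])
    have H0: "0 \<le> H n" "H n \<le> \<epsilon> n / 16" using L hL by (auto simp: H_def)
    let ?y = "(b - a) / (3 * R * h n)"
    define m where "m = nat \<lfloor>?y\<rfloor>"
    have y1: "1 \<le> ?y" using hab R h by (simp add: field_simps)
    note m = nat_floor_ge_half[OF y1, folded m_def]
    have lnh: "ln (h n) = p * (ln K + ln (ln (real n)) - ln (real n))"
    proof -
      have "ln ?x = ln (ln (real n)) - ln (real n)" using ln n by (intro ln_divide_pos) auto
      moreover have "ln (K * ?x) = ln K + ln ?x" using K x by (rule ln_mult_pos)
      moreover have "ln (h n) = p * ln (K * ?x)" unfolding h_def by (rule ln_powr)
      ultimately show ?thesis by simp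
    qed
    have lnm: "?\<Lambda> - \<epsilon> n * ?\<Lambda> / 8 \<le> ln (real m)"
    proof -
      have "?y / 2 = (b - a) / (6 * R) / h n" using R h by (simp add: field_simps)
      moreover have "ln ((b - a) / (6 * R) / h n) = ln ((b - a) / (6 * R)) - ln (h n)"
        using ab R h by (intro ln_divide_pos) auto
      ultimately have "ln (?y / 2) = ln ((b - a) / (6 * R)) - ln (h n)" by (simp only:)
      also have "\<dots> = ?\<Lambda> - D n" unfolding lnh D_def C_def by (simp add: algebra_simps)
      finally have "?\<Lambda> - D n = ln (?y / 2)" by (rule sym)
      also have "\<dots> \<le> ln (real m)" using m(1,2) y1 by (intro ln_mono) auto
      finally have "?\<Lambda> - D n \<le> ln (real m)" .
      moreover have "D n \<le> \<epsilon> n * ?\<Lambda> / 8"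
      proof -
        have s: "0 < s n" "s n * s n = ln (real n)" using ln by (auto simp: s_def)
        have "D n \<le> p / 8 * s n" using Ds s(1) by (simp add: pos_divide_less_eq)
        also have "\<dots> \<le> p / 8 * (\<epsilon> n * (s n * s n))"
        proof -
          have "1 \<le> \<epsilon> n * s n" using es s(1) by (simp add: pos_divide_le_eq)
          then have "1 * s n \<le> \<epsilon> n * s n * s n" using s(1) by (intro mult_right_mono) auto
          then show ?thesis using p by (simp add: mult_ac)
        qed
        also have "\<dots> = \<epsilon> n * ?\<Lambda> / 8" unfolding s(2) by simp
        finally show ?thesis .
      qed
      ultimately show ?thesis by linarith
    qed
    have hpow: "h n powr \<beta> = (K * ?x) powr (p * \<beta>)" by (simp add: h_def powr_powr)
    have energy: "real n * ((H n)\<^sup>2 * h n * N2) = 4 * ?\<Lambda>"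
    proof -
      have "(h n powr \<beta>)\<^sup>2 * h n = h n powr (2 * \<beta> + 1)"
        using h by (simp add: powr_add powr_powr mult.commute flip: powr_numeral)
      also have "\<dots> = (K * ?x) powr (p * (2 * \<beta> + 1))" by (simp only: h_def powr_powr)
      also have "\<dots> = K * ?x" unfolding p(3) by (rule powr_one) (use K x in \<open>intro mult_nonneg_nonneg less_imp_le\<close>)
      finally have hh: "(h n powr \<beta>)\<^sup>2 * h n = K * ?x" .
      have "(H n)\<^sup>2 * h n * N2 = L\<^sup>2 * N2 * ((h n powr \<beta>)\<^sup>2 * h n)"
        by (simp only: H_def power_mult_distrib mult_ac)
      then have "(H n)\<^sup>2 * h n * N2 = L\<^sup>2 * N2 * (K * ?x)" unfolding hh .
      then show ?thesis using n L N2 \<beta> by (simp add: K_def p_def)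
    qed
    have crho: "kernel_constant \<beta> L \<psi> * rate \<beta> n = H n"
    proof -
      have pb: "\<beta> / (2 * \<beta> + 1) = p * \<beta>" by (simp add: p_def)
      have "4 * L powr (1 / \<beta>) / ((2 * \<beta> + 1) * N2) = L powr (2 + 1 / \<beta>) * K"
        using L by (simp add: K_def powr_add)
      then have "kernel_constant \<beta> L \<psi> * rate \<beta> n = (L powr (2 + 1 / \<beta>) * K) powr (p * \<beta>) * ?x powr (p * \<beta>)"
        unfolding kernel_constant_def rate_def N2(2) pb by simp
      also have "\<dots> = L powr ((2 + 1 / \<beta>) * (p * \<beta>)) * (K * ?x) powr (p * \<beta>)"
        by (simp only: powr_mult powr_powr mult.assoc)
      also have "(2 + 1 / \<beta>) * (p * \<beta>) = 1" using p(3) \<beta> by (simp add: field_simps)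
      finally show ?thesis using L by (simp add: H_def hpow)
    qed
    define A where "A = (1 - \<epsilon> n / 2) * H n"
    have A0: "0 \<le> A" using H0 e1 by (simp add: A_def)
    have AH: "A \<le> H n" using H0 e0 mult_right_mono[of "1 - \<epsilon> n / 2" 1 "H n"] by (simp add: A_def)
    define \<eta> where "\<eta> = real m powr (- (\<epsilon> n / 4)) *
      exp (\<epsilon> n / 4 * (1 + \<epsilon> n / 4) / 4 * (1 + 2 * A) * (real n * (A\<^sup>2 * h n * (\<integral>x. (\<psi> x)\<^sup>2 \<partial>lborel))))"
    have "\<exists>\<sigma>. volatility \<sigma> \<and> normalized_sq \<sigma> \<in> hoelder_class {0..1} \<beta> L \<and>
      ereal ((1 - \<epsilon> n) * H n) \<le> dist_const {a..b} \<sigma> \<and>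
      (\<integral>\<omega>. \<phi> n (observations n Z \<omega>) \<partial>P \<sigma>) \<le> \<alpha> + sqrt \<eta> + 2 * \<eta>"
      unfolding \<eta>_def
    proof (rule lower_bound_fixed_n[OF ker L])
      show "volatility_model (P \<sigma>) z0 \<sigma> Z" if "volatility \<sigma>" for \<sigma> using model that by blast
      show "is_test n (\<phi> n)" "(\<integral>\<omega>. \<phi> n (observations n Z \<omega>) \<partial>P (\<lambda>_. 1)) \<le> \<alpha>"
        using test level[of n] n by auto
      show "0 < n" "0 < m" "0 < h n" using n m h by auto
      show "1 / real n \<le> R * h n" using nh n R by (simp add: field_simps)
      show "real m * (3 * R * h n) \<le> b - a" using m(3) R h by (simp add: pos_le_divide_eq)
      show "0 \<le> A" by (rule A0)
      show "A \<le> 1 / 2" using AH H0 e1 by linarith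
      show "A / h n powr \<beta> \<le> L" using AH h by (simp add: H_def pos_divide_le_eq)
      show "0 \<le> \<epsilon> n / 4" "\<epsilon> n / 4 \<le> 1" using e0 e1 by auto
      show "(1 - \<epsilon> n) * H n \<le> (1 + A) / (1 + 2 * R * h n * A) - 1"
        unfolding A_def by (rule separation_bound) (use e0 e1 H0 hR R h in auto)
    qed
    then obtain \<sigma> where \<sigma>: "volatility \<sigma>" "normalized_sq \<sigma> \<in> hoelder_class {0..1} \<beta> L"
      "ereal ((1 - \<epsilon> n) * H n) \<le> dist_const {a..b} \<sigma>"
      "(\<integral>\<omega>. \<phi> n (observations n Z \<omega>) \<partial>P \<sigma>) \<le> \<alpha> + sqrt \<eta> + 2 * \<eta>" by blast
    have "\<eta> \<le> B n"
      unfolding \<eta>_def B_def A_def N2_def[symmetric]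
      by (rule mixture_error_bound) (use e0 e1 H0 p ln energy m(1) lnm in auto)
    then have "(\<integral>\<omega>. \<phi> n (observations n Z \<omega>) \<partial>P \<sigma>) \<le> \<alpha> + sqrt (B n) + 2 * B n"
      using \<sigma>(4) real_sqrt_le_mono[of \<eta> "B n"] by linarith
    then show "?power n \<le> ereal (\<alpha> + sqrt (B n) + 2 * B n)"
      using \<sigma>(1-3) by (intro INF_lower2[of \<sigma>]) (auto simp: crho mult.assoc)
  qed
  have "B \<longlonglongrightarrow> 0"
  proof -
    have "filterlim (\<lambda>n. p / 32 * ((\<epsilon> n)\<^sup>2 * ln (real n))) at_top sequentially"
      using p by (intro filterlim_tendsto_pos_mult_at_top[OF tendsto_const _ \<epsilon>(3)]) auto
    then have "filterlim (\<lambda>n. - (p / 32 * ((\<epsilon> n)\<^sup>2 * ln (real n)))) at_bot sequentially"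
      by (simp add: filterlim_uminus_at_bot)
    then have "(\<lambda>n. exp (- (p / 32 * ((\<epsilon> n)\<^sup>2 * ln (real n))))) \<longlonglongrightarrow> 0"
      by (rule filterlim_compose[OF exp_at_bot])
    then show ?thesis by (simp add: B_def mult_ac)
  qed
  then have "(\<lambda>n. \<alpha> + sqrt (B n) + 2 * B n) \<longlonglongrightarrow> \<alpha> + sqrt 0 + 2 * 0"
    by (intro tendsto_intros)
  then have "(\<lambda>n. ereal (\<alpha> + sqrt (B n) + 2 * B n)) \<longlonglongrightarrow> ereal \<alpha>" by simp
  then have "limsup (\<lambda>n. ereal (\<alpha> + sqrt (B n) + 2 * B n)) = ereal \<alpha>"
    by (intro lim_imp_Limsup) auto
  then show ?thesis using Limsup_mono[OF bound] by simp
qed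

theorem theorem3p1:
  fixes \<beta> L :: real
  assumes "0 < \<beta>" and "0 < L"
  shows "\<exists>c>0. (\<beta> \<le> 1 \<longrightarrow> c = c_star \<beta> L) \<and>
    (\<forall>(P :: (real \<Rightarrow> real) \<Rightarrow> 'a measure) (Z :: real \<Rightarrow> 'a \<Rightarrow> real) (z0 :: real)
      (\<alpha> :: real) (\<phi> :: nat \<Rightarrow> (nat \<Rightarrow> real) \<Rightarrow> real) (\<epsilon> :: nat \<Rightarrow> real) (a :: real) (b :: real).
      (\<forall>\<sigma>. volatility \<sigma> \<longrightarrow> volatility_model (P \<sigma>) z0 \<sigma> Z) \<longrightarrow>
      0 < \<alpha> \<and> \<alpha> < 1 \<longrightarrow>
      (\<forall>n\<ge>1. is_test n (\<phi> n)) \<longrightarrow>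
      (\<forall>n\<ge>1. (SUP v\<in>{0<..}. ereal (\<integral>\<omega>. \<phi> n (observations n Z \<omega>) \<partial>P (\<lambda>_. v))) \<le> ereal \<alpha>) \<longrightarrow>
      (\<forall>n\<ge>1. 0 < \<epsilon> n) \<longrightarrow>
      \<epsilon> \<longlonglongrightarrow> 0 \<longrightarrow>
      filterlim (\<lambda>n. (\<epsilon> n)\<^sup>2 * ln (real n)) at_top sequentially \<longrightarrow>
      0 < a \<and> a < b \<and> b < 1 \<longrightarrow>
      limsup (\<lambda>n. INF \<sigma> \<in> {\<sigma>. volatility \<sigma> \<and>
            normalized_sq \<sigma> \<in> hoelder_class {0..1} \<beta> L \<and>
            dist_const {a..b} \<sigma> \<ge> ereal ((1 - \<epsilon> n) * c * rate \<beta> n)}.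
          ereal (\<integral>\<omega>. \<phi> n (observations n Z \<omega>) \<partial>P \<sigma>))
        \<le> ereal \<alpha>)"
proof -
  obtain R \<psi> where ker: "localized_kernel \<beta> R \<psi>" and opt: "\<beta> \<le> 1 \<Longrightarrow> \<psi> = recovery_kernel \<beta>"
  proof (cases "\<beta> \<le> 1")
    case True
    then show ?thesis using that localized_kernel_recovery_kernel[OF assms(1) True] by blast
  next
    case False
    then show ?thesis using that ex_localized_kernel[OF assms(1)] by blast
  qed
  have pos: "0 < kernel_constant \<beta> L \<psi>"
    using localized_kernel_square_integral(2,3)[OF ker] assms by (simp add: kernel_constant_def)
  show ?thesis
  proof (intro exI[of _ "kernel_constant \<beta> L \<psi>"] conjI allI impI)
    show "0 < kernel_constant \<beta> L \<psi>" by (rule pos)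
    show "kernel_constant \<beta> L \<psi> = c_star \<beta> L" if "\<beta> \<le> 1"
      using opt[OF that] by (simp add: kernel_constant_def c_star_def)
  qed (rule limsup_power_le_level[OF assms ker]; (assumption | simp))
qed

end
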